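(* Let $T$ be a spherically symmetric tree with spherically symmetric edge probabilities $(p_n)_{n\ge1}$ satisfying $0<\inf_n p_n\le \sup_n p_n<1$, and let $w_n$ be the expected number of vertices at level $n$ connected to the root at a fixed time. Consider dynamical percolation on $T$. (i) If $$\lim_{n\to\infty} \frac{w_n}{n(\log n)^{\alpha}}=\infty$$ for some $\alpha>2$, then there are no exceptional times of nonpercolation; that is, almost surely there is an infinite open cluster at every time $t$. (ii) If $w_n\asymp n(\log n)^{\alpha}$ (for $n\ge 2$) for some $1<\alpha\le 2$, then there are exceptional times of nonpercolation; that is, almost surely there exists a time $t$ at which there is no infinite open cluster.
   Context: A spherically symmetric tree with spherically symmetric edge probabilities is an infinite locally finite rooted tree with root $\rho$ in which all vertices on a given level (distance from $\rho$) have the same number of children, and in which every edge joining level $n-1$ to level $n$ has the same probability $p_n$. $T_n$ denotes the set of vertices at level $n$. In static percolation each edge between levels $n-1$ and $n$ is independently open with probability $p_n$; $W_n=|\{x\in T_n: x \text{ is connected to }\rho\text{ by open edges}\}|$ and $w_n=\mathbf E[W_n]=|T_n|\prod_{i=1}^n p_i$. Dynamical percolation: edges evolve independently as two-state continuous time Markov chains, an edge of probability $p$ switching from closed to open at rate $p$ and from open to closed at rate $1-p$, started from the stationary product measure; times $t\in[0,\infty)$. Convention: an edge is declared open at the times at which it changes state. $a_n\asymp b_n$ means that the ratio $a_n/b_n$ is bounded between two positive finite constants. *)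

theory Defs
  imports "HOL-Probability.Probability"
begin

section \<open>Rooted trees\<close>

text \<open>A graph is given by a vertex set \<open>V\<close> and a set \<open>E\<close> of two-element subsets of \<open>V\<close>.
  The same functions are applied to the full edge set and to random sets of open edges.\<close>

definition adj :: "'v set set \<Rightarrow> 'v rel" where
  "adj E = {(x, y). {x, y} \<in> E}"

definition simple_graph :: "'v set \<Rightarrow> 'v set set \<Rightarrow> bool" where
  "simple_graph V E \<longleftrightarrow> (\<forall>e\<in>E. \<exists>x\<in>V. \<exists>y\<in>V. x \<noteq> y \<and> e = {x, y})"

definition simple_path :: "'v set set \<Rightarrow> 'v \<Rightarrow> 'v list \<Rightarrow> 'v \<Rightarrow> bool" where
  "simple_path E x xs y \<longleftrightarrow>
     xs \<noteq> [] \<and> hd xs = x \<and> last xs = y \<and> distinct xs \<and> successively (\<lambda>u v. {u, v} \<in> E) xs"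

definition tree :: "'v set \<Rightarrow> 'v set set \<Rightarrow> bool" where
  "tree V E \<longleftrightarrow> simple_graph V E \<and> (\<forall>x\<in>V. \<forall>y\<in>V. \<exists>!xs. simple_path E x xs y)"

text \<open>Graph distance from the root (meaningful for vertices connected to the root).\<close>

definition level :: "'v set set \<Rightarrow> 'v \<Rightarrow> 'v \<Rightarrow> nat" where
  "level E \<rho> x = (LEAST n. (\<rho>, x) \<in> adj E ^^ n)"

definition level_set :: "'v set \<Rightarrow> 'v set set \<Rightarrow> 'v \<Rightarrow> nat \<Rightarrow> 'v set" where
  "level_set V E \<rho> n = {x \<in> V. level E \<rho> x = n}"

definition children :: "'v set set \<Rightarrow> 'v \<Rightarrow> 'v \<Rightarrow> 'v set" where
  "children E \<rho> x = {y. {x, y} \<in> E \<and> level E \<rho> y = Suc (level E \<rho> x)}"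

definition spherically_symmetric_tree :: "'v set \<Rightarrow> 'v set set \<Rightarrow> 'v \<Rightarrow> bool" where
  "spherically_symmetric_tree V E \<rho> \<longleftrightarrow>
     tree V E \<and> \<rho> \<in> V \<and> infinite V \<and> (\<forall>x\<in>V. finite {y. {x, y} \<in> E}) \<and>
     (\<forall>x\<in>V. \<forall>y\<in>V. level E \<rho> x = level E \<rho> y \<longrightarrow>
        card (children E \<rho> x) = card (children E \<rho> y))"

text \<open>The edge joining level \<open>n - 1\<close> to level \<open>n\<close> has edge level \<open>n\<close>; its probability is \<open>p n\<close>,
  so that \<open>p 0\<close> is never used.\<close>

definition edge_level :: "'v set set \<Rightarrow> 'v \<Rightarrow> 'v set \<Rightarrow> nat" where
  "edge_level E \<rho> e = Max (level E \<rho> ` e)"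

definition cluster :: "'v set set \<Rightarrow> 'v \<Rightarrow> 'v set" where
  "cluster F x = {y. (x, y) \<in> (adj F)\<^sup>*}"

definition percolates :: "'v set \<Rightarrow> 'v set set \<Rightarrow> bool" where
  "percolates V F \<longleftrightarrow> (\<exists>x\<in>V. infinite (cluster F x))"


section \<open>Static percolation\<close>

definition static_percolation ::
    "'v set set \<Rightarrow> 'v \<Rightarrow> (nat \<Rightarrow> real) \<Rightarrow> ('v set \<Rightarrow> bool) measure" where
  "static_percolation E \<rho> p =
     (\<Pi>\<^sub>M e\<in>E. measure_pmf (bernoulli_pmf (p (edge_level E \<rho> e))))"

definition W_perc :: "'v set \<Rightarrow> 'v set set \<Rightarrow> 'v \<Rightarrow> nat \<Rightarrow> ('v set \<Rightarrow> bool) \<Rightarrow> nat" where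
  "W_perc V E \<rho> n \<omega> = card {x \<in> level_set V E \<rho> n. x \<in> cluster {e \<in> E. \<omega> e} \<rho>}"

definition w_perc :: "'v set \<Rightarrow> 'v set set \<Rightarrow> 'v \<Rightarrow> (nat \<Rightarrow> real) \<Rightarrow> nat \<Rightarrow> real" where
  "w_perc V E \<rho> p n = (\<integral>\<omega>. real (W_perc V E \<rho> n \<omega>) \<partial>static_percolation E \<rho> p)"


section \<open>Dynamical percolation\<close>

text \<open>A two-state continuous time Markov chain in its jump chain/holding time description.
  States are Booleans (\<open>True\<close> is open), \<open>b\<close> is the initial state, and \<open>u\<close> is a sequence of
  variables which will be independent standard exponentials; the \<open>k\<close>-th holding time
  \<open>u k / (rate of leaving the current state)\<close> is then exponential with that rate.\<close>

definition chain_state :: "bool \<Rightarrow> nat \<Rightarrow> bool" where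
  "chain_state b k = (if even k then b else \<not> b)"

definition leave_rate :: "real \<Rightarrow> bool \<Rightarrow> real" where
  "leave_rate p s = (if s then 1 - p else p)"

definition jump_time :: "real \<Rightarrow> bool \<Rightarrow> (nat \<Rightarrow> real) \<Rightarrow> nat \<Rightarrow> real" where
  "jump_time p b u k = (\<Sum>i<k. u i / leave_rate p (chain_state b i))"

text \<open>Both end points of the holding interval are included: an edge is open at the times at
  which it changes state, in either direction.\<close>

definition open_at :: "real \<Rightarrow> bool \<Rightarrow> (nat \<Rightarrow> real) \<Rightarrow> real \<Rightarrow> bool" where
  "open_at p b u t \<longleftrightarrow>
     (\<exists>k. chain_state b k \<and> jump_time p b u k \<le> t \<and> t \<le> jump_time p b u (Suc k))"

text \<open>\<open>X e t \<omega>\<close> says that the edge \<open>e\<close> is open at time \<open>t \<ge> 0\<close>. The pairs of initial state and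
  standardised holding times are independent over the edges; for each edge the initial state is
  Bernoulli (the stationary law) and independent of the i.i.d. exponential sequence.\<close>

definition dynamical_percolation ::
    "'v set set \<Rightarrow> 'v \<Rightarrow> (nat \<Rightarrow> real) \<Rightarrow> 'w measure \<Rightarrow> ('v set \<Rightarrow> real \<Rightarrow> 'w \<Rightarrow> bool) \<Rightarrow> bool" where
  "dynamical_percolation E \<rho> p M X \<longleftrightarrow>
     prob_space M \<and>
     (\<exists>(B :: 'v set \<Rightarrow> 'w \<Rightarrow> bool) (U :: 'v set \<Rightarrow> 'w \<Rightarrow> nat \<Rightarrow> real).
        prob_space.indep_vars M
          (\<lambda>_. count_space UNIV \<Otimes>\<^sub>M (\<Pi>\<^sub>M k\<in>UNIV. borel)) (\<lambda>e \<omega>. (B e \<omega>, U e \<omega>)) E \<and>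
        (\<forall>e\<in>E. distr M (count_space UNIV \<Otimes>\<^sub>M (\<Pi>\<^sub>M k\<in>UNIV. borel)) (\<lambda>\<omega>. (B e \<omega>, U e \<omega>)) =
           measure_pmf (bernoulli_pmf (p (edge_level E \<rho> e))) \<Otimes>\<^sub>M
           (\<Pi>\<^sub>M k\<in>UNIV. density lborel (exponential_density 1))) \<and>
        (AE \<omega> in M. \<forall>e\<in>E. \<forall>t\<ge>0.
           X e t \<omega> \<longleftrightarrow> open_at (p (edge_level E \<rho> e)) (B e \<omega>) (U e \<omega>) t))"

definition open_edges ::
    "'v set set \<Rightarrow> ('v set \<Rightarrow> real \<Rightarrow> 'w \<Rightarrow> bool) \<Rightarrow> real \<Rightarrow> 'w \<Rightarrow> 'v set set" where
  "open_edges E X t \<omega> = {e \<in> E. X e t \<omega>}"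

end

theory Submission
  imports Defs "HOL-Real_Asymp.Real_Asymp"
begin

text \<open>(i) Let \<open>n\<^sub>j\<^sub>+\<^sub>1 = n\<^sub>j\<^sup>2\<close> and cut time into intervals of length \<open>1/n\<^sub>j\<^sup>2\<close>. The vertices of level \<open>n\<^sub>j\<^sub>+\<^sub>1\<close>
  that are reached through edges which stay open during the whole interval around \<open>t\<close> of their scale
  lose against \<open>w\<close> only a summable proportion per scale: by a second order expansion of the Laplace
  transform, a loss of \<open>\<kappa>\<close> has probability at most \<open>exp (- c \<kappa>\<^sup>2 / (\<Sum>\<^bsub>k\<ge>n\<^sub>j\<^esub> 1/w\<^sub>k))\<close>, and for \<open>\<alpha> > 2\<close> this is
  smaller than any power of \<open>1/n\<^sub>j\<close>, which beats the number of intervals.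

  (ii) The times at which a given vertex is cut off from infinity form an open set, so by Baire's
  theorem it is enough that this set is dense. For that, look at finitely many grid times in a short
  interval. Each vertex \<open>b\<close> at a large depth below the given one gets a scale \<open>n\<^sub>b\<close> of its own. Since
  \<open>\<Sum> 1/w\<^sub>k\<close> converges, \<open>b\<close> has typically few (at most \<open>\<eta> w\<close>) descendants at level \<open>n\<^sub>b\<close>; given these, the event
  that all of them die before level \<open>(2 n\<^sub>b)\<^sup>2\<close>, divided by its conditional probability, has mean nearly 1.
  The correlation of these weights at two times is controlled by the generating function of the pair
  process: it is at most a power of \<open>n\<^sub>b\<close>, and close to 1 as soon as the times are farther apart than
  a negative power of \<open>n\<^sub>b\<close>. With scales that increase fast enough the average over the grid of the
  products over \<open>b\<close> concentrates at 1, so that at some grid time all these descendants die.\<close>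

section \<open>Functions of finitely many independent discrete variables\<close>

text \<open>The exponent 2 has one source in both parts. Over one scale, from \<open>n\<close> to
  about \<open>n\<^sup>2\<close>, the sum of \<open>1/w\<close> is of order
  \<open>(log n)^(1 - \<alpha>)\<close>, and it competes with \<open>log n\<close>, the logarithm of
  the number of distinguishable times. In (i) the deviations have exponent
  \<open>(log n)^(\<alpha> - 1)\<close>, which wins for \<alpha> > 2. In (ii) survival probability
  times \<open>w\<close> is at most of order \<open>log n\<close>, so the death of about
  \<open>w\<close> vertices costs only a power of \<open>n\<close>. That power is the obstacle in
  (ii). The second moment over a grid tolerates a correction \<open>n^(1/4)\<close> from near times,
  because pairs closer than \<open>n^(-1/2)\<close> form a fraction of order
  \<open>n^(-1/2)\<close>. The given vertex, however, typically has about \<open>w\<close>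
  descendants, and the resulting power is too large. A threshold \<open>\<eta> * w\<close> with
  small \<eta> is typical only for vertices \<open>b\<close> far down, each of which carries a small
  part of the total. All of them at one scale would multiply their corrections back to the large
  power; at separate scales each correction is paid for by its own small fraction of near
  pairs.\<close>

definition depends_on :: "(('a \<Rightarrow> 'b) \<Rightarrow> 'c) \<Rightarrow> 'a set \<Rightarrow> bool" where
  "depends_on F J \<longleftrightarrow> (\<forall>\<omega> \<omega>'. (\<forall>v\<in>J. \<omega> v = \<omega>' v) \<longrightarrow> F \<omega> = F \<omega>')"

lemma depends_onI:
  assumes "\<And>\<omega> \<omega>'. (\<And>v. v \<in> J \<Longrightarrow> \<omega> v = \<omega>' v) \<Longrightarrow> F \<omega> = F \<omega>'"
  shows "depends_on F J"
  unfolding depends_on_def by (intro allI impI assms) (erule bspec)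

lemma depends_onD:
  assumes "depends_on F J" "\<And>v. v \<in> J \<Longrightarrow> \<omega> v = \<omega>' v"
  shows "F \<omega> = F \<omega>'"
  by (rule assms(1)[unfolded depends_on_def, rule_format]) (rule assms(2))

lemma depends_on_mono: "depends_on F J \<Longrightarrow> J \<subseteq> K \<Longrightarrow> depends_on F K"
  by (intro depends_onI) (erule depends_onD, simp add: subset_iff)

lemma depends_on_const [simp]: "depends_on (\<lambda>_. c) J"
  by (rule depends_onI) simp

lemma depends_on_compose: "depends_on F J \<Longrightarrow> depends_on (\<lambda>\<omega>. g (F \<omega>)) J"
  by (intro depends_onI arg_cong[of _ _ g]) (rule depends_onD)

lemma depends_on_compose2:
  "depends_on F J \<Longrightarrow> depends_on G J \<Longrightarrow> depends_on (\<lambda>\<omega>. g (F \<omega>) (G \<omega>)) J"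
  by (intro depends_onI arg_cong2[of _ _ _ _ g]) (rule depends_onD; assumption)+

lemma depends_on_prod:
  assumes "\<And>c. c \<in> C \<Longrightarrow> depends_on (F c) J"
  shows "depends_on (\<lambda>\<omega>. \<Prod>c\<in>C. F c \<omega> :: real) J"
  by (intro depends_onI prod.cong refl) (rule depends_onD[OF assms])

lemma expectation_pair_pmf_mult:
  fixes f :: "'a \<Rightarrow> real" and g :: "'b \<Rightarrow> real"
  assumes "finite (set_pmf p)" "finite (set_pmf q)"
  shows "measure_pmf.expectation (pair_pmf p q) (\<lambda>(a, b). f a * g b) =
    measure_pmf.expectation p f * measure_pmf.expectation q g"
proof -
  have "measure_pmf.expectation (pair_pmf p q) (\<lambda>(a, b). f a * g b) =
    (\<Sum>(a, b)\<in>set_pmf p \<times> set_pmf q. (f a * pmf p a) * (g b * pmf q b))"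
    by (subst integral_measure_pmf_real[where A = "set_pmf p \<times> set_pmf q"])
       (use assms in \<open>auto simp: pmf_pair intro!: sum.cong\<close>)
  also have "\<dots> = (\<Sum>a\<in>set_pmf p. f a * pmf p a) * (\<Sum>b\<in>set_pmf q. g b * pmf q b)"
    by (simp add: sum_product sum.cartesian_product)
  also have "\<dots> = measure_pmf.expectation p f * measure_pmf.expectation q g"
    using integral_measure_pmf_real[OF assms(1), of p f] integral_measure_pmf_real[OF assms(2), of q g]
    by simp
  finally show ?thesis .
qed

locale finite_product =
  fixes A :: "'a set" and dflt :: 'b and P :: "'a \<Rightarrow> 'b pmf"
  assumes finite_A: "finite A"
    and finite_P: "\<And>x. x \<in> A \<Longrightarrow> finite (set_pmf (P x))"
begin

abbreviation Q where "Q \<equiv> Pi_pmf A dflt P"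
abbreviation EE :: "(('a \<Rightarrow> 'b) \<Rightarrow> real) \<Rightarrow> real" where "EE \<equiv> measure_pmf.expectation Q"

lemma finite_Q: "finite (set_pmf Q)"
  using finite_A finite_P by (auto simp: set_Pi_pmf intro!: finite_PiE_dflt)

lemma integrable_Q [simp]: "integrable Q (f :: _ \<Rightarrow> real)"
  by (rule integrable_measure_pmf_finite[OF finite_Q])

lemma EE_cong: "(\<And>\<omega>. \<omega> \<in> set_pmf Q \<Longrightarrow> f \<omega> = g \<omega>) \<Longrightarrow> EE f = EE g"
  by (intro integral_cong_AE) (auto simp: AE_measure_pmf_iff)

lemma EE_mono: "(\<And>\<omega>. \<omega> \<in> set_pmf Q \<Longrightarrow> f \<omega> \<le> g \<omega>) \<Longrightarrow> EE f \<le> EE g"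
  by (intro integral_mono_AE) (auto simp: AE_measure_pmf_iff)

lemma EE_sum: "EE (\<lambda>\<omega>. \<Sum>i\<in>I. f i \<omega>) = (\<Sum>i\<in>I. EE (f i))"
  by (rule Bochner_Integration.integral_sum) auto

text \<open>\<open>Q\<close> is the law of two independent pieces, one on \<open>J\<close> and one
  on \<open>A - J\<close>, glued together; each function sees only one of them.\<close>

lemma EE_mult:
  assumes F: "depends_on F J" and G: "depends_on G K"
    and JK: "J \<inter> K = {}" "J \<subseteq> A" "K \<subseteq> A"
  shows "EE (\<lambda>\<omega>. F \<omega> * G \<omega>) = EE F * EE G"
proof -
  have fin: "finite J" "finite (A - J)"
    using finite_A JK by (auto dest: finite_subset)
  let ?m = "\<lambda>(f, g) x. if x \<in> J then f x else g x"
  have Q: "Q = map_pmf ?m (pair_pmf (Pi_pmf J dflt P) (Pi_pmf (A - J) dflt P))"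
    using Pi_pmf_union[OF fin, of dflt P] JK by (simp add: Un_absorb1)
  have fs: "finite (set_pmf (Pi_pmf J dflt P))" "finite (set_pmf (Pi_pmf (A - J) dflt P))"
    using fin finite_P JK by (auto simp: set_Pi_pmf intro!: finite_PiE_dflt)
  have F': "F (\<lambda>x. if x \<in> J then f x else g x) = F f" for f g
    using F by (rule depends_onD) auto
  have G': "G (\<lambda>x. if x \<in> J then f x else g x) = G g" for f g
    using G by (rule depends_onD) (use JK in auto)
  have 1: "EE (\<lambda>\<omega>. F \<omega> * G \<omega>) = measure_pmf.expectation (Pi_pmf J dflt P) F *
      measure_pmf.expectation (Pi_pmf (A - J) dflt P) G"
    unfolding Q integral_map_pmf
    using expectation_pair_pmf_mult[OF fs, of F G] F' G' by (simp add: case_prod_unfold)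
  have 2: "EE F = measure_pmf.expectation (Pi_pmf J dflt P) F"
    unfolding Q integral_map_pmf
    using expectation_pair_pmf_mult[OF fs, of F "\<lambda>_. 1"] F' by (simp add: case_prod_unfold)
  have 3: "EE G = measure_pmf.expectation (Pi_pmf (A - J) dflt P) G"
    unfolding Q integral_map_pmf
    using expectation_pair_pmf_mult[OF fs, of "\<lambda>_. 1" G] G' by (simp add: case_prod_unfold)
  show ?thesis
    by (simp only: 1 2 3)
qed

lemma EE_prod:
  assumes "finite C" "disjoint_family_on J C"
    and "\<And>c. c \<in> C \<Longrightarrow> J c \<subseteq> A" "\<And>c. c \<in> C \<Longrightarrow> depends_on (F c) (J c)"
  shows "EE (\<lambda>\<omega>. \<Prod>c\<in>C. F c \<omega>) = (\<Prod>c\<in>C. EE (F c))"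
  using assms
proof (induction C rule: finite_induct)
  case (insert x C)
  have "EE (\<lambda>\<omega>. F x \<omega> * (\<Prod>c\<in>C. F c \<omega>)) = EE (F x) * EE (\<lambda>\<omega>. \<Prod>c\<in>C. F c \<omega>)"
  proof (rule EE_mult)
    show "depends_on (F x) (J x)" using insert by auto
    show "depends_on (\<lambda>\<omega>. \<Prod>c\<in>C. F c \<omega>) (\<Union>c\<in>C. J c)"
      by (intro depends_on_prod) (rule depends_on_mono[OF insert.prems(3)], auto)
    show "J x \<inter> (\<Union>c\<in>C. J c) = {}"
      using insert.hyps insert.prems(1) by (fastforce simp: disjoint_family_on_def)
    show "J x \<subseteq> A" "(\<Union>c\<in>C. J c) \<subseteq> A" using insert.prems by auto
  qed
  also have "EE (\<lambda>\<omega>. \<Prod>c\<in>C. F c \<omega>) = (\<Prod>c\<in>C. EE (F c))"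
    by (rule insert.IH) (use insert.prems in \<open>auto simp: disjoint_family_on_def\<close>)
  finally show ?case using insert.hyps by simp
qed simp

text \<open>Conditioning on \<open>\<sigma>\<close> by hand: it takes finitely many values on the
  support, and once its value \<open>s\<close> is frozen, the factors \<open>H c s\<close> see
  coordinates disjoint from \<open>A0\<close> and from each other, so that they may be replaced by
  their means.\<close>

lemma EE_cut:
  fixes \<sigma> :: "('a \<Rightarrow> 'b) \<Rightarrow> 's" and H :: "'c \<Rightarrow> 's \<Rightarrow> ('a \<Rightarrow> 'b) \<Rightarrow> real" and G :: "'s \<Rightarrow> real"
  assumes \<sigma>: "depends_on \<sigma> A0" "A0 \<subseteq> A"
    and C: "finite C" "disjoint_family_on J C" "\<And>c. c \<in> C \<Longrightarrow> J c \<subseteq> A"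
    and disj: "\<And>c. c \<in> C \<Longrightarrow> A0 \<inter> J c = {}"
    and H: "\<And>c s. c \<in> C \<Longrightarrow> depends_on (H c s) (J c)"
  shows "EE (\<lambda>\<omega>. G (\<sigma> \<omega>) * (\<Prod>c\<in>C. H c (\<sigma> \<omega>) \<omega>)) =
         EE (\<lambda>\<omega>. G (\<sigma> \<omega>) * (\<Prod>c\<in>C. EE (H c (\<sigma> \<omega>))))"
proof -
  define S where "S = \<sigma> ` set_pmf Q"
  have S: "finite S" using finite_Q by (simp add: S_def)
  define I where "I = (\<lambda>s \<omega>. (if \<sigma> \<omega> = s then G s else 0))"
  have I: "depends_on (I s) A0" for s
    unfolding I_def by (rule depends_on_compose[OF \<sigma>(1)])
  have split: "EE (\<lambda>\<omega>. G (\<sigma> \<omega>) * K (\<sigma> \<omega>) \<omega>) = (\<Sum>s\<in>S. EE (\<lambda>\<omega>. I s \<omega> * K s \<omega>))"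
    for K :: "'s \<Rightarrow> ('a \<Rightarrow> 'b) \<Rightarrow> real"
  proof -
    have "EE (\<lambda>\<omega>. G (\<sigma> \<omega>) * K (\<sigma> \<omega>) \<omega>) = EE (\<lambda>\<omega>. \<Sum>s\<in>S. I s \<omega> * K s \<omega>)"
    proof (rule EE_cong)
      fix \<omega> assume "\<omega> \<in> set_pmf Q"
      hence *: "\<sigma> \<omega> \<in> S" by (auto simp: S_def)
      have "(\<Sum>s\<in>S. I s \<omega> * K s \<omega>) = (\<Sum>s\<in>S. if s = \<sigma> \<omega> then G s * K s \<omega> else 0)"
        by (intro sum.cong) (auto simp: I_def)
      then show "G (\<sigma> \<omega>) * K (\<sigma> \<omega>) \<omega> = (\<Sum>s\<in>S. I s \<omega> * K s \<omega>)"
        using S * by simp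
    qed
    then show ?thesis by (simp add: EE_sum)
  qed
  have "EE (\<lambda>\<omega>. I s \<omega> * (\<Prod>c\<in>C. H c s \<omega>)) = EE (\<lambda>\<omega>. I s \<omega> * (\<Prod>c\<in>C. EE (H c s)))" for s
  proof -
    have "EE (\<lambda>\<omega>. I s \<omega> * (\<Prod>c\<in>C. H c s \<omega>)) = EE (I s) * EE (\<lambda>\<omega>. \<Prod>c\<in>C. H c s \<omega>)"
    proof (rule EE_mult[where J = A0 and K = "\<Union>c\<in>C. J c"])
      show "depends_on (\<lambda>\<omega>. \<Prod>c\<in>C. H c s \<omega>) (\<Union>c\<in>C. J c)"
        by (intro depends_on_prod) (rule depends_on_mono[OF H], auto)
      show "A0 \<inter> (\<Union>c\<in>C. J c) = {}" using disj by blast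
    qed (use I \<sigma> C in auto)
    also have "EE (\<lambda>\<omega>. \<Prod>c\<in>C. H c s \<omega>) = (\<Prod>c\<in>C. EE (H c s))"
      by (rule EE_prod) (use C H in auto)
    finally show ?thesis by simp
  qed
  then show ?thesis
    unfolding split[of "\<lambda>s \<omega>. \<Prod>c\<in>C. H c s \<omega>"] split[of "\<lambda>s \<omega>. \<Prod>c\<in>C. EE (H c s)"] by simp
qed

lemma prob_eq_EE: "measure_pmf.prob Q {\<omega>. R \<omega>} = EE (\<lambda>\<omega>. of_bool (R \<omega>))"
proof -
  have "EE (\<lambda>\<omega>. of_bool (R \<omega>)) = EE (indicator {\<omega>. R \<omega>})"
    by (intro EE_cong) (auto simp: indicator_def)
  then show ?thesis by simp
qed

lemma EE_component:
  assumes "x \<in> A"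
  shows "EE (\<lambda>\<omega>. f (\<omega> x)) = measure_pmf.expectation (P x) f"
  using Pi_pmf_component[OF finite_A, of x dflt P] assms
  by (metis integral_map_pmf)

end


section \<open>Spherically symmetric trees with a level function\<close>

text \<open>\<open>par\<close> recovers the ancestor from a descendant; this is what makes the
  subtrees below distinct vertices of one level disjoint.\<close>

locale level_tree =
  fixes V :: "'v set" and ch :: "'v \<Rightarrow> 'v set" and par :: "'v \<Rightarrow> 'v"
    and lev :: "'v \<Rightarrow> nat" and d :: "nat \<Rightarrow> nat"
  assumes ch_V: "x \<in> V \<Longrightarrow> ch x \<subseteq> V"
    and ch_fin: "x \<in> V \<Longrightarrow> finite (ch x)"
    and ch_card: "x \<in> V \<Longrightarrow> card (ch x) = d (lev x)"
    and ch_lev: "x \<in> V \<Longrightarrow> c \<in> ch x \<Longrightarrow> lev c = Suc (lev x)"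
    and ch_par: "x \<in> V \<Longrightarrow> c \<in> ch x \<Longrightarrow> par c = x"
begin

primrec desc :: "nat \<Rightarrow> 'v \<Rightarrow> 'v set" where
  "desc 0 x = {x}"
| "desc (Suc n) x = (\<Union>c\<in>ch x. desc n c)"

text \<open>A vertex stands for the edge to its parent: \<open>ob v\<close> says that this edge is
  open, so the state of the starting vertex is never consulted.\<close>

primrec reach :: "('v \<Rightarrow> bool) \<Rightarrow> nat \<Rightarrow> 'v \<Rightarrow> 'v set" where
  "reach ob 0 x = {x}"
| "reach ob (Suc n) x = (\<Union>c\<in>{c \<in> ch x. ob c}. reach ob n c)"

text \<open>The vertices whose upper edges decide \<open>reach\<close> down to depth
  \<open>n\<close>. The top vertex is left out because its upper edge leads out of the
  subtree.\<close>

primrec below :: "nat \<Rightarrow> 'v \<Rightarrow> 'v set" where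
  "below 0 x = {}"
| "below (Suc n) x = (\<Union>c\<in>ch x. insert c (below n c))"

text \<open>One induction for all properties: the cardinality needs the disjointness that the
  ancestor equation provides.\<close>

lemma desc_props:
  "x \<in> V \<Longrightarrow> desc n x \<subseteq> V \<and> finite (desc n x) \<and> card (desc n x) = (\<Prod>i<n. d (lev x + i)) \<and>
     (\<forall>y\<in>desc n x. lev y = lev x + n \<and> (par ^^ n) y = x)"
proof (induction n arbitrary: x)
  case (Suc n)
  have c: "c \<in> V" "lev c = Suc (lev x)" "par c = x" if "c \<in> ch x" for c
    using that Suc.prems ch_V ch_lev ch_par by auto
  note IH = Suc.IH[OF c(1)]
  have y: "lev y = lev x + Suc n \<and> (par ^^ Suc n) y = x" if "c \<in> ch x" "y \<in> desc n c" for c y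
    using IH[OF that(1)] that c[OF that(1)] by auto
  have "card (\<Union>c\<in>ch x. desc n c) = (\<Sum>c\<in>ch x. card (desc n c))"
  proof (rule card_UN_disjoint)
    have "desc n i \<inter> desc n j = {}" if "i \<in> ch x" "j \<in> ch x" "i \<noteq> j" for i j
      using IH[OF that(1)] IH[OF that(2)] that(3) by (metis disjoint_iff)
    then show "\<forall>i\<in>ch x. \<forall>j\<in>ch x. i \<noteq> j \<longrightarrow> desc n i \<inter> desc n j = {}" by simp
  qed (use Suc.prems ch_fin IH in auto)
  also have "\<dots> = (\<Sum>c\<in>ch x. \<Prod>i<n. d (lev x + Suc i))"
    using IH c by (intro sum.cong) auto
  also have "\<dots> = (\<Prod>i<Suc n. d (lev x + i))"
    using Suc.prems by (subst prod.lessThan_Suc_shift) (simp add: ch_card)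
  finally have "card (desc (Suc n) x) = (\<Prod>i<Suc n. d (lev x + i))" by simp
  moreover have "desc (Suc n) x \<subseteq> V" "finite (desc (Suc n) x)"
    using IH Suc.prems ch_fin by auto
  ultimately show ?case using y by auto
qed auto

lemma desc_V: "x \<in> V \<Longrightarrow> y \<in> desc n x \<Longrightarrow> y \<in> V"
  and desc_fin: "x \<in> V \<Longrightarrow> finite (desc n x)"
  and card_desc: "x \<in> V \<Longrightarrow> card (desc n x) = (\<Prod>i<n. d (lev x + i))"
  and desc_lev: "x \<in> V \<Longrightarrow> y \<in> desc n x \<Longrightarrow> lev y = lev x + n"
  and desc_par: "x \<in> V \<Longrightarrow> y \<in> desc n x \<Longrightarrow> (par ^^ n) y = x"
  by (simp_all add: desc_props subsetD[OF conjunct1[OF desc_props]])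

lemma below_iff: "v \<in> below n x \<longleftrightarrow> (\<exists>k. 1 \<le> k \<and> k \<le> n \<and> v \<in> desc k x)"
proof (induction n arbitrary: x)
  case (Suc n)
  have "v \<in> below (Suc n) x \<longleftrightarrow> (\<exists>c\<in>ch x. \<exists>k. k \<le> n \<and> v \<in> desc k c)"
  proof -
    have "v = c \<or> v \<in> below n c \<longleftrightarrow> (\<exists>k. k \<le> n \<and> v \<in> desc k c)" for c
    proof
      assume "v = c \<or> v \<in> below n c"
      then show "\<exists>k. k \<le> n \<and> v \<in> desc k c"
        using Suc.IH by (metis desc.simps(1) le0 singletonI)
    next
      assume "\<exists>k. k \<le> n \<and> v \<in> desc k c"
      then obtain k where k: "k \<le> n" "v \<in> desc k c" by auto
      show "v = c \<or> v \<in> below n c"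
        using k Suc.IH[of c]
        by (cases "k = 0") (simp, metis One_nat_def Suc_leI neq0_conv)
    qed
    then show ?thesis by auto
  qed
  also have "\<dots> \<longleftrightarrow> (\<exists>k. k \<le> n \<and> v \<in> desc (Suc k) x)" by auto
  also have "\<dots> \<longleftrightarrow> (\<exists>k. 1 \<le> k \<and> k \<le> Suc n \<and> v \<in> desc k x)"
  proof
    assume "\<exists>k\<ge>1. k \<le> Suc n \<and> v \<in> desc k x"
    then obtain k where k: "1 \<le> k" "k \<le> Suc n" "v \<in> desc k x" by blast
    then obtain j where "k = Suc j" by (cases k) auto
    then show "\<exists>k\<le>n. v \<in> desc (Suc k) x" using k by (intro exI[of _ j]) (simp del: desc.simps)
  next
    assume "\<exists>k\<le>n. v \<in> desc (Suc k) x"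
    then obtain k where "k \<le> n" "v \<in> desc (Suc k) x" by blast
    then show "\<exists>k\<ge>1. k \<le> Suc n \<and> v \<in> desc k x"
      by (intro exI[of _ "Suc k"]) (simp del: desc.simps)
  qed
  finally show ?case .
qed simp

lemma below_V: "x \<in> V \<Longrightarrow> below n x \<subseteq> V"
  and below_fin: "x \<in> V \<Longrightarrow> finite (below n x)"
proof -
  show "x \<in> V \<Longrightarrow> below n x \<subseteq> V" using desc_V below_iff by (metis subsetI)
  have "below n x \<subseteq> (\<Union>k\<in>{..n}. desc k x)" by (auto simp: below_iff)
  then show "finite (below n x)" if "x \<in> V"
    by (rule finite_subset) (use that in \<open>auto simp: desc_fin\<close>)
qed

lemma desc_add: "desc (m + n) x = (\<Union>y\<in>desc m x. desc n y)"
  by (induction m arbitrary: x) auto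

lemma reach_add: "reach ob (m + n) x = (\<Union>y\<in>reach ob m x. reach ob n y)"
  by (induction m arbitrary: x) auto

lemma below_mono: "m \<le> n \<Longrightarrow> below m x \<subseteq> below n x"
proof
  fix v assume "m \<le> n" "v \<in> below m x"
  then obtain k where "1 \<le> k" "k \<le> n" "v \<in> desc k x" unfolding below_iff by (metis order.trans)
  then show "v \<in> below n x" by (auto simp: below_iff)
qed

lemma below_desc_subset:
  assumes "y \<in> desc m x"
  shows "below n y \<subseteq> below (m + n) x"
proof
  fix v assume "v \<in> below n y"
  then obtain k where k: "1 \<le> k" "k \<le> n" "v \<in> desc k y" by (auto simp: below_iff)
  then have "v \<in> desc (m + k) x" using assms by (auto simp: desc_add)
  then show "v \<in> below (m + n) x"
    unfolding below_iff using k by (intro exI[of _ "m + k"]) auto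
qed

lemma reach_subset_desc: "reach ob n x \<subseteq> desc n x"
  by (induction n arbitrary: x) auto

lemma reach_fin: "x \<in> V \<Longrightarrow> finite (reach ob n x)"
  using reach_subset_desc desc_fin by (rule finite_subset)

lemma reach_cong: "(\<And>v. v \<in> below n x \<Longrightarrow> ob v = ob' v) \<Longrightarrow> reach ob n x = reach ob' n x"
proof (induction n arbitrary: x)
  case (Suc n)
  have "reach ob n c = reach ob' n c" if "c \<in> ch x" for c
    using Suc.prems that by (intro Suc.IH) auto
  moreover have "ob c = ob' c" if "c \<in> ch x" for c
    using Suc.prems that by auto
  ultimately show ?case by auto
qed simp

lemma reach_mono: "(\<And>v. v \<in> below n x \<Longrightarrow> ob v \<Longrightarrow> ob' v) \<Longrightarrow> reach ob n x \<subseteq> reach ob' n x"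
proof (induction n arbitrary: x)
  case (Suc n)
  have "reach ob n c \<subseteq> reach ob' n c" if "c \<in> ch x" for c
    using Suc.prems that by (intro Suc.IH) auto
  moreover have "ob c \<Longrightarrow> ob' c" if "c \<in> ch x" for c
    using Suc.prems that by auto
  ultimately show ?case by (simp; blast)
qed simp

lemma below_lev: "x \<in> V \<Longrightarrow> v \<in> below n x \<Longrightarrow>
    lev x < lev v \<and> lev v \<le> lev x + n \<and> (par ^^ (lev v - lev x)) v = x"
  by (auto simp: below_iff desc_lev desc_par)

lemma below_disjoint:
  "x \<in> V \<Longrightarrow> y \<in> V \<Longrightarrow> lev x = lev y \<Longrightarrow> x \<noteq> y \<Longrightarrow> below n x \<inter> below m y = {}"
  by (metis below_lev disjoint_iff)

lemma desc_disjoint: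
  "x \<in> V \<Longrightarrow> y \<in> V \<Longrightarrow> lev x = lev y \<Longrightarrow> x \<noteq> y \<Longrightarrow> desc n x \<inter> desc m y = {}"
  by (metis add_left_cancel desc_lev desc_par disjoint_iff)

lemma below_ch_disjoint: "x \<in> V \<Longrightarrow> disjoint_family_on (\<lambda>c. insert c (below n c)) (ch x)"
  unfolding disjoint_family_on_def
proof (intro ballI impI)
  fix c c' assume *: "x \<in> V" "c \<in> ch x" "c' \<in> ch x" "c \<noteq> c'"
  then have V: "c \<in> V" "c' \<in> V" and l: "lev c = lev c'"
    using ch_V by (auto simp: ch_lev)
  have "c \<notin> below n c'" "c' \<notin> below n c"
    using below_lev[OF V(1), of c' n] below_lev[OF V(2), of c n] l by auto
  then show "insert c (below n c) \<inter> insert c' (below n c') = {}"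
    using below_disjoint[OF V l \<open>c \<noteq> c'\<close>, of n n] \<open>c \<noteq> c'\<close> by blast
qed

lemma card_reach_Suc:
  assumes "x \<in> V"
  shows "card (reach ob (Suc n) x) = (\<Sum>c\<in>ch x. if ob c then card (reach ob n c) else 0)"
proof -
  have V: "c \<in> V" "lev c = Suc (lev x)" if "c \<in> ch x" for c using that assms ch_V ch_lev by auto
  have "card (reach ob (Suc n) x) = (\<Sum>c\<in>{c\<in>ch x. ob c}. card (reach ob n c))"
    unfolding reach.simps
  proof (rule card_UN_disjoint)
    have "reach ob n i \<inter> reach ob n j = {}" if "i \<in> ch x" "j \<in> ch x" "i \<noteq> j" for i j
      using desc_disjoint[of i j n n] reach_subset_desc[of ob n i] reach_subset_desc[of ob n j] V that by auto
    then show "\<forall>i\<in>{c \<in> ch x. ob c}. \<forall>j\<in>{c \<in> ch x. ob c}. i \<noteq> j \<longrightarrow> reach ob n i \<inter> reach ob n j = {}"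
      by simp
    show "finite {c \<in> ch x. ob c}" using assms ch_fin by simp
    show "\<forall>i\<in>{c \<in> ch x. ob c}. finite (reach ob n i)" using V reach_fin by simp
  qed
  also have "\<dots> = (\<Sum>c\<in>ch x. if ob c then card (reach ob n c) else 0)"
    using assms ch_fin by (simp add: sum.inter_filter)
  finally show ?thesis .
qed

end


section \<open>Generating functions of percolation on a finite piece of the tree\<close>

text \<open>\<open>law k\<close> is the distribution of the state of an edge between levels \<open>k - 1\<close> and \<open>k\<close>;
  the edge is identified with its lower end point.\<close>

locale perc_tree = level_tree V ch par lev d
  for V :: "'v set" and ch par lev d +
  fixes A :: "'v set" and dflt :: 'b and law :: "nat \<Rightarrow> 'b pmf"
  assumes finA: "finite A" and fin_law: "\<And>k. finite (set_pmf (law k))"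
begin

sublocale finite_product A dflt "\<lambda>v. law (lev v)"
  by unfold_locales (auto simp: finA fin_law)

definition pr :: "('b \<Rightarrow> bool) \<Rightarrow> nat \<Rightarrow> real" where
  "pr ob k = measure_pmf.prob (law k) {s. ob s}"

abbreviation rch :: "('b \<Rightarrow> bool) \<Rightarrow> ('v \<Rightarrow> 'b) \<Rightarrow> nat \<Rightarrow> 'v \<Rightarrow> 'v set" where
  "rch ob \<omega> \<equiv> reach (\<lambda>v. ob (\<omega> v))"

lemma depends_on_reach: "below n x \<subseteq> J \<Longrightarrow> depends_on (\<lambda>\<omega>. rch ob \<omega> n x) J"
  by (intro depends_onI reach_cong) auto

lemma pr_bounds: "0 \<le> pr ob k" "pr ob k \<le> 1"
  by (auto simp: pr_def)

lemma EE_of_bool: "x \<in> A \<Longrightarrow> EE (\<lambda>\<omega>. of_bool (ob (\<omega> x))) = pr ob (lev x)"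
proof -
  assume x: "x \<in> A"
  have "EE (\<lambda>\<omega>. of_bool (ob (\<omega> x))) = measure_pmf.expectation (law (lev x)) (\<lambda>s. of_bool (ob s))"
    using EE_component[OF x, of "\<lambda>s. of_bool (ob s)"] .
  also have "\<dots> = measure_pmf.expectation (law (lev x)) (indicator {s. ob s})"
    by (rule arg_cong[of _ _ "measure_pmf.expectation (law (lev x))"]) (auto simp: fun_eq_iff)
  also have "\<dots> = pr ob (lev x)" by (simp add: pr_def)
  finally show ?thesis .
qed

end

text \<open>The generating function at \<open>z\<close> of the number of vertices reached
  \<open>n\<close> levels below a vertex of level \<open>k\<close>. At \<open>z = 0\<close> it is
  the probability that none is reached, at \<open>z = exp (- h)\<close> a Laplace transform.\<close>

primrec lap :: "(nat \<Rightarrow> nat) \<Rightarrow> (nat \<Rightarrow> real) \<Rightarrow> real \<Rightarrow> nat \<Rightarrow> nat \<Rightarrow> real" where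
  "lap d p z 0 k = z"
| "lap d p z (Suc n) k = (1 - p (Suc k) + p (Suc k) * lap d p z n (Suc k)) ^ d k"

text \<open>The probability that two percolations with edge probabilities \<open>p\<close> both die
  within \<open>n\<close> levels, when \<open>r k\<close> is the probability that an edge of level
  \<open>k\<close> is open in both. It starts at 0 because depth 0 always reaches the vertex
  itself.\<close>

primrec joint :: "(nat \<Rightarrow> nat) \<Rightarrow> (nat \<Rightarrow> real) \<Rightarrow> (nat \<Rightarrow> real) \<Rightarrow> nat \<Rightarrow> nat \<Rightarrow> real" where
  "joint d p r 0 k = 0"
| "joint d p r (Suc n) k = (1 - 2 * p (Suc k) + r (Suc k)
     + 2 * (p (Suc k) - r (Suc k)) * lap d p 0 n (Suc k) + r (Suc k) * joint d p r n (Suc k)) ^ d k"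

context perc_tree
begin

lemma EE_ch:
  assumes x: "x \<in> V" "below (Suc n) x \<subseteq> A"
    and F: "\<And>c. c \<in> ch x \<Longrightarrow> depends_on (F c) (insert c (below n c))"
    and e: "\<And>c. c \<in> ch x \<Longrightarrow> EE (F c) = e"
  shows "EE (\<lambda>\<omega>. \<Prod>c\<in>ch x. F c \<omega>) = e ^ d (lev x)"
proof -
  have "EE (\<lambda>\<omega>. \<Prod>c\<in>ch x. F c \<omega>) = (\<Prod>c\<in>ch x. EE (F c))"
    by (rule EE_prod[where J = "\<lambda>c. insert c (below n c)"])
       (use x F below_ch_disjoint ch_fin in auto)
  also have "\<dots> = e ^ d (lev x)" using e x by (simp add: ch_card)
  finally show ?thesis .
qed

lemma EE_edge_mult:
  assumes c: "c \<in> V" "c \<in> A" "below n c \<subseteq> A" and G: "depends_on G (below n c)"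
  shows "EE (\<lambda>\<omega>. of_bool (ob (\<omega> c)) * G \<omega>) = pr ob (lev c) * EE G"
proof -
  have "EE (\<lambda>\<omega>. of_bool (ob (\<omega> c)) * G \<omega>) = EE (\<lambda>\<omega>. of_bool (ob (\<omega> c))) * EE G"
    by (rule EE_mult[where J = "{c}" and K = "below n c"])
       (use c G below_lev[OF c(1), of c n] in \<open>auto intro!: depends_onI\<close>)
  then show ?thesis using c by (simp add: EE_of_bool)
qed

lemma EE_lap:
  assumes "x \<in> V" "below n x \<subseteq> A"
  shows "EE (\<lambda>\<omega>. z ^ card (rch ob \<omega> n x)) = lap d (pr ob) z n (lev x)"
  using assms
proof (induction n arbitrary: x)
  case (Suc n)
  have c: "c \<in> V" "c \<in> A" "below n c \<subseteq> A" "lev c = Suc (lev x)" if "c \<in> ch x" for c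
    using that Suc.prems ch_V ch_lev by auto
  let ?F = "\<lambda>c \<omega>. 1 - of_bool (ob (\<omega> c)) + of_bool (ob (\<omega> c)) * z ^ card (rch ob \<omega> n c)"
  have "z ^ card (rch ob \<omega> (Suc n) x) = (\<Prod>c\<in>ch x. ?F c \<omega>)" for \<omega>
    unfolding card_reach_Suc[OF Suc.prems(1)] power_sum by (intro prod.cong) auto
  moreover have "EE (\<lambda>\<omega>. \<Prod>c\<in>ch x. ?F c \<omega>) =
      (1 - pr ob (Suc (lev x)) + pr ob (Suc (lev x)) * lap d (pr ob) z n (Suc (lev x))) ^ d (lev x)"
  proof (rule EE_ch[OF Suc.prems])
    fix c assume cx: "c \<in> ch x"
    note c = c[OF cx]
    have dep: "depends_on (\<lambda>\<omega>. rch ob \<omega> n c) (insert c (below n c))"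
      by (rule depends_on_reach) auto
    show "depends_on (?F c) (insert c (below n c))"
    proof (rule depends_onI)
      fix \<omega> \<omega>' :: "'v \<Rightarrow> 'b" assume *: "\<And>v. v \<in> insert c (below n c) \<Longrightarrow> \<omega> v = \<omega>' v"
      have "rch ob \<omega> n c = rch ob \<omega>' n c" by (rule depends_onD[OF dep *])
      then show "?F c \<omega> = ?F c \<omega>'" using *[of c] by simp
    qed
    have "EE (\<lambda>\<omega>. of_bool (ob (\<omega> c)) * z ^ card (rch ob \<omega> n c)) =
        pr ob (lev c) * EE (\<lambda>\<omega>. z ^ card (rch ob \<omega> n c))"
      by (rule EE_edge_mult[OF c(1-3)]) (rule depends_on_compose[OF depends_on_reach[OF subset_refl]])
    then show "EE (?F c) = 1 - pr ob (Suc (lev x)) + pr ob (Suc (lev x)) * lap d (pr ob) z n (Suc (lev x))"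
      using c by (simp add: EE_of_bool Suc.IH)
  qed
  ultimately show ?case by simp
qed simp

lemma EE_card_reach:
  assumes "x \<in> V" "below n x \<subseteq> A"
  shows "EE (\<lambda>\<omega>. real (card (rch ob \<omega> n x))) =
    (\<Prod>i<n. real (d (lev x + i)) * pr ob (Suc (lev x + i)))"
  using assms
proof (induction n arbitrary: x)
  case (Suc n)
  have c: "c \<in> V" "c \<in> A" "below n c \<subseteq> A" "lev c = Suc (lev x)" if "c \<in> ch x" for c
    using that Suc.prems ch_V ch_lev by auto
  have "EE (\<lambda>\<omega>. real (card (rch ob \<omega> (Suc n) x))) =
      EE (\<lambda>\<omega>. \<Sum>c\<in>ch x. of_bool (ob (\<omega> c)) * real (card (rch ob \<omega> n c)))"
    unfolding card_reach_Suc[OF Suc.prems(1)] of_nat_sum by (intro EE_cong sum.cong) auto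
  also have "\<dots> = (\<Sum>c\<in>ch x. pr ob (lev c) * EE (\<lambda>\<omega>. real (card (rch ob \<omega> n c))))"
    unfolding EE_sum
  proof (intro sum.cong refl)
    fix c' assume c': "c' \<in> ch x"
    show "EE (\<lambda>\<omega>. of_bool (ob (\<omega> c')) * real (card (rch ob \<omega> n c'))) =
        pr ob (lev c') * EE (\<lambda>\<omega>. real (card (rch ob \<omega> n c')))"
      by (rule EE_edge_mult[OF c(1-3)[OF c']]) (rule depends_on_compose[OF depends_on_reach[OF subset_refl]])
  qed
  also have "\<dots> = (\<Sum>c\<in>ch x. pr ob (Suc (lev x)) *
      (\<Prod>i<n. real (d (Suc (lev x) + i)) * pr ob (Suc (Suc (lev x) + i))))"
    by (intro sum.cong refl) (use c Suc.IH in auto)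
  also have "\<dots> = (\<Prod>i<Suc n. real (d (lev x + i)) * pr ob (Suc (lev x + i)))"
    using Suc.prems by (subst prod.lessThan_Suc_shift) (simp add: ch_card mult_ac)
  finally show ?case .
qed simp

lemma card_eq_0_power: "x \<in> V \<Longrightarrow> (0::real) ^ card (reach ob n x) = of_bool (reach ob n x = {})"
  by (auto simp: power_0_left reach_fin)

lemma EE_dead:
  assumes "x \<in> V" "below n x \<subseteq> A"
  shows "EE (\<lambda>\<omega>. of_bool (rch ob \<omega> n x = {})) = lap d (pr ob) 0 n (lev x)"
  using EE_lap[OF assms, of 0] by (simp add: card_eq_0_power assms(1))

lemma EE_joint:
  assumes "x \<in> V" "below n x \<subseteq> A" and p: "\<And>k. pr ob k = p k" "\<And>k. pr ob' k = p k"
    and r: "\<And>k. pr (\<lambda>s. ob s \<and> ob' s) k = r k"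
  shows "EE (\<lambda>\<omega>. of_bool (rch ob \<omega> n x = {}) * of_bool (rch ob' \<omega> n x = {})) =
    joint d p r n (lev x)"
  using assms(1,2)
proof (induction n arbitrary: x)
  case (Suc n)
  have c: "c \<in> V" "c \<in> A" "below n c \<subseteq> A" "lev c = Suc (lev x)" if "c \<in> ch x" for c
    using that Suc.prems ch_V ch_lev by auto
  let ?k = "Suc (lev x)"
  define D where "D = (\<lambda>c \<omega>. of_bool (rch ob \<omega> n c = {}) :: real)"
  define D' where "D' = (\<lambda>c \<omega>. of_bool (rch ob' \<omega> n c = {}) :: real)"
  let ?o = "\<lambda>c \<omega>. of_bool (ob (\<omega> c)) :: real"
  let ?o' = "\<lambda>c \<omega>. of_bool (ob' (\<omega> c)) :: real"
  let ?oo = "\<lambda>c \<omega>. of_bool (ob (\<omega> c) \<and> ob' (\<omega> c)) :: real"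
  \<comment> \<open>The product of the one-process factors \<open>1 - o + o * D\<close> and
    \<open>1 - o' + o' * D'\<close>, multiplied out so that \<open>EE_edge_mult\<close> applies to
    every term.\<close>
  let ?F = "\<lambda>c \<omega>. 1 - ?o c \<omega> - ?o' c \<omega> + ?oo c \<omega> + (?o c \<omega> * D c \<omega> - ?oo c \<omega> * D c \<omega>)
      + (?o' c \<omega> * D' c \<omega> - ?oo c \<omega> * D' c \<omega>) + ?oo c \<omega> * (D c \<omega> * D' c \<omega>)"
  have "of_bool (rch ob \<omega> (Suc n) x = {}) * of_bool (rch ob' \<omega> (Suc n) x = {}) =
      (\<Prod>c\<in>ch x. ?F c \<omega>)" for \<omega>
  proof -
    have f: "finite (ch x)" using Suc.prems ch_fin by auto
    have *: "of_bool (rch oc \<omega> (Suc n) x = {}) =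
        (\<Prod>c\<in>ch x. 1 - of_bool (oc (\<omega> c)) + of_bool (oc (\<omega> c)) * of_bool (rch oc \<omega> n c = {}) :: real)" for oc
    proof (cases "rch oc \<omega> (Suc n) x = {}")
      case True
      then have "\<forall>c\<in>ch x. 1 - of_bool (oc (\<omega> c)) + of_bool (oc (\<omega> c)) * of_bool (rch oc \<omega> n c = {}) = (1::real)"
        by auto
      then show ?thesis unfolding of_bool_eq_1_iff[THEN iffD2, OF True] by (metis (no_types, lifting) prod.neutral)
    next
      case False
      then obtain c where "c \<in> ch x" "oc (\<omega> c)" "rch oc \<omega> n c \<noteq> {}" by auto
      then show ?thesis
        unfolding of_bool_eq_0_iff[THEN iffD2, OF False] using f
        by (intro prod_zero[symmetric] bexI[of _ c]) auto
    qed
    show ?thesis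
      unfolding * prod.distrib[symmetric]
      by (rule prod.cong) (auto simp: D_def D'_def)
  qed
  moreover have "EE (\<lambda>\<omega>. \<Prod>c\<in>ch x. ?F c \<omega>) = joint d p r (Suc n) (lev x)"
    unfolding joint.simps
  proof (rule EE_ch[OF Suc.prems])
    fix c assume cx: "c \<in> ch x"
    note c = c[OF cx]
    have D: "depends_on (D c) (below n c)" "depends_on (D' c) (below n c)"
      unfolding D_def D'_def
      by (intro depends_on_compose[OF depends_on_reach[OF subset_refl]])+
    show "depends_on (?F c) (insert c (below n c))"
    proof (rule depends_onI)
      fix \<omega> \<omega>' :: "'v \<Rightarrow> 'b" assume *: "\<And>v. v \<in> insert c (below n c) \<Longrightarrow> \<omega> v = \<omega>' v"
      have "D c \<omega> = D c \<omega>'" "D' c \<omega> = D' c \<omega>'"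
        by (rule depends_onD[OF D(1)], use * in auto) (rule depends_onD[OF D(2)], use * in auto)
      then show "?F c \<omega> = ?F c \<omega>'" using *[of c] by simp
    qed
    have DD: "depends_on (\<lambda>\<omega>. D c \<omega> * D' c \<omega>) (below n c)"
      by (rule depends_on_compose2[OF D])
    have "EE (?F c) = 1 - p ?k - p ?k + r ?k + (p ?k * EE (D c) - r ?k * EE (D c))
       + (p ?k * EE (D' c) - r ?k * EE (D' c)) + r ?k * EE (\<lambda>\<omega>. D c \<omega> * D' c \<omega>)"
      using EE_edge_mult[OF c(1-3) D(1), of ob] EE_edge_mult[OF c(1-3) D(2), of ob']
        EE_edge_mult[OF c(1-3) D(1), of "\<lambda>s. ob s \<and> ob' s"]
        EE_edge_mult[OF c(1-3) D(2), of "\<lambda>s. ob s \<and> ob' s"]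
        EE_edge_mult[OF c(1-3) DD, of "\<lambda>s. ob s \<and> ob' s"]
        EE_of_bool[OF c(2), of ob] EE_of_bool[OF c(2), of ob'] EE_of_bool[OF c(2), of "\<lambda>s. ob s \<and> ob' s"] p r c(4)
      by simp
    moreover have "pr ob = p" "pr ob' = p" using p by auto
    then have "EE (D c) = lap d p 0 n ?k" "EE (D' c) = lap d p 0 n ?k"
      unfolding D_def D'_def using EE_dead[OF c(1,3), of ob] EE_dead[OF c(1,3), of ob'] c(4) by auto
    moreover have "EE (\<lambda>\<omega>. D c \<omega> * D' c \<omega>) = joint d p r n ?k"
      using Suc.IH[OF c(1,3)] c(4) by (simp add: D_def D'_def)
    ultimately show "EE (?F c) = 1 - 2 * p ?k + r ?k + 2 * (p ?k - r ?k) * lap d p 0 n ?k + r ?k * joint d p r n ?k"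
      by (simp add: algebra_simps)
  qed
  ultimately show ?case by simp
qed simp

end


section \<open>Estimates for the recursions\<close>

lemma exp_minus_le_quadratic:
  fixes x :: real
  assumes "0 \<le> x"
  shows "exp (- x) \<le> 1 - x + x\<^sup>2 / 2"
proof -
  define f where "f = (\<lambda>x::real. 1 - x + x\<^sup>2 / 2 - exp (- x))"
  have "f 0 \<le> f x"
  proof (rule DERIV_nonneg_imp_nondecreasing[OF assms])
    fix y :: real assume "0 \<le> y" "y \<le> x"
    have "(f has_real_derivative (- 1 + y + exp (- y))) (at y)"
      unfolding f_def by (auto intro!: derivative_eq_intros)
    moreover have "0 \<le> - 1 + y + exp (- y)" using exp_ge_add_one_self[of "- y"] by simp
    ultimately show "\<exists>z. (f has_real_derivative z) (at y) \<and> 0 \<le> z" by blast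
  qed
  then show ?thesis by (simp add: f_def)
qed

lemma one_minus_power_le:
  fixes t :: real
  assumes "0 \<le> t" "t \<le> 1"
  shows "(1 - t) ^ n \<le> 1 - real n * t + (real n * t)\<^sup>2 / 2"
proof -
  have "(1 - t) ^ n \<le> exp (- t) ^ n"
    using exp_ge_add_one_self[of "- t"] assms by (intro power_mono) auto
  also have "\<dots> = exp (- (real n * t))" by (simp add: exp_of_nat_mult[symmetric])
  also have "\<dots> \<le> 1 - real n * t + (real n * t)\<^sup>2 / 2"
    by (rule exp_minus_le_quadratic) (use assms in auto)
  finally show ?thesis .
qed

lemma Bernoulli_minus: "0 \<le> t \<Longrightarrow> t \<le> 1 \<Longrightarrow> 1 - real n * t \<le> (1 - t) ^ n" for t :: real
  using Bernoulli_inequality[of "- t" n] by simp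

text \<open>With \<open>z = 2 * a\<close> and \<open>d = n + 1\<close> this bounds
  \<open>(1 - z) ^ d\<close> from below by its Pade approximant
  \<open>(1 - (d + 1) * z / 2) / (1 + (d - 1) * z / 2)\<close>.\<close>

lemma one_minus_power_ge:
  fixes a :: real
  assumes a: "0 \<le> a" "2 * a \<le> 1"
  shows "1 - (real n + 2) * a \<le> (1 - 2 * a) ^ Suc n * (1 + real n * a)"
proof (induction n)
  case (Suc n)
  define D where "D = 1 + real n * a"
  have D: "D > 0" using a by (simp add: D_def add_pos_nonneg)
  have IH: "1 - (real n + 2) * a \<le> (1 - 2 * a) ^ Suc n * D"
    using Suc by (simp only: D_def)
  have "(1 - (real n + 3) * a) * D \<le> (1 - (real n + 2) * a) * ((1 - 2 * a) * (1 + (real n + 1) * a))"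
  proof -
    have "(1 - (real n + 2) * a) * ((1 - 2 * a) * (1 + (real n + 1) * a)) - (1 - (real n + 3) * a) * D
       = 2 * (real n + 1) * (real n + 2) * a ^ 3"
      unfolding D_def by (simp add: algebra_simps power2_eq_square power3_eq_cube)
    moreover have "0 \<le> 2 * (real n + 1) * (real n + 2) * a ^ 3" using a by simp
    ultimately show ?thesis by linarith
  qed
  also have "\<dots> \<le> ((1 - 2 * a) ^ Suc n * D) * ((1 - 2 * a) * (1 + (real n + 1) * a))"
    by (rule mult_right_mono[OF IH]) (use a in auto)
  also have "\<dots> = ((1 - 2 * a) ^ Suc (Suc n) * (1 + (real n + 1) * a)) * D"
    by simp
  finally have "1 - (real n + 3) * a \<le> (1 - 2 * a) ^ Suc (Suc n) * (1 + (real n + 1) * a)"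
    using D by (simp only: mult_le_cancel_right_pos)
  moreover have "real (Suc n) + 2 = real n + 3" "real (Suc n) = real n + 1" by simp_all
  ultimately show ?case by (simp only:)
qed (simp add: algebra_simps)

text \<open>One generation of survival, on the scale of reciprocals: the Pade bound gives the linear
  term plus a fixed gain from branching, which vanishes for a single child.\<close>

lemma survival_step:
  fixes z :: real
  assumes z: "0 < z" "z \<le> 1" and d: "d \<ge> 1"
  shows "1 / (real d * z) + (real d - 1) / (2 * real d) \<le> 1 / (1 - (1 - z) ^ d)"
proof -
  obtain n where n: "d = Suc n" using d by (cases d) auto
  define D where "D = 1 + real n * z / 2"
  have D: "D > 0" using z by (auto simp: D_def intro!: add_pos_nonneg)
  have "1 - (real n + 2) * (z / 2) \<le> (1 - z) ^ d * D"
    using one_minus_power_ge[of "z / 2" n] z by (simp only: n D_def) simp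
  moreover have "real d * z = D - (1 - (real n + 2) * (z / 2))"
    by (simp add: n D_def field_simps)
  ultimately have 1: "(1 - (1 - z) ^ d) * D \<le> real d * z"
    by (simp add: left_diff_distrib)
  have "(1 - z) ^ d \<le> 1 - z" using z power_decreasing[of 1 d "1 - z"] d by simp
  then have 2: "1 - (1 - z) ^ d > 0" using z by simp
  have dz: "real d * z > 0" using z d by simp
  have "1 / (real d * z) + (real d - 1) / (2 * real d) = D / (real d * z)"
  proof -
    have "(real d - 1) / (2 * real d) = (real n * z / 2) / (real d * z)"
      using z by (simp add: n)
    then show ?thesis by (simp only: D_def add_divide_distrib)
  qed
  also have "\<dots> \<le> 1 / (1 - (1 - z) ^ d)"
    using 1 2 dz by (simp add: field_simps)
  finally show ?thesis .
qed

lemma power_diff_le: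
  fixes x y :: real
  assumes "0 \<le> y" "y \<le> x" "x \<le> 1"
  shows "x ^ n - y ^ n \<le> real n * (x - y)"
proof (induction n)
  case (Suc n)
  have "x ^ Suc n - y ^ Suc n = x * (x ^ n - y ^ n) + y ^ n * (x - y)" by (simp add: algebra_simps)
  also have "\<dots> \<le> 1 * (x ^ n - y ^ n) + 1 * (x - y)"
    using assms by (intro add_mono mult_right_mono power_le_one) (auto intro: power_mono)
  also have "\<dots> \<le> real (Suc n) * (x - y)" using Suc by (simp add: algebra_simps)
  finally show ?case .
qed simp

text \<open>The ratio \<open>w (k + n) / w k\<close> is the mean number of vertices reached
  \<open>n\<close> levels below a vertex of level \<open>k\<close>.\<close>

locale weights =
  fixes d :: "nat \<Rightarrow> nat" and p w :: "nat \<Rightarrow> real"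
  assumes d_pos: "d k \<ge> 1"
    and p_pos: "k \<ge> 1 \<Longrightarrow> 0 < p k" and p_le_1: "k \<ge> 1 \<Longrightarrow> p k \<le> 1"
    and w_Suc: "w (Suc k) = w k * real (d k) * p (Suc k)"
    and w_0: "w 0 > 0"
begin

lemma w_pos: "w k > 0"
  by (induction k) (use d_pos p_pos in \<open>auto simp: w_0 w_Suc Suc_le_eq\<close>)

lemma w_add: "w (k + n) = w k * (\<Prod>i<n. real (d (k + i)) * p (Suc (k + i)))"
  by (induction n) (auto simp: w_Suc)

lemma lap_bounds: "0 \<le> z \<Longrightarrow> z \<le> 1 \<Longrightarrow> 0 \<le> lap d p z n k \<and> lap d p z n k \<le> 1"
proof (induction n arbitrary: k)
  case (Suc n)
  have "0 \<le> 1 - p (Suc k) + p (Suc k) * lap d p z n (Suc k)"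
    using Suc p_pos[of "Suc k"] p_le_1[of "Suc k"] by (intro add_nonneg_nonneg mult_nonneg_nonneg) auto
  moreover have "p (Suc k) * lap d p z n (Suc k) \<le> p (Suc k) * 1"
    using Suc p_pos[of "Suc k"] by (intro mult_left_mono) auto
  ultimately show ?case by (auto intro!: power_le_one)
qed simp

text \<open>Second order expansion of the Laplace transform. Each generation transports the error
  linearly and adds half the square of its own first order term, which is the summand
  \<open>1 / w k\<close>.\<close>

lemma lap_exp_estimate:
  assumes h: "0 \<le> h"
  shows "1 - lap d p (exp (- h)) n k \<le> h * w (k + n) / w k \<and>
    h * w (k + n) / w k - (1 - lap d p (exp (- h)) n k) \<le>
      h\<^sup>2 * (w (k + n))\<^sup>2 / (2 * w k) * (\<Sum>i=k..k+n. 1 / w i)"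
proof (induction n arbitrary: k)
  case 0
  have "1 + (- h) \<le> exp (- h)" by (rule exp_ge_add_one_self)
  moreover have "exp (- h) \<le> 1 - h + h\<^sup>2 / 2" by (rule exp_minus_le_quadratic[OF h])
  ultimately show ?case using w_pos[of k] by (simp add: power2_eq_square)
next
  case (Suc n)
  let ?N = "Suc k + n"
  define y where "y = 1 - lap d p (exp (- h)) n (Suc k)"
  define t where "t = p (Suc k) * y"
  define D where "D = real (d k)"
  have y: "0 \<le> y" "y \<le> 1"
    using lap_bounds[of "exp (- h)" n "Suc k"] h by (auto simp: y_def)
  have p: "0 < p (Suc k)" "p (Suc k) \<le> 1" using p_pos[of "Suc k"] p_le_1[of "Suc k"] by auto
  have t: "0 \<le> t" "t \<le> 1" using y p by (auto simp: t_def intro: mult_le_one)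
  have lap: "lap d p (exp (- h)) (Suc n) k = (1 - t) ^ d k"
    by (simp add: t_def y_def algebra_simps)
  have IH1: "y \<le> h * w ?N / w (Suc k)"
    and IH2: "h * w ?N / w (Suc k) - y \<le> h\<^sup>2 * (w ?N)\<^sup>2 / (2 * w (Suc k)) * (\<Sum>i=Suc k..?N. 1 / w i)"
    using Suc[of "Suc k"] by (auto simp: y_def)
  have D: "D > 0" using d_pos[of k] by (simp add: D_def)
  have wk: "w (Suc k) = w k * (D * p (Suc k))" by (simp add: w_Suc D_def)
  have Dp: "D * p (Suc k) = w (Suc k) / w k" using w_pos[of k] by (simp add: wk)
  have Dt: "D * t = w (Suc k) / w k * y" by (simp add: t_def Dp[symmetric])
  have hN: "w (Suc k) / w k * (h * w ?N / w (Suc k)) = h * w ?N / w k"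
    using w_pos[of "Suc k"] by simp
  have pos: "0 < w (Suc k) / w k" using w_pos[of k] w_pos[of "Suc k"] by simp
  have Dt_le: "D * t \<le> h * w ?N / w k"
    unfolding Dt hN[symmetric] by (rule mult_left_mono[OF IH1]) (use pos in simp)
  have 1: "1 - lap d p (exp (- h)) (Suc n) k \<le> h * w (k + Suc n) / w k"
    unfolding lap using Bernoulli_minus[OF t, of "d k"] Dt_le by (simp add: D_def)
  have "h * w ?N / w k - (1 - (1 - t) ^ d k) \<le> (h * w ?N / w k - D * t) + (D * t)\<^sup>2 / 2"
    using one_minus_power_le[OF t, of "d k"] by (simp add: D_def)
  also have "\<dots> = w (Suc k) / w k * (h * w ?N / w (Suc k) - y) + (D * t)\<^sup>2 / 2"
    unfolding right_diff_distrib hN Dt ..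
  also have "\<dots> \<le> w (Suc k) / w k * (h\<^sup>2 * (w ?N)\<^sup>2 / (2 * w (Suc k)) * (\<Sum>i=Suc k..?N. 1 / w i))
      + (h * w ?N / w k)\<^sup>2 / 2"
    by (intro add_mono mult_left_mono[OF IH2] divide_right_mono power_mono[OF Dt_le])
       (use pos D t in auto)
  also have "\<dots> = h\<^sup>2 * (w ?N)\<^sup>2 / (2 * w k) * ((\<Sum>i=Suc k..?N. 1 / w i) + 1 / w k)"
    using w_pos[of k] w_pos[of "Suc k"] by (simp add: field_simps power2_eq_square)
  also have "(\<Sum>i=Suc k..?N. 1 / w i) + 1 / w k = (\<Sum>i=k..k+Suc n. 1 / w i)"
    by (subst sum.atLeast_Suc_atMost[of k]) auto
  finally show ?case using 1 unfolding lap by simp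
qed

abbreviation surv where "surv n k \<equiv> 1 - lap d p 0 n k"

lemma surv_bounds: "0 < surv n k" "surv n k \<le> 1"
proof -
  show "surv n k \<le> 1" using lap_bounds[of 0 n k] by simp
  show "0 < surv n k"
  proof (induction n arbitrary: k)
    case (Suc n)
    let ?t = "p (Suc k) * surv n (Suc k)"
    have p: "0 < p (Suc k)" "p (Suc k) \<le> 1" using p_pos[of "Suc k"] p_le_1[of "Suc k"] by auto
    have t: "0 < ?t" "?t \<le> 1"
      using Suc[of "Suc k"] lap_bounds[of 0 n "Suc k"] p by (auto intro!: mult_le_one)
    have "lap d p 0 (Suc n) k = (1 - ?t) ^ d k" by (simp add: algebra_simps)
    also have "\<dots> \<le> (1 - ?t) ^ 1" by (rule power_decreasing) (use t d_pos in auto)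
    finally show ?case using t by simp
  qed simp
qed

text \<open>Reciprocal survival probabilities behave like resistances: \<open>1 / w i\<close>
  accumulates along the levels. The extra term \<open>s / (4 * w k)\<close> is a reserve for levels
  with a single child, where \<open>survival_step\<close> yields no gain.\<close>

lemma surv_bound:
  assumes s: "\<And>k. k \<ge> 1 \<Longrightarrow> p k \<le> s" "0 < s" "s < 1"
  shows "(1 - s) / 4 * (\<Sum>i=k..<k+n. 1 / w i) + s / (4 * w k) \<le> 1 / (w k * surv n k)"
proof (induction n arbitrary: k)
  case 0
  show ?case using w_pos[of k] s by (simp add: field_simps)
next
  case (Suc n)
  let ?q = "surv n (Suc k)" and ?D = "real (d k)"
  let ?t = "p (Suc k) * ?q" and ?S = "\<Sum>i=Suc k..<Suc k+n. 1 / w i"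
  have p: "0 < p (Suc k)" "p (Suc k) \<le> 1" "p (Suc k) \<le> s"
    using p_pos[of "Suc k"] p_le_1[of "Suc k"] s(1)[of "Suc k"] by auto
  have q: "0 < ?q" "?q \<le> 1" using surv_bounds by auto
  have D: "?D \<ge> 1" using d_pos[of k] by simp
  have t: "0 < ?t" "?t \<le> 1" using q p by (auto intro!: mult_le_one)
  have wk: "0 < w k" "0 < w (Suc k)" by (rule w_pos)+
  have lap: "surv (Suc n) k = 1 - (1 - ?t) ^ d k" by (simp add: algebra_simps)
  have "1 / (?D * ?t) + (?D - 1) / (2 * ?D) \<le> 1 / surv (Suc n) k"
    unfolding lap by (rule survival_step[OF t d_pos])
  then have "(1 / w k) * (1 / (?D * ?t) + (?D - 1) / (2 * ?D)) \<le> (1 / w k) * (1 / surv (Suc n) k)"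
    by (rule mult_left_mono) (use wk in simp)
  also have "(1 / w k) * (1 / (?D * ?t) + (?D - 1) / (2 * ?D)) =
      1 / (w (Suc k) * ?q) + (?D - 1) / (2 * ?D * w k)"
    by (simp add: w_Suc distrib_left mult_ac)
  finally have "1 / (w (Suc k) * ?q) + (?D - 1) / (2 * ?D * w k) \<le> 1 / (w k * surv (Suc n) k)"
    by simp
  moreover have "(1 - s) / 4 * ?S + s / (4 * w (Suc k)) \<le> 1 / (w (Suc k) * ?q)"
    using Suc[of "Suc k"] by simp
  \<comment> \<open>With one child \<open>w\<close> drops at least by the factor \<open>s\<close>,
    and the reserve of the next level pays; with two or more children the gain
    \<open>(d - 1) / (2 * d)\<close> is at least 1/4.\<close>
  moreover have "1 / (4 * w k) \<le> s / (4 * w (Suc k)) + (?D - 1) / (2 * ?D * w k)"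
  proof (cases "d k = 1")
    case True
    have "w (Suc k) \<le> s * w k" using True p wk by (simp add: w_Suc mult.commute)
    then show ?thesis using True wk s by (simp add: field_simps)
  next
    case False
    then have "?D \<ge> 2" using d_pos[of k] by simp
    then have "1 / (4 * w k) \<le> (?D - 1) / (2 * ?D * w k)" using wk by (simp add: field_simps)
    moreover have "0 \<le> s / (4 * w (Suc k))" using wk s by simp
    ultimately show ?thesis by simp
  qed
  moreover have "(\<Sum>i=k..<k+Suc n. 1 / w i) = 1 / w k + ?S"
    by (subst sum.atLeast_Suc_lessThan) auto
  moreover have "1 / (4 * w k) = (1 - s) / 4 * (1 / w k) + s / (4 * w k)"
    using wk by (simp add: field_simps)
  ultimately show ?case by (simp add: distrib_left)
qed

text \<open>Unrolling the recursion bounds the covariance of the two extinction events by a sum over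
  the level at which the two processes separate. Staying together over one level costs the factor
  \<open>p + (1 - p) * E\<close>, at most \<open>s + (1 - s) * E\<close>, so the sum decays
  geometrically.\<close>

lemma joint_bounds:
  assumes E: "0 \<le> E" "E \<le> 1" and r: "\<And>k. r k = (p k)\<^sup>2 + p k * (1 - p k) * E"
    and s: "\<And>k. k \<ge> 1 \<Longrightarrow> p k \<le> s" "s \<le> 1"
  shows "(lap d p 0 n k)\<^sup>2 \<le> joint d p r n k \<and> joint d p r n k \<le> lap d p 0 n k \<and>
    w k * (joint d p r n k - (lap d p 0 n k)\<^sup>2) \<le>
      (\<Sum>i=Suc k..k+n. (s + (1 - s) * E) ^ (i - Suc k) * w i * (surv (k + n - i) i)\<^sup>2)"
proof (induction n arbitrary: k)
  case 0
  show ?case by simp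
next
  case (Suc n)
  let ?P = "p (Suc k)" and ?R = "r (Suc k)" and ?\<rho> = "s + (1 - s) * E" and ?N = "Suc k + n"
  define b where "b = lap d p 0 n (Suc k)"
  define J where "J = joint d p r n (Suc k)"
  define X where "X = 1 - 2 * ?P + ?R + 2 * (?P - ?R) * b + ?R * J"
  define Y where "Y = 1 - ?P + ?P * b"
  have P: "0 < ?P" "?P \<le> 1" "?P \<le> s" using p_pos[of "Suc k"] p_le_1[of "Suc k"] s(1)[of "Suc k"] by auto
  have b: "0 \<le> b" "b \<le> 1" using lap_bounds[of 0 n "Suc k"] by (auto simp: b_def)
  have IH: "b\<^sup>2 \<le> J" "J \<le> b" and IH3: "w (Suc k) * (J - b\<^sup>2) \<le>
      (\<Sum>i=Suc (Suc k)..?N. ?\<rho> ^ (i - Suc (Suc k)) * w i * (surv (?N - i) i)\<^sup>2)"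
    using Suc[of "Suc k"] by (auto simp: b_def J_def)
  have R: "?R = ?P * (?P + (1 - ?P) * E)" by (simp add: r algebra_simps power2_eq_square)
  have PE: "0 \<le> ?P + (1 - ?P) * E" "?P + (1 - ?P) * E \<le> 1"
    using P E by (auto intro!: add_nonneg_nonneg mult_nonneg_nonneg)
      (use mult_left_le[of E "1 - ?P"] P E in linarith)
  have R_bounds: "0 \<le> ?R" "?R \<le> ?P" "?P\<^sup>2 \<le> ?R"
    unfolding R using P PE E by (auto simp: power2_eq_square intro!: mult_left_le)
  \<comment> \<open>Covariance over one edge: the first term is inherited from below an edge open at
    both times, the second comes from the correlation \<open>?R - ?P\<^sup>2\<close> of the edge
    itself.\<close>
  have XY: "X - Y\<^sup>2 = ?R * (J - b\<^sup>2) + (?R - ?P\<^sup>2) * (1 - b)\<^sup>2"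
    by (simp add: X_def Y_def algebra_simps power2_eq_square)
  have Y: "0 \<le> Y" "Y \<le> 1"
    unfolding Y_def using P b mult_left_le[of b ?P] by (auto intro!: add_nonneg_nonneg)
  have YX: "Y\<^sup>2 \<le> X" using XY R_bounds IH by (smt (verit) mult_nonneg_nonneg zero_le_power2)
  have "?R * J \<le> ?R * b" using IH R_bounds by (intro mult_left_mono) auto
  moreover have "0 \<le> (?P - ?R) * (1 - b)" using R_bounds b by simp
  ultimately have XleY: "X \<le> Y" unfolding X_def Y_def by (simp add: algebra_simps)
  have lap: "lap d p 0 (Suc n) k = Y ^ d k" "joint d p r (Suc n) k = X ^ d k"
    by (simp_all add: X_def Y_def b_def J_def)
  have X: "0 \<le> X" using YX by (smt (verit) zero_le_power2)
  have 1: "(lap d p 0 (Suc n) k)\<^sup>2 \<le> joint d p r (Suc n) k"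
    unfolding lap power_mult[symmetric] mult.commute[of "d k" 2]
    unfolding power_mult by (rule power_mono[OF YX]) simp
  have 2: "joint d p r (Suc n) k \<le> lap d p 0 (Suc n) k"
    unfolding lap by (rule power_mono[OF XleY X])
  have "X ^ d k - (Y ^ d k)\<^sup>2 = X ^ d k - (Y\<^sup>2) ^ d k"
    by (simp add: power_mult[symmetric] mult.commute)
  also have "\<dots> \<le> real (d k) * (X - Y\<^sup>2)"
    by (rule power_diff_le) (use YX XleY Y in auto)
  finally have "w k * (X ^ d k - (Y ^ d k)\<^sup>2) \<le> w k * (real (d k) * (X - Y\<^sup>2))"
    using w_pos[of k] by simp
  also have "\<dots> = w (Suc k) * ((?P + (1 - ?P) * E) * (J - b\<^sup>2) + (1 - ?P) * E * (1 - b)\<^sup>2)"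
    unfolding XY by (simp add: R w_Suc algebra_simps power2_eq_square)
  also have "\<dots> \<le> w (Suc k) * (?\<rho> * (J - b\<^sup>2) + 1 * (1 - b)\<^sup>2)"
  proof -
    have "?\<rho> - (?P + (1 - ?P) * E) = (s - ?P) * (1 - E)" by (simp add: algebra_simps)
    also have "\<dots> \<ge> 0" using P E by simp
    finally have A: "?P + (1 - ?P) * E \<le> ?\<rho>" by simp
    have B: "(1 - ?P) * E \<le> 1" using P E by (intro mult_le_one) auto
    show ?thesis
      by (intro mult_left_mono[OF add_mono[OF mult_right_mono[OF A] mult_right_mono[OF B]]])
         (use IH w_pos[of "Suc k"] in auto)
  qed
  also have "\<dots> = ?\<rho> * (w (Suc k) * (J - b\<^sup>2)) + w (Suc k) * (1 - b)\<^sup>2"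
    by (simp add: algebra_simps)
  also have "\<dots> \<le> ?\<rho> * (\<Sum>i=Suc (Suc k)..?N. ?\<rho> ^ (i - Suc (Suc k)) * w i * (surv (?N - i) i)\<^sup>2)
     + w (Suc k) * (1 - b)\<^sup>2"
  proof -
    have "0 \<le> s" using P by simp
    then have "0 \<le> ?\<rho>" using E s by (intro add_nonneg_nonneg mult_nonneg_nonneg) auto
    then show ?thesis using mult_left_mono[OF IH3] by simp
  qed
  also have "?\<rho> * (\<Sum>i=Suc (Suc k)..?N. ?\<rho> ^ (i - Suc (Suc k)) * w i * (surv (?N - i) i)\<^sup>2)
      = (\<Sum>i=Suc (Suc k)..?N. ?\<rho> ^ (i - Suc k) * w i * (surv (?N - i) i)\<^sup>2)"
    unfolding sum_distrib_left
  proof (rule sum.cong[OF refl])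
    fix i assume "i \<in> {Suc (Suc k)..?N}"
    then have "i - Suc k = Suc (i - Suc (Suc k))" by auto
    then show "?\<rho> * (?\<rho> ^ (i - Suc (Suc k)) * w i * (surv (?N - i) i)\<^sup>2) =
      ?\<rho> ^ (i - Suc k) * w i * (surv (?N - i) i)\<^sup>2" by simp
  qed
  also have "\<dots> + w (Suc k) * (1 - b)\<^sup>2 =
      (\<Sum>i=Suc k..?N. ?\<rho> ^ (i - Suc k) * w i * (surv (?N - i) i)\<^sup>2)"
    by (subst (2) sum.atLeast_Suc_atMost) (auto simp: b_def)
  finally show ?case using 1 2 unfolding lap by simp
qed

end

section \<open>Survival and correlation at one scale when \<open>w k\<close> is at most of order
  \<open>k (log k)^2\<close>\<close>

lemma ln_diff_le_sum:
  assumes "1 \<le> a" "a \<le> b"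
  shows "ln (real b) - ln (real a) \<le> (\<Sum>i=a..<b. 1 / real i)"
  using assms(2)
proof (induction b rule: dec_induct)
  case (step b)
  have "ln (real (Suc b)) - ln (real b) = ln (real (Suc b) / real b)"
    using step assms by (subst ln_div) auto
  also have "\<dots> = ln (1 + 1 / real b)" using step assms by (simp add: field_simps)
  also have "\<dots> \<le> 1 / real b" using step assms by (intro ln_add_one_self_le_self) auto
  finally show ?case using step by simp
qed simp

context weights
begin

text \<open>Level \<open>4 * n\<^sup>2\<close> is the square of \<open>2 * n\<close>. Between the
  two the harmonic sum is at least \<open>L = ln (2 * n)\<close> while logarithms stay below
  \<open>2 * L\<close>, so the sum of \<open>1 / w\<close> is at least
  \<open>1 / (4 * C * L)\<close>; \<open>surv_bound\<close> inverts this.\<close>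

lemma survival_at_scale:
  assumes s: "\<And>k. k \<ge> 1 \<Longrightarrow> p k \<le> s" "0 < s" "s < 1"
    and C: "C > 0" "\<And>k. k \<ge> 3 \<Longrightarrow> w k \<le> C * real k * (ln (real k))\<^sup>2"
    and n: "n \<ge> 3" "n \<le> k" "k \<le> 2 * n"
  shows "w k * surv (4 * n\<^sup>2 - k) k \<le> 16 * C / (1 - s) * ln (2 * real n)"
proof -
  define N where "N = 4 * n\<^sup>2"
  define L where "L = ln (2 * real n)"
  have "2 * n \<le> 2 * n * (2 * n)" by simp
  then have N: "2 * n \<le> N" by (simp add: N_def power2_eq_square)
  have L: "L > 0" using n by (simp add: L_def)
  have N2: "real N = (2 * real n) ^ 2" by (simp add: N_def power2_eq_square)
  have lnN: "ln (real N) = 2 * L" unfolding N2 L_def using n by (subst ln_realpow) auto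
  have "1 / (4 * C * L) = (1 / (C * (2 * L)\<^sup>2)) * L"
    using L C by (simp add: field_simps power2_eq_square)
  also have "\<dots> \<le> (1 / (C * (2 * L)\<^sup>2)) * (\<Sum>i=2*n..<N. 1 / real i)"
  proof (rule mult_left_mono)
    have "L = ln (real N) - ln (real (2 * n))" unfolding lnN by (simp add: L_def)
    also have "\<dots> \<le> (\<Sum>i=2*n..<N. 1 / real i)" by (rule ln_diff_le_sum) (use n N in auto)
    finally show "L \<le> (\<Sum>i=2*n..<N. 1 / real i)" .
  qed (use C in auto)
  also have "\<dots> = (\<Sum>i=2*n..<N. 1 / (C * real i * (2 * L)\<^sup>2))"
    unfolding sum_distrib_left by (intro sum.cong) (auto simp: mult_ac)
  also have "\<dots> \<le> (\<Sum>i=2*n..<N. 1 / w i)"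
  proof (intro sum_mono divide_left_mono)
    fix i assume i: "i \<in> {2*n..<N}"
    then have i3: "i \<ge> 3" using n by auto
    have "w i \<le> C * real i * (ln (real i))\<^sup>2" by (rule C(2)[OF i3])
    also have "\<dots> \<le> C * real i * (ln (real N))\<^sup>2"
      by (intro mult_left_mono power_mono) (use i i3 C n in auto)
    finally show "w i \<le> C * real i * (2 * L)\<^sup>2" unfolding lnN .
    show "0 < C * real i * (2 * L)\<^sup>2 * w i" using C i3 L w_pos[of i] by simp
  qed simp
  also have "\<dots> \<le> (\<Sum>i=k..<k + (N - k). 1 / w i)"
    by (rule sum_mono2) (use n N w_pos in \<open>auto simp: less_imp_le\<close>)
  finally have 1: "1 / (4 * C * L) \<le> (\<Sum>i=k..<k + (N - k). 1 / w i)" .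
  have q: "w k * surv (N - k) k > 0" using w_pos surv_bounds by simp
  have "(1 - s) / 4 * (1 / (4 * C * L)) \<le> (1 - s) / 4 * (\<Sum>i=k..<k + (N - k). 1 / w i)"
    by (intro mult_left_mono 1) (use s in auto)
  also have "\<dots> \<le> 1 / (w k * surv (N - k) k)"
  proof -
    have "0 \<le> s / (4 * w k)" using s w_pos[of k] by simp
    then show ?thesis using surv_bound[OF s, of k "N - k"] by linarith
  qed
  finally have "(1 - s) / (16 * C * L) \<le> 1 / (w k * surv (N - k) k)" by simp
  moreover have "X \<le> b / a" if "a / b \<le> 1 / X" "0 < X" "0 < a" "0 < b" for X a b :: real
    using that by (simp add: field_simps)
  ultimately have "w k * surv (N - k) k \<le> 16 * C * L / (1 - s)"
    using q s C L by (metis diff_gt_0_iff_gt mult_pos_pos zero_less_numeral)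
  then show ?thesis by (simp add: N_def L_def)
qed

text \<open>The sum of \<open>joint_bounds\<close> is cut at level \<open>2 * n\<close>. Up to there
  \<open>survival_at_scale\<close> applies and the geometric factors sum to order
  \<open>sqrt n\<close>; beyond, these factors are exponentially small in \<open>sqrt n\<close>, and
  crude bounds of \<open>w\<close> suffice.\<close>

lemma covariance_at_scale:
  assumes s: "\<And>k. k \<ge> 1 \<Longrightarrow> p k \<le> s" "0 < s" "s < 1"
    and C: "C > 0" "\<And>k. k \<ge> 3 \<Longrightarrow> w k \<le> C * real k * (ln (real k))\<^sup>2"
    and c: "c > 0" "\<And>k. k \<ge> 3 \<Longrightarrow> c * real k \<le> w k"
    and n: "n \<ge> 3" and u: "1 / sqrt (real n) \<le> u"
    and r: "\<And>k. r k = (p k)\<^sup>2 + p k * (1 - p k) * exp (- u)"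
  shows "w n * (joint d p r (4 * n\<^sup>2 - n) n - (lap d p 0 (4 * n\<^sup>2 - n) n)\<^sup>2) \<le>
    2 * (16 * C / (1 - s) * ln (2 * real n))\<^sup>2 / (c * (1 - s) * sqrt (real n))
    + 16 * C * real n ^ 4 * (ln (4 * (real n)\<^sup>2))\<^sup>2 * exp (- ((1 - s) * sqrt (real n) / 2))"
proof -
  define N where "N = 4 * n\<^sup>2"
  define E where "E = exp (- u)"
  define \<rho> where "\<rho> = s + (1 - s) * E"
  define B where "B = 16 * C / (1 - s) * ln (2 * real n)"
  define x where "x = 1 / sqrt (real n)"
  have "2 * n \<le> 2 * n * (2 * n)" by simp
  then have N: "2 * n \<le> N" by (simp add: N_def power2_eq_square)
  have x: "0 < x" "x \<le> 1" using n by (auto simp: x_def)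
  have u0: "0 \<le> u" using u x unfolding x_def by linarith
  have "E \<le> exp (- x)" using u by (simp add: E_def x_def)
  also have "\<dots> \<le> 1 - x + x\<^sup>2 / 2" by (rule exp_minus_le_quadratic) (use x in simp)
  also have "x\<^sup>2 \<le> x" using x by (simp add: power2_eq_square mult_left_le)
  finally have E: "E \<le> 1 - x / 2" "0 \<le> E" by (simp_all add: E_def)
  have "0 \<le> (1 - s) * E" using E s by simp
  then have \<rho>: "0 \<le> \<rho>" "\<rho> \<le> 1 - (1 - s) * x / 2"
    using s mult_left_mono[OF E(1), of "1 - s"] by (simp_all add: \<rho>_def algebra_simps)
  have sx: "0 < (1 - s) * x" using s x by simp
  have nN: "n + (N - n) = N" using N by simp
  have f: "w i * (surv (N - i) i)\<^sup>2 \<le> B\<^sup>2 / (c * real n)" if "i \<in> {Suc n..2*n}" for i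
  proof -
    have "w i * (surv (N - i) i)\<^sup>2 = (w i * surv (N - i) i)\<^sup>2 / w i"
      using w_pos[of i] by (simp add: power2_eq_square)
    also have "\<dots> \<le> B\<^sup>2 / w i"
    proof (intro divide_right_mono power_mono)
      show "w i * surv (N - i) i \<le> B"
        unfolding B_def N_def by (rule survival_at_scale[OF s C]) (use n that in auto)
      show "0 \<le> w i * surv (N - i) i" using w_pos[of i] surv_bounds(1)[of "N - i" i] by simp
    qed (use w_pos[of i] in simp)
    also have "\<dots> \<le> B\<^sup>2 / (c * real n)"
    proof (intro divide_left_mono)
      have "c * real n \<le> c * real i" using that c by simp
      also have "\<dots> \<le> w i" using that n by (intro c) auto
      finally show "c * real n \<le> w i" .
      show "0 < w i * (c * real n)" using c n w_pos[of i] by simp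
    qed simp
    finally show ?thesis .
  qed
  have g: "w i * (surv (N - i) i)\<^sup>2 \<le> C * real N * (ln (real N))\<^sup>2" if "i \<in> {Suc (2*n)..N}" for i
  proof -
    have "(surv (N - i) i)\<^sup>2 \<le> 1"
      using surv_bounds[of "N - i" i] by (intro power_le_one) auto
    then have "w i * (surv (N - i) i)\<^sup>2 \<le> w i * 1"
      by (intro mult_left_mono) (use w_pos[of i] in auto)
    also have "\<dots> \<le> C * real i * (ln (real i))\<^sup>2" using C(2)[of i] that n by auto
    also have "\<dots> \<le> C * real N * (ln (real N))\<^sup>2"
      by (intro mult_mono power_mono) (use that n C in auto)
    finally show ?thesis .
  qed
  have "w n * (joint d p r (N - n) n - (lap d p 0 (N - n) n)\<^sup>2) \<le>
      (\<Sum>i=Suc n..N. \<rho> ^ (i - Suc n) * w i * (surv (N - i) i)\<^sup>2)"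
    using joint_bounds[of E r s "N - n" n, OF _ _ _ s(1)] r s u0 unfolding nN \<rho>_def E_def by auto
  also have "\<dots> = (\<Sum>i=Suc n..2*n. \<rho> ^ (i - Suc n) * (w i * (surv (N - i) i)\<^sup>2))
       + (\<Sum>i=Suc (2*n)..N. \<rho> ^ (i - Suc n) * (w i * (surv (N - i) i)\<^sup>2))"
  proof -
    have "{Suc n..N} = {Suc n..2*n} \<union> {Suc (2*n)..N}" using N by auto
    then show ?thesis by (simp add: mult.assoc sum.union_disjoint)
  qed
  also have "(\<Sum>i=Suc n..2*n. \<rho> ^ (i - Suc n) * (w i * (surv (N - i) i)\<^sup>2)) \<le>
      (\<Sum>i=Suc n..2*n. \<rho> ^ (i - Suc n) * (B\<^sup>2 / (c * real n)))"
    by (intro sum_mono mult_left_mono f) (use \<rho> in auto)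
  also have "\<dots> = (\<Sum>j<n. \<rho> ^ j) * (B\<^sup>2 / (c * real n))"
    unfolding sum_distrib_right
    by (rule sum.reindex_bij_witness[of _ "\<lambda>j. j + Suc n" "\<lambda>i. i - Suc n"]) auto
  also have "\<dots> \<le> (2 / ((1 - s) * x)) * (B\<^sup>2 / (c * real n))"
  proof (rule mult_right_mono)
    have \<rho>1: "\<rho> < 1" using \<rho> sx by linarith
    have "(\<Sum>j<n. \<rho> ^ j) = (1 - \<rho> ^ n) / (1 - \<rho>)"
      using \<rho>1 by (simp add: sum_gp_strict)
    also have "\<dots> \<le> 1 / (1 - \<rho>)" using \<rho> \<rho>1 by (intro divide_right_mono) auto
    also have "\<dots> \<le> 1 / ((1 - s) * x / 2)"
      by (rule divide_left_mono) (use \<rho> \<rho>1 sx in auto)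
    finally show "(\<Sum>j<n. \<rho> ^ j) \<le> 2 / ((1 - s) * x)" by simp
  qed (use c in auto)
  also have "\<dots> = 2 * B\<^sup>2 / (c * (1 - s) * sqrt (real n))"
  proof -
    obtain y where y: "y > 0" "sqrt (real n) = y" "real n = y * y"
      using n by (metis of_nat_0_less_iff real_sqrt_gt_zero real_sqrt_mult_self abs_of_nat
          less_le_trans zero_less_numeral)
    show ?thesis unfolding x_def y(2,3) using y(1) by simp
  qed
  also have "(\<Sum>i=Suc (2*n)..N. \<rho> ^ (i - Suc n) * (w i * (surv (N - i) i)\<^sup>2)) \<le>
      (\<Sum>i=Suc (2*n)..N. exp (- ((1 - s) * sqrt (real n) / 2)) * (C * real N * (ln (real N))\<^sup>2))"
  proof (rule sum_mono)
    fix i assume i: "i \<in> {Suc (2*n)..N}"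
    have "\<rho> ^ (i - Suc n) \<le> \<rho> ^ n"
      by (rule power_decreasing) (use i \<rho> sx in auto)
    also have "\<dots> \<le> exp (- ((1 - s) * x / 2)) ^ n"
      using \<rho> exp_ge_add_one_self[of "- ((1 - s) * x / 2)"] by (intro power_mono) auto
    also have "\<dots> = exp (- ((1 - s) * sqrt (real n) / 2))"
    proof -
      have "real n * x = sqrt (real n)" using n by (simp add: x_def real_div_sqrt)
      then have "real n * - ((1 - s) * x / 2) = - ((1 - s) * sqrt (real n) / 2)"
        by (metis (no_types, opaque_lifting) mult.left_commute mult_minus_right times_divide_eq_right)
      then show ?thesis by (simp only: exp_of_nat_mult[symmetric])
    qed
    finally have "\<rho> ^ (i - Suc n) \<le> exp (- ((1 - s) * sqrt (real n) / 2))" .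
    moreover have "0 \<le> w i * (surv (N - i) i)\<^sup>2" using w_pos[of i] by simp
    ultimately show "\<rho> ^ (i - Suc n) * (w i * (surv (N - i) i)\<^sup>2) \<le>
        exp (- ((1 - s) * sqrt (real n) / 2)) * (C * real N * (ln (real N))\<^sup>2)"
      by (intro mult_mono g i) auto
  qed
  also have "\<dots> \<le> real N * (exp (- ((1 - s) * sqrt (real n) / 2)) * (C * real N * (ln (real N))\<^sup>2))"
    using C by (simp only: sum_constant) (intro mult_right_mono, auto)
  also have "\<dots> = 16 * C * real n ^ 4 * (ln (4 * (real n)\<^sup>2))\<^sup>2 * exp (- ((1 - s) * sqrt (real n) / 2))"
    by (simp add: N_def power2_eq_square power4_eq_xxxx)
  finally show ?thesis by (simp add: N_def B_def)
qed

text \<open>The power \<open>m\<close> is the number of vertices at the scale that have to die at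
  both times. The witnesses are \<open>uu n = n powr (- 1 / 2)\<close> for the separation of far
  times and \<open>bb n = (2 * n) powr (1 / 4)\<close> for the correlation of near ones; what
  matters later is that \<open>bb n * uu n\<close> tends to 0.\<close>

lemma pair_ratio_at_scale:
  assumes s: "\<And>k. k \<ge> 1 \<Longrightarrow> p k \<le> s" "0 < s" "s < 1"
    and C: "C > 0" "\<And>k. k \<ge> 3 \<Longrightarrow> w k \<le> C * real k * (ln (real k))\<^sup>2"
    and c: "c > 0" "\<And>k. k \<ge> 3 \<Longrightarrow> c * real k \<le> w k"
    and r: "\<And>u k. r u k = (p k)\<^sup>2 + p k * (1 - p k) * exp (- u)"
  obtains \<eta> :: real and bb e uu :: "nat \<Rightarrow> real" where
    "\<eta> > 0" "\<And>n. bb n \<ge> 1" "\<And>n. e n \<ge> 0" "e \<longlonglongrightarrow> 0" "(\<lambda>n. bb n * uu n) \<longlonglongrightarrow> 0"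
    "\<And>n. uu n \<ge> 0"
    "eventually (\<lambda>n. lap d p 0 (4 * n\<^sup>2 - n) n > 0 \<and>
       (\<forall>m u. real m \<le> \<eta> * w n \<longrightarrow> 0 \<le> u \<longrightarrow>
          1 \<le> joint d p (r u) (4 * n\<^sup>2 - n) n / (lap d p 0 (4 * n\<^sup>2 - n) n)\<^sup>2 \<and>
          (joint d p (r u) (4 * n\<^sup>2 - n) n / (lap d p 0 (4 * n\<^sup>2 - n) n)\<^sup>2) ^ m \<le>
            (if u \<ge> uu n then 1 + e n else bb n))) sequentially"
proof -
  \<comment> \<open>128 = 16 * 8: \<open>\<eta>\<close> times the bound of
    \<open>survival_at_scale\<close> is one eighth of the logarithm, and doubling it in the exponent
    gives the 1/4 of \<open>bb\<close>.\<close>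
  define \<eta> where "\<eta> = (1 - s) / (128 * C)"
  define bb where "bb = (\<lambda>n. exp (ln (2 * real n) / 4))"
  define W where "W = (\<lambda>n. 2 * (16 * C / (1 - s) * ln (2 * real n))\<^sup>2 / (c * (1 - s) * sqrt (real n))
    + 16 * C * real n ^ 4 * (ln (4 * (real n)\<^sup>2))\<^sup>2 * exp (- ((1 - s) * sqrt (real n) / 2)))"
  define e where "e = (\<lambda>n. exp (4 * \<eta> * W n) - 1)"
  define uu where "uu = (\<lambda>n. 1 / sqrt (real n))"
  have s1: "0 < 1 - s" using s by simp
  have \<eta>: "\<eta> > 0" using s1 C by (simp add: \<eta>_def)
  have W0: "W n \<ge> 0" for n
    unfolding W_def using s C c by (intro add_nonneg_nonneg) auto
  have "W \<longlonglongrightarrow> 0" unfolding W_def using s1 C(1) c(1) by real_asymp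
  then have "(\<lambda>n. exp (4 * \<eta> * W n) - 1) \<longlonglongrightarrow> exp (4 * \<eta> * 0) - 1"
    by (intro tendsto_intros)
  then have e: "e \<longlonglongrightarrow> 0" by (simp add: e_def)
  have q_lim: "(\<lambda>n. 16 * C / (1 - s) * ln (2 * real n) / (c * real n)) \<longlonglongrightarrow> 0"
    using s1 C(1) c(1) by real_asymp
  have "eventually (\<lambda>n. 16 * C / (1 - s) * ln (2 * real n) / (c * real n) < 1 / 2 \<and> n \<ge> 3) sequentially"
    by (intro eventually_conj order_tendstoD(2)[OF q_lim] eventually_ge_at_top) simp
  then have ev: "eventually (\<lambda>n. lap d p 0 (4 * n\<^sup>2 - n) n > 0 \<and>
       (\<forall>m u. real m \<le> \<eta> * w n \<longrightarrow> 0 \<le> u \<longrightarrow>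
          1 \<le> joint d p (r u) (4 * n\<^sup>2 - n) n / (lap d p 0 (4 * n\<^sup>2 - n) n)\<^sup>2 \<and>
          (joint d p (r u) (4 * n\<^sup>2 - n) n / (lap d p 0 (4 * n\<^sup>2 - n) n)\<^sup>2) ^ m \<le>
            (if u \<ge> uu n then 1 + e n else bb n))) sequentially"
  proof (rule eventually_mono, intro conjI allI impI)
    fix n assume "16 * C / (1 - s) * ln (2 * real n) / (c * real n) < 1 / 2 \<and> n \<ge> 3"
    then have n: "n \<ge> 3" and small: "16 * C / (1 - s) * ln (2 * real n) / (c * real n) < 1 / 2" by auto
    define b where "b = lap d p 0 (4 * n\<^sup>2 - n) n"
    define q where "q = 1 - b"
    have wq: "w n * q \<le> 16 * C / (1 - s) * ln (2 * real n)"
      unfolding q_def b_def by (rule survival_at_scale[OF s C n]) auto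
    have q: "0 < q" "q \<le> 1" using surv_bounds[of "4 * n\<^sup>2 - n" n] by (auto simp: q_def b_def)
    have "q \<le> 16 * C / (1 - s) * ln (2 * real n) / w n"
      using wq w_pos[of n] by (subst pos_le_divide_eq) (auto simp: mult.commute)
    also have "\<dots> \<le> 16 * C / (1 - s) * ln (2 * real n) / (c * real n)"
      by (rule divide_left_mono) (use c n w_pos[of n] s C in auto)
    finally have q2: "q < 1 / 2" using small by simp
    then have b: "b > 1 / 2" by (simp add: q_def)
    then show "lap d p 0 (4 * n\<^sup>2 - n) n > 0" by (simp add: b_def)
    fix m :: nat and u :: real
    assume m: "real m \<le> \<eta> * w n" and u: "0 \<le> u"
    define J where "J = joint d p (r u) (4 * n\<^sup>2 - n) n"
    have J: "b\<^sup>2 \<le> J" "J \<le> b"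
      using joint_bounds[of "exp (- u)" "r u" s "4 * n\<^sup>2 - n" n, OF _ _ r s(1)] s u
      unfolding J_def b_def by auto
    have b2: "b\<^sup>2 > 0" using b by simp
    show "1 \<le> joint d p (r u) (4 * n\<^sup>2 - n) n / (lap d p 0 (4 * n\<^sup>2 - n) n)\<^sup>2"
      using J b2 unfolding J_def b_def by simp
    have J0: "0 \<le> J / b\<^sup>2" using J b2 by (smt (verit) divide_nonneg_pos)
    have "(J / b\<^sup>2) ^ m \<le> (if u \<ge> uu n then 1 + e n else bb n)"
    proof (cases "u \<ge> uu n")
      case True
      \<comment> \<open>Far times: as \<open>b\<close> exceeds 1/2, the ratio exceeds 1 by at most 4
        times the covariance.\<close>
      have "J / b\<^sup>2 = 1 + (J - b\<^sup>2) / b\<^sup>2" using b by (simp add: field_simps)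
      also have "(J - b\<^sup>2) / b\<^sup>2 \<le> (J - b\<^sup>2) / (1 / 4)"
      proof (rule divide_left_mono)
        show "1 / 4 \<le> b\<^sup>2" using power_mono[of "1/2" b 2] b by (simp add: power2_eq_square)
      qed (use J b in auto)
      also have "1 + (J - b\<^sup>2) / (1 / 4) \<le> exp (4 * (J - b\<^sup>2))"
        using exp_ge_add_one_self[of "4 * (J - b\<^sup>2)"] by (simp only: divide_divide_eq_right)
      finally have "(J / b\<^sup>2) ^ m \<le> exp (4 * (J - b\<^sup>2)) ^ m"
        using J0 by (intro power_mono) auto
      also have "\<dots> = exp (4 * (real m * (J - b\<^sup>2)))"
        by (simp add: exp_of_nat_mult[symmetric] mult_ac)
      also have "real m * (J - b\<^sup>2) \<le> \<eta> * w n * (J - b\<^sup>2)"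
        using J by (intro mult_right_mono m) auto
      also have "\<dots> = \<eta> * (w n * (J - b\<^sup>2))" by simp
      also have "\<dots> \<le> \<eta> * W n"
        unfolding J_def b_def W_def using True
        by (intro mult_left_mono covariance_at_scale[OF s C c n _ r]) (use \<eta> in \<open>auto simp: uu_def\<close>)
      finally show ?thesis using True by (simp add: e_def mult_ac)
    next
      case False
      \<comment> \<open>Near times: the trivial bound \<open>J \<le> b\<close>, as if the two events
        coincided.\<close>
      have "J / b\<^sup>2 \<le> b / b\<^sup>2" using J b by (intro divide_right_mono) auto
      also have "\<dots> = 1 / b" using b by (simp add: power2_eq_square)
      also have "\<dots> \<le> 1 + 2 * q"
      proof -
        have "0 \<le> q * (1 - 2 * q)" using q q2 by simp
        then have "1 \<le> (1 + 2 * q) * b" by (simp add: q_def algebra_simps)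
        then show ?thesis using b by (simp add: field_simps)
      qed
      also have "\<dots> \<le> exp (2 * q)" using exp_ge_add_one_self[of "2 * q"] by simp
      finally have "(J / b\<^sup>2) ^ m \<le> exp (2 * q) ^ m"
        using J0 by (intro power_mono) auto
      also have "\<dots> = exp (2 * (real m * q))"
        by (simp add: exp_of_nat_mult[symmetric] mult_ac)
      also have "real m * q \<le> \<eta> * w n * q" using q by (intro mult_right_mono m) auto
      also have "\<dots> = \<eta> * (w n * q)" by simp
      also have "\<dots> \<le> \<eta> * (16 * C / (1 - s) * ln (2 * real n))"
        by (intro mult_left_mono wq) (use \<eta> in auto)
      also have "\<dots> = ln (2 * real n) / 8" using s1 C by (simp add: \<eta>_def field_simps)
      finally show ?thesis using False by (simp add: bb_def)
    qed
    then show "(joint d p (r u) (4 * n\<^sup>2 - n) n / (lap d p 0 (4 * n\<^sup>2 - n) n)\<^sup>2) ^ m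
       \<le> (if u \<ge> uu n then 1 + e n else bb n)" unfolding J_def b_def .
  qed
  show ?thesis
  proof (rule that[OF \<eta> _ _ e _ _ ev])
    show "bb n \<ge> 1" for n by (cases "n = 0") (auto simp: bb_def)
    show "e n \<ge> 0" for n using W0[of n] \<eta> by (simp add: e_def)
    show "(\<lambda>n. bb n * uu n) \<longlonglongrightarrow> 0" unfolding bb_def uu_def by real_asymp
    show "uu n \<ge> 0" for n by (simp add: uu_def)
  qed
qed

end

section \<open>Choice of the scales and tails of the sum of inverse weights\<close>

lemma card_near_le:
  fixes y :: real
  assumes "0 \<le> y"
  shows "real (card {h::nat. h < G \<and> \<bar>real g - real h\<bar> < y}) \<le> 2 * y + 1"
proof -
  define z where "z = \<lceil>y\<rceil>"
  have z: "z \<ge> 0" "real_of_int z < y + 1" using assms unfolding z_def by linarith+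
  have "int ` {h::nat. h < G \<and> \<bar>real g - real h\<bar> < y} \<subseteq> {int g - z <..< int g + z}"
  proof
    fix i assume "i \<in> int ` {h::nat. h < G \<and> \<bar>real g - real h\<bar> < y}"
    then obtain h where h: "i = int h" "\<bar>real g - real h\<bar> < y" by auto
    then have "\<bar>real_of_int (int g - int h)\<bar> < real_of_int z" using h unfolding z_def by simp linarith
    then have "\<bar>int g - int h\<bar> < z" by linarith
    then show "i \<in> {int g - z <..< int g + z}" using h by auto
  qed
  then have "card (int ` {h::nat. h < G \<and> \<bar>real g - real h\<bar> < y}) \<le> card {int g - z <..< int g + z}"
    by (rule card_mono[rotated]) simp
  also have "card (int ` {h::nat. h < G \<and> \<bar>real g - real h\<bar> < y}) = card {h::nat. h < G \<and> \<bar>real g - real h\<bar> < y}"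
    by (rule card_image) simp
  finally have "real (card {h::nat. h < G \<and> \<bar>real g - real h\<bar> < y}) \<le> real (card {int g - z <..< int g + z})"
    by simp
  also have "\<dots> \<le> 2 * y + 1"
    using z assms by (cases "z = 0") auto
  finally show ?thesis .
qed

text \<open>The scales are chosen one after the other, each one so large that it changes the average of
  the product over all pairs of grid points by little.\<close>

lemma scales_exist:
  fixes bb e uu :: "nat \<Rightarrow> real" and M n0 :: nat and l \<epsilon> :: real
  assumes bb: "\<And>n. bb n \<ge> 1" and e: "\<And>n. e n \<ge> 0" "e \<longlonglongrightarrow> 0"
    and uu: "\<And>n. uu n \<ge> 0" "(\<lambda>n. bb n * uu n) \<longlonglongrightarrow> 0" and l: "l > 0" and \<epsilon>: "\<epsilon> > 0"
  shows "\<exists>ns. (\<forall>i<M. ns i \<ge> n0) \<and> eventually (\<lambda>G. (\<Sum>g<G. \<Sum>h<G. \<Prod>i<M.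
     if \<bar>real g - real h\<bar> * l / real G \<ge> uu (ns i) then 1 + e (ns i) else bb (ns i)) \<le> (1 + \<epsilon>) * (real G)\<^sup>2)
     sequentially"
  using \<epsilon>
proof (induction M arbitrary: \<epsilon>)
  case 0
  have "real G * real G \<le> (1 + \<epsilon>) * (real G)\<^sup>2" for G
    using 0 by (simp add: power2_eq_square mult_right_mono mult_ac algebra_simps)
  then show ?case by simp
next
  case (Suc M)
  define f where "f = (\<lambda>n (G::nat) (g::nat) (h::nat).
     if \<bar>real g - real h\<bar> * l / real G \<ge> uu n then 1 + e n else bb n)"
  obtain ns where ns: "\<And>i. i < M \<Longrightarrow> ns i \<ge> n0"
    and IH: "eventually (\<lambda>G. (\<Sum>g<G. \<Sum>h<G. \<Prod>i<M. f (ns i) G g h) \<le> (1 + \<epsilon> / 2) * (real G)\<^sup>2) sequentially"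
    using Suc.IH[of "\<epsilon> / 2"] Suc.prems by (auto simp: f_def)
  \<comment> \<open>A bound on the product over the earlier scales that holds for every
    \<open>G\<close>, so that the new scale, and after it \<open>G\<close>, may depend on
    it.\<close>
  define K where "K = (\<Prod>i<M. 1 + e (ns i) + bb (ns i))"
  have f0: "0 \<le> f n G g h" for n G g h
    unfolding f_def using e(1)[of n] bb[of n] by auto
  have fle: "f n G g h \<le> 1 + e n + bb n" for n G g h
    unfolding f_def using e(1)[of n] bb[of n] by auto
  have K: "(\<Prod>i<M. f (ns i) G g h) \<le> K" for G g h
    unfolding K_def by (intro prod_mono) (use f0 fle in auto)
  have K0: "0 \<le> K" unfolding K_def using bb e by (intro prod_nonneg) (smt (verit))
  have lim: "(\<lambda>n. (1 + e n) * (1 + \<epsilon> / 2) + K * (2 / l) * (bb n * uu n)) \<longlonglongrightarrow>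
      (1 + 0) * (1 + \<epsilon> / 2) + K * (2 / l) * 0"
    by (intro tendsto_intros e uu)
  have "eventually (\<lambda>n. (1 + e n) * (1 + \<epsilon> / 2) + K * (2 / l) * (bb n * uu n) < 1 + 3 / 4 * \<epsilon> \<and> n \<ge> n0) sequentially"
    by (intro eventually_conj order_tendstoD(2)[OF lim] eventually_ge_at_top) (use Suc.prems in auto)
  then obtain n where n: "(1 + e n) * (1 + \<epsilon> / 2) + K * (2 / l) * (bb n * uu n) < 1 + 3 / 4 * \<epsilon>" "n \<ge> n0"
    by (auto simp: eventually_sequentially)
  define ns' where "ns' = ns(M := n)"
  have lim2: "(\<lambda>G. K * bb n / real G) \<longlonglongrightarrow> 0" by real_asymp
  have "eventually (\<lambda>G. K * bb n / real G < \<epsilon> / 4) sequentially"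
    by (rule order_tendstoD(2)[OF lim2]) (use Suc.prems in auto)
  then have "eventually (\<lambda>G. (\<Sum>g<G. \<Sum>h<G. \<Prod>i<Suc M. f (ns' i) G g h) \<le> (1 + \<epsilon>) * (real G)\<^sup>2) sequentially"
    using IH eventually_gt_at_top[of 0]
  proof eventually_elim
    case (elim G)
    define P where "P = (\<lambda>g h. \<Prod>i<M. f (ns i) G g h)"
    have P: "0 \<le> P g h" "P g h \<le> K" for g h
      using K f0 by (auto simp: P_def intro: prod_nonneg)
    \<comment> \<open>Near pairs for the new scale are those with distance below \<open>y\<close>.
      There are at most \<open>2 * y + 1\<close> for each \<open>g\<close>, which is a proportion
      \<open>2 * uu n / l + 1 / G\<close>; the first part is small by the choice of
      \<open>n\<close>, the second by that of \<open>G\<close>.\<close>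
    define y where "y = uu n * real G / l"
    have y: "y \<ge> 0" using uu l by (simp add: y_def)
    have fn: "f n G g h \<le> (1 + e n) + bb n * of_bool (\<bar>real g - real h\<bar> < y)" for g h
    proof (cases "\<bar>real g - real h\<bar> < y")
      case True
      then show ?thesis using e(1)[of n] bb[of n] by (auto simp: f_def)
    next
      case False
      then have "\<bar>real g - real h\<bar> * l / real G \<ge> uu n"
        using l elim by (simp add: y_def field_simps not_less)
      then show ?thesis using False by (auto simp: f_def)
    qed
    have "(\<Prod>i<Suc M. f (ns' i) G g h) \<le> (1 + e n) * P g h + K * bb n * of_bool (\<bar>real g - real h\<bar> < y)" for g h
    proof -
      have "(\<Prod>i<Suc M. f (ns' i) G g h) = P g h * f n G g h"
        by (simp add: ns'_def P_def)
      also have "\<dots> \<le> P g h * ((1 + e n) + bb n * of_bool (\<bar>real g - real h\<bar> < y))"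
        by (intro mult_left_mono fn P)
      also have "\<dots> = (1 + e n) * P g h + P g h * (bb n * of_bool (\<bar>real g - real h\<bar> < y))"
        by (simp add: algebra_simps)
      also have "\<dots> \<le> (1 + e n) * P g h + K * (bb n * of_bool (\<bar>real g - real h\<bar> < y))"
        by (intro add_left_mono mult_right_mono P) (use bb[of n] in auto)
      finally show ?thesis by (simp add: mult.assoc)
    qed
    then have "(\<Sum>g<G. \<Sum>h<G. \<Prod>i<Suc M. f (ns' i) G g h) \<le>
       (\<Sum>g<G. \<Sum>h<G. (1 + e n) * P g h + K * bb n * of_bool (\<bar>real g - real h\<bar> < y))"
      by (intro sum_mono)
    also have "\<dots> = (1 + e n) * (\<Sum>g<G. \<Sum>h<G. P g h) +
        K * bb n * (\<Sum>g<G. \<Sum>h<G. of_bool (\<bar>real g - real h\<bar> < y))"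
      by (simp only: sum.distrib sum_distrib_left)
    also have "\<dots> \<le> (1 + e n) * ((1 + \<epsilon> / 2) * (real G)\<^sup>2) + K * bb n * (real G * (2 * y + 1))"
    proof (intro add_mono mult_left_mono)
      show "(\<Sum>g<G. \<Sum>h<G. P g h) \<le> (1 + \<epsilon> / 2) * (real G)\<^sup>2" using elim by (simp add: P_def)
      have "(\<Sum>h<G. of_bool (\<bar>real g - real h\<bar> < y)) \<le> 2 * y + 1" for g
      proof -
        have "(\<Sum>h<G. of_bool (\<bar>real g - real h\<bar> < y)) = real (card {h::nat. h < G \<and> \<bar>real g - real h\<bar> < y})"
          by (simp add: Int_def)
        then show ?thesis using card_near_le[OF y] by simp
      qed
      then have "(\<Sum>g<G. \<Sum>h<G. of_bool (\<bar>real g - real h\<bar> < y)) \<le> (\<Sum>g<G. 2 * y + 1)"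
        by (intro sum_mono)
      then show "(\<Sum>g<G. \<Sum>h<G. of_bool (\<bar>real g - real h\<bar> < y)) \<le> real G * (2 * y + 1)" by simp
    qed (use e(1)[of n] K0 bb[of n] in auto)
    also have "\<dots> = ((1 + e n) * (1 + \<epsilon> / 2) + K * (2 / l) * (bb n * uu n) + K * bb n / real G) * (real G)\<^sup>2"
      using elim l by (simp add: y_def field_simps power2_eq_square)
    also have "\<dots> \<le> (1 + \<epsilon>) * (real G)\<^sup>2"
    proof (rule mult_right_mono)
      show "(1 + e n) * (1 + \<epsilon> / 2) + K * (2 / l) * (bb n * uu n) + K * bb n / real G \<le> 1 + \<epsilon>"
        using elim(1) n(1) by linarith
    qed simp
    finally show ?case .
  qed
  moreover have "\<forall>i<Suc M. ns' i \<ge> n0" using ns n by (auto simp: ns'_def less_Suc_eq)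
  ultimately show ?case by (intro exI[of _ ns']) (auto simp: f_def)
qed

text \<open>Comparison with the integral, whose antiderivative is \<open>f\<close>; the mean value
  theorem bounds each summand by an increment of \<open>f\<close>.\<close>

lemma sum_inverse_log_le:
  assumes \<alpha>: "\<alpha> > 1" and n: "n \<ge> 3"
  shows "(\<Sum>k=n..m. 1 / (real k * ln (real k) powr \<alpha>)) \<le> ln (real (n - 1)) powr (1 - \<alpha>) / (\<alpha> - 1)"
proof -
  define f where "f = (\<lambda>x::real. - (ln x powr (1 - \<alpha>)) / (\<alpha> - 1))"
  have f: "(f has_real_derivative (1 / (x * ln x powr \<alpha>))) (at x)" if "x > 1" for x
  proof -
    have "((\<lambda>x. ln x powr (1 - \<alpha>)) has_real_derivative
        (1 - \<alpha>) * ln x powr (1 - \<alpha> - of_nat 1) * (1 / x)) (at x)"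
      by (rule DERIV_fun_powr[OF DERIV_ln_divide]) (use that in auto)
    from DERIV_cdivide[OF DERIV_minus[OF this], of "\<alpha> - 1"]
    have "(f has_real_derivative (- ((1 - \<alpha>) * ln x powr (1 - \<alpha> - of_nat 1) * (1 / x))) / (\<alpha> - 1)) (at x)"
      by (simp add: f_def)
    also have "- ((1 - \<alpha>) * ln x powr (1 - \<alpha> - of_nat 1) * (1 / x)) = (\<alpha> - 1) * (ln x powr (- \<alpha>) * (1 / x))"
      by (simp add: left_diff_distrib diff_divide_distrib)
    finally show ?thesis using \<alpha> by (simp add: powr_minus_divide mult.commute)
  qed
  have step: "1 / (real k * ln (real k) powr \<alpha>) \<le> f (real k) - f (real (k - 1))" if "k \<ge> 3" for k
  proof -
    have "\<exists>z. z > real (k - 1) \<and> z < real k \<and> f (real k) - f (real (k - 1)) = (real k - real (k - 1)) * (1 / (z * ln z powr \<alpha>))"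
      by (rule MVT2) (use that f in auto)
    then obtain z where z: "z > real (k - 1)" "z < real k"
      "f (real k) - f (real (k - 1)) = (real k - real (k - 1)) * (1 / (z * ln z powr \<alpha>))" by blast
    have z1: "z > 1" using z that by auto
    have "1 / (real k * ln (real k) powr \<alpha>) \<le> 1 / (z * ln z powr \<alpha>)"
    proof (rule divide_left_mono)
      show "z * ln z powr \<alpha> \<le> real k * ln (real k) powr \<alpha>"
        using z z1 \<alpha> by (intro mult_mono powr_mono2) auto
    qed (use z z1 that in auto)
    then show ?thesis using z that by (simp add: of_nat_diff)
  qed
  have fneg: "f x \<le> 0" for x using \<alpha> by (simp add: f_def)
  have "(\<Sum>k=n..m. 1 / (real k * ln (real k) powr \<alpha>)) \<le> - f (real (n - 1))"
  proof (cases "n \<le> m")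
    case True
    have "(\<Sum>k=n..m. 1 / (real k * ln (real k) powr \<alpha>)) \<le> (\<Sum>k=n..m. f (real k) - f (real (k - 1)))"
      by (rule sum_mono) (use step n in auto)
    also have "\<dots> = f (real m) - f (real (n - 1))"
    proof -
      have "(\<Sum>k=Suc (n - 1)..m. f (real k) - f (real (k - 1))) = f (real m) - f (real (n - 1))"
        by (rule sum_telescope'') (use True in auto)
      then show ?thesis using n by simp
    qed
    finally show ?thesis using fneg[of "real m"] by simp
  qed (use fneg[of "real (n - 1)"] in auto)
  then show ?thesis by (simp add: f_def)
qed


section \<open>One step of the multi-scale construction\<close>

context perc_tree
begin

lemma card_reach_add:
  assumes "x \<in> V"
  shows "card (reach ob (m + n) x) = (\<Sum>c\<in>reach ob m x. card (reach ob n c))"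
  unfolding reach_add
proof (rule card_UN_disjoint)
  have c: "c \<in> V" "lev c = lev x + m" if "c \<in> reach ob m x" for c
    using that reach_subset_desc desc_V[OF assms] desc_lev[OF assms] by blast+
  show "finite (reach ob m x)" by (rule reach_fin[OF assms])
  show "\<forall>c\<in>reach ob m x. finite (reach ob n c)" using c reach_fin by blast
  show "\<forall>c\<in>reach ob m x. \<forall>c'\<in>reach ob m x. c \<noteq> c' \<longrightarrow> reach ob n c \<inter> reach ob n c' = {}"
  proof (intro ballI impI)
    fix c c' assume *: "c \<in> reach ob m x" "c' \<in> reach ob m x" "c \<noteq> c'"
    then have "desc n c \<inter> desc n c' = {}" using c by (intro desc_disjoint) auto
    then show "reach ob n c \<inter> reach ob n c' = {}"
      using reach_subset_desc[of ob n c] reach_subset_desc[of ob n c'] by blast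
  qed
qed

lemma lap_pr_bounds: "0 \<le> z \<Longrightarrow> z \<le> 1 \<Longrightarrow> 0 \<le> lap d (pr ob) z n k \<and> lap d (pr ob) z n k \<le> 1"
proof (induction n arbitrary: k)
  case (Suc n)
  have "0 \<le> 1 - pr ob (Suc k) + pr ob (Suc k) * lap d (pr ob) z n (Suc k)"
    using Suc pr_bounds[of ob "Suc k"] by (intro add_nonneg_nonneg mult_nonneg_nonneg) auto
  moreover have "pr ob (Suc k) * lap d (pr ob) z n (Suc k) \<le> pr ob (Suc k) * 1"
    using Suc pr_bounds[of ob "Suc k"] by (intro mult_left_mono) auto
  ultimately show ?case by (auto intro!: power_le_one)
qed simp

text \<open>Exponential Markov inequality. Given the vertices reached at depth \<open>m\<close>,
  what they reach is independent, so the Laplace transform becomes a power of \<open>lap\<close>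
  with exponent at least \<open>a\<close>.\<close>

lemma step_prob:
  assumes x: "x \<in> V" "below (m + n) x \<subseteq> A" and h: "0 \<le> h"
  shows "measure_pmf.prob Q {\<omega>. a \<le> card (rch ob \<omega> m x) \<and> real (card (rch ob \<omega> (m + n) x)) < a'} \<le>
    exp (h * a') * lap d (pr ob) (exp (- h)) n (lev x + m) ^ a"
proof -
  define z where "z = exp (- h)"
  have z: "0 < z" "z \<le> 1" using h by (auto simp: z_def)
  define L where "L = lap d (pr ob) z n (lev x + m)"
  have L: "0 \<le> L" "L \<le> 1" using lap_pr_bounds[of z ob n] z by (auto simp: L_def)
  define G where "G = (\<lambda>s::'v set. of_bool (a \<le> card s) :: real)"
  define H where "H = (\<lambda>c (s::'v set) \<omega>. if c \<in> s then z ^ card (rch ob \<omega> n c) else 1)"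
  let ?C = "desc m x"
  have c: "c \<in> V" "lev c = lev x + m" "below n c \<subseteq> A" if "c \<in> ?C" for c
    using that desc_V[OF x(1)] desc_lev[OF x(1)] below_desc_subset[of c m x n] x(2) by auto
  have sub: "rch ob \<omega> m x \<subseteq> ?C" for \<omega> by (rule reach_subset_desc)
  have pw: "z ^ card (rch ob \<omega> (m + n) x) = (\<Prod>c\<in>?C. H c (rch ob \<omega> m x) \<omega>)" for \<omega>
  proof -
    have "z ^ card (rch ob \<omega> (m + n) x) = (\<Prod>c\<in>rch ob \<omega> m x. z ^ card (rch ob \<omega> n c))"
      by (simp add: card_reach_add[OF x(1)] power_sum)
    also have "\<dots> = (\<Prod>c\<in>?C. H c (rch ob \<omega> m x) \<omega>)"
      using sub[of \<omega>] desc_fin[OF x(1)] unfolding H_def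
      by (subst prod.inter_filter[symmetric]) (auto intro!: prod.cong)
    finally show ?thesis .
  qed
  have "exp (- (h * a')) * measure_pmf.prob Q {\<omega>. a \<le> card (rch ob \<omega> m x) \<and> real (card (rch ob \<omega> (m + n) x)) < a'}
     = EE (\<lambda>\<omega>. exp (- (h * a')) * of_bool (a \<le> card (rch ob \<omega> m x) \<and> real (card (rch ob \<omega> (m + n) x)) < a'))"
    unfolding prob_eq_EE by simp
  also have "\<dots> \<le> EE (\<lambda>\<omega>. G (rch ob \<omega> m x) * (\<Prod>c\<in>?C. H c (rch ob \<omega> m x) \<omega>))"
  proof (rule EE_mono)
    fix \<omega>
    have "exp (- (h * a')) \<le> z ^ card (rch ob \<omega> (m + n) x)" if "real (card (rch ob \<omega> (m + n) x)) < a'"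
    proof -
      have "z ^ card (rch ob \<omega> (m + n) x) = exp (- (h * real (card (rch ob \<omega> (m + n) x))))"
        by (simp add: z_def exp_of_nat_mult[symmetric] mult.commute)
      moreover have "h * real (card (rch ob \<omega> (m + n) x)) \<le> h * a'"
        using that h by (intro mult_left_mono) auto
      ultimately show ?thesis by simp
    qed
    then show "exp (- (h * a')) * of_bool (a \<le> card (rch ob \<omega> m x) \<and> real (card (rch ob \<omega> (m + n) x)) < a')
        \<le> G (rch ob \<omega> m x) * (\<Prod>c\<in>?C. H c (rch ob \<omega> m x) \<omega>)"
      unfolding pw[symmetric] using z by (auto simp: G_def)
  qed
  also have "\<dots> = EE (\<lambda>\<omega>. G (rch ob \<omega> m x) * (\<Prod>c\<in>?C. EE (H c (rch ob \<omega> m x))))"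
  proof (rule EE_cut[where J = "below n"])
    show "depends_on (\<lambda>\<omega>. rch ob \<omega> m x) (below m x)" by (rule depends_on_reach) simp
    show "below m x \<subseteq> A" using x below_mono[of m "m + n" x] by auto
    show "finite ?C" by (rule desc_fin[OF x(1)])
    show "disjoint_family_on (below n) ?C"
      unfolding disjoint_family_on_def using below_disjoint c by (metis (no_types, lifting))
    show "below n c \<subseteq> A" if "c \<in> ?C" for c using c that by auto
    show "below m x \<inter> below n c = {}" if "c \<in> ?C" for c
      using below_lev[OF x(1), of _ m] below_lev[OF c(1)[OF that], of _ n] c(2)[OF that]
      by (metis (no_types, lifting) disjoint_iff not_less)
    show "depends_on (H c s) (below n c)" if "c \<in> ?C" for c s
    proof (cases "c \<in> s")
      case True
      then have "H c s = (\<lambda>\<omega>. z ^ card (rch ob \<omega> n c))" by (simp add: H_def)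
      then show ?thesis using depends_on_compose[OF depends_on_reach[OF subset_refl], of "\<lambda>r. z ^ card r"] by simp
    next
      case False
      then have "H c s = (\<lambda>\<omega>. 1)" by (simp add: H_def)
      then show ?thesis by simp
    qed
  qed
  also have "\<dots> \<le> EE (\<lambda>\<omega>. L ^ a)"
  proof (rule EE_mono)
    fix \<omega>
    have "(\<Prod>c\<in>?C. EE (H c (rch ob \<omega> m x))) = (\<Prod>c\<in>?C. if c \<in> rch ob \<omega> m x then L else 1)"
    proof (rule prod.cong[OF refl])
      fix c assume cC: "c \<in> ?C"
      show "EE (H c (rch ob \<omega> m x)) = (if c \<in> rch ob \<omega> m x then L else 1)"
        using EE_lap[OF c(1,3)[OF cC], of z ob] c(2)[OF cC] by (auto simp: H_def L_def)
    qed
    also have "\<dots> = L ^ card (rch ob \<omega> m x)"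
      using sub[of \<omega>] desc_fin[OF x(1), of m] by (simp add: prod.If_cases Int_absorb1)
    finally have eq: "(\<Prod>c\<in>?C. EE (H c (rch ob \<omega> m x))) = L ^ card (rch ob \<omega> m x)" .
    show "G (rch ob \<omega> m x) * (\<Prod>c\<in>?C. EE (H c (rch ob \<omega> m x))) \<le> L ^ a"
      unfolding eq G_def using L by (auto intro: power_decreasing)
  qed
  finally have "exp (- (h * a')) * measure_pmf.prob Q {\<omega>. a \<le> card (rch ob \<omega> m x) \<and>
      real (card (rch ob \<omega> (m + n) x)) < a'} \<le> L ^ a" by simp
  then have "exp (h * a') * (exp (- (h * a')) * measure_pmf.prob Q {\<omega>. a \<le> card (rch ob \<omega> m x) \<and>
      real (card (rch ob \<omega> (m + n) x)) < a'}) \<le> exp (h * a') * L ^ a"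
    by (intro mult_left_mono) auto
  then show ?thesis by (simp add: mult.assoc[symmetric] mult_exp_exp L_def z_def)
qed

text \<open>Markov's inequality for the function \<open>exp (- y) - 1 + y\<close>, which is
  nonnegative and at least \<open>exp (- 1) \<ge> 1 / 3\<close> for \<open>y \<ge> 1\<close>. Its
  mean is exactly the second order remainder that \<open>lap_exp_estimate\<close> controls.\<close>

lemma large_reach_prob:
  assumes x: "x \<in> V" "below n x \<subseteq> A" and h: "0 < h"
  shows "measure_pmf.prob Q {\<omega>. 1 / h \<le> real (card (rch ob \<omega> n x))} \<le>
    3 * (lap d (pr ob) (exp (- h)) n (lev x) - 1 + h * (\<Prod>i<n. real (d (lev x + i)) * pr ob (Suc (lev x + i))))"
proof -
  have f: "0 \<le> exp (- y) - 1 + y" for y :: real using exp_ge_add_one_self[of "- y"] by simp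
  have f1: "1 \<le> 3 * (exp (- y) - 1 + y)" if y: "1 \<le> y" for y :: real
  proof -
    define e where "e = exp (- 1 :: real)"
    have e: "1 / 3 \<le> e" "e \<le> 1" using exp_le by (simp_all add: e_def exp_minus field_simps)
    define v where "v = y - 1"
    have v: "0 \<le> v" "y = 1 + v" using y by (auto simp: v_def)
    have "e * (1 + - v) \<le> e * exp (- v)"
      using e by (intro mult_left_mono exp_ge_add_one_self) auto
    also have "e * exp (- v) = exp (- y)" unfolding e_def v by (simp add: mult_exp_exp)
    finally have "e - e * v \<le> exp (- y)" by (simp add: algebra_simps)
    moreover have "e * v \<le> v" using mult_right_mono[OF e(2) v(1)] by simp
    ultimately have "e - v \<le> exp (- y)" by simp
    then show ?thesis using e v by (simp add: algebra_simps)
  qed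
  have pw: "exp (- h) ^ k = exp (- (h * real k))" for k
    by (simp add: exp_of_nat_mult[symmetric] mult.commute)
  have "measure_pmf.prob Q {\<omega>. 1 / h \<le> real (card (rch ob \<omega> n x))} =
      EE (\<lambda>\<omega>. of_bool (1 / h \<le> real (card (rch ob \<omega> n x))))"
    by (rule prob_eq_EE)
  also have "\<dots> \<le> EE (\<lambda>\<omega>. 3 * (exp (- h) ^ card (rch ob \<omega> n x) - 1 + h * real (card (rch ob \<omega> n x))))"
  proof (rule EE_mono)
    fix \<omega>
    show "of_bool (1 / h \<le> real (card (rch ob \<omega> n x)))
        \<le> 3 * (exp (- h) ^ card (rch ob \<omega> n x) - 1 + h * real (card (rch ob \<omega> n x)))"
    proof (cases "1 / h \<le> real (card (rch ob \<omega> n x))")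
      case True
      then have "1 \<le> h * real (card (rch ob \<omega> n x))" using h by (simp add: field_simps)
      then show ?thesis unfolding pw using f1 True by simp
    next
      case False
      then show ?thesis unfolding pw using f[of "h * real (card (rch ob \<omega> n x))"] by simp
    qed
  qed
  also have "\<dots> = 3 * (EE (\<lambda>\<omega>. exp (- h) ^ card (rch ob \<omega> n x)) - 1 + h * EE (\<lambda>\<omega>. real (card (rch ob \<omega> n x))))"
    by simp
  finally show ?thesis unfolding EE_lap[OF x] EE_card_reach[OF x] .
qed

end


section \<open>Existence of a time without long paths\<close>

text \<open>\<open>x\<close> is the vertex to be cut off and \<open>desc m x\<close> are the
  vertices with scales of their own. \<open>cut b\<close> is the distance from \<open>b\<close> down
  to its scale, \<open>dep b\<close> the further distance within which everything has to die. Grid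
  times are numbered by \<open>g < G\<close>, and \<open>ob g\<close> reads the state at that time
  off an observation.\<close>

locale dead_time = perc_tree V ch par lev d A dflt law
  for V :: "'v set" and ch par lev d A and dflt :: 'b and law +
  fixes x :: 'v and m :: nat and cut dep :: "'v \<Rightarrow> nat" and N :: nat
    and ob :: "nat \<Rightarrow> 'b \<Rightarrow> bool" and p :: "nat \<Rightarrow> real" and r :: "nat \<Rightarrow> nat \<Rightarrow> nat \<Rightarrow> real"
    and \<theta> :: "'v \<Rightarrow> nat" and G :: nat
  assumes x: "x \<in> V" and below_A: "below N x \<subseteq> A"
    and mN: "m \<le> N" and N: "\<And>b. b \<in> desc m x \<Longrightarrow> m + cut b + dep b \<le> N"
    and p: "\<And>g k. g < G \<Longrightarrow> pr (ob g) k = p k"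
    and r: "\<And>g h k. g < G \<Longrightarrow> h < G \<Longrightarrow> pr (\<lambda>s. ob g s \<and> ob h s) k = r g h k"
    and \<beta>_pos: "\<And>b. b \<in> desc m x \<Longrightarrow> 0 < lap d p 0 (dep b) (lev x + m + cut b)"
    and ratio_ge: "\<And>b g h. b \<in> desc m x \<Longrightarrow> g < G \<Longrightarrow> h < G \<Longrightarrow>
        1 \<le> joint d p (r g h) (dep b) (lev x + m + cut b) / (lap d p 0 (dep b) (lev x + m + cut b))\<^sup>2"
begin

abbreviation \<beta> where "\<beta> b \<equiv> lap d p 0 (dep b) (lev x + m + cut b)"
abbreviation ratio where "ratio g h b \<equiv> joint d p (r g h) (dep b) (lev x + m + cut b) / (\<beta> b)\<^sup>2"

definition C where "C = Sigma (desc m x) (\<lambda>b. desc (cut b) b)"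
definition J where "J bc = below (dep (fst bc)) (snd bc)"
definition A0 where "A0 = below m x \<union> (\<Union>b\<in>desc m x. below (cut b) b)"
definition S where "S g \<omega> = {(b, c). b \<in> rch (ob g) \<omega> m x \<and> c \<in> rch (ob g) \<omega> (cut b) b}"
definition good :: "('v \<times> 'v) set \<Rightarrow> bool" where "good s \<longleftrightarrow> (\<forall>b\<in>desc m x. card {c. (b, c) \<in> s} \<le> \<theta> b)"
text \<open>Dividing by the extinction probability gives each factor mean 1. Thus \<open>Y g\<close>
  has the probability of \<open>good\<close> as its mean, and its mixed second moments reduce to
  correlation ratios at vertices reached at both times.\<close>

definition K where "K g bc \<omega> = of_bool (rch (ob g) \<omega> (dep (fst bc)) (snd bc) = {}) / \<beta> (fst bc)"
definition Y where "Y g \<omega> = of_bool (good (S g \<omega>)) * (\<Prod>bc\<in>C. if bc \<in> S g \<omega> then K g bc \<omega> else 1)"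

lemma b_props:
  assumes "b \<in> desc m x"
  shows "b \<in> V" "lev b = lev x + m" "below (cut b + dep b) b \<subseteq> A"
proof -
  show "b \<in> V" "lev b = lev x + m" using assms x by (auto intro: desc_V desc_lev)
  have "below (cut b + dep b) b \<subseteq> below (m + (cut b + dep b)) x" by (rule below_desc_subset[OF assms])
  also have "\<dots> \<subseteq> below N x" using N[OF assms] by (intro below_mono) simp
  also have "\<dots> \<subseteq> A" by (rule below_A)
  finally show "below (cut b + dep b) b \<subseteq> A" .
qed

lemma c_props:
  assumes "(b, c) \<in> C"
  shows "b \<in> desc m x" "c \<in> desc (cut b) b" "c \<in> V" "lev c = lev x + m + cut b"
    "J (b, c) \<subseteq> below (cut b + dep b) b" "J (b, c) \<subseteq> A"
proof -
  show bc: "b \<in> desc m x" "c \<in> desc (cut b) b" using assms by (auto simp: C_def)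
  show "c \<in> V" "lev c = lev x + m + cut b"
    using desc_V[OF b_props(1)[OF bc(1)] bc(2)] desc_lev[OF b_props(1)[OF bc(1)] bc(2)] b_props(2)[OF bc(1)] by auto
  show *: "J (b, c) \<subseteq> below (cut b + dep b) b"
    unfolding J_def using below_desc_subset[OF bc(2)] by simp
  show "J (b, c) \<subseteq> A" using * b_props(3)[OF bc(1)] by blast
qed

lemma finite_C: "finite C"
  unfolding C_def using x b_props(1) by (intro finite_SigmaI desc_fin) auto

lemma disjoint_J: "disjoint_family_on J C"
proof -
  have "J (b, c) \<inter> J (b', c') = {}" if "(b, c) \<in> C" "(b', c') \<in> C" "(b, c) \<noteq> (b', c')" for b c b' c'
  proof (cases "b = b'")
    case True
    then show ?thesis
      unfolding J_def using that c_props[OF that(1)] c_props[OF that(2)] by (simp add: below_disjoint)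
  next
    case False
    have "below (cut b + dep b) b \<inter> below (cut b' + dep b') b' = {}"
      using False b_props c_props(1)[OF that(1)] c_props(1)[OF that(2)] by (intro below_disjoint) auto
    then show ?thesis using c_props(5)[OF that(1)] c_props(5)[OF that(2)] by blast
  qed
  then show ?thesis unfolding disjoint_family_on_def by (metis prod.collapse)
qed

lemma A0_A: "A0 \<subseteq> A"
proof -
  have "below m x \<subseteq> A" using below_mono[OF mN, of x] below_A by blast
  moreover have "below (cut b) b \<subseteq> A" if "b \<in> desc m x" for b
    using below_mono[of "cut b" "cut b + dep b" b] b_props(3)[OF that] by auto
  ultimately show ?thesis unfolding A0_def by blast
qed

lemma A0_J: "bc \<in> C \<Longrightarrow> A0 \<inter> J bc = {}"
proof -
  assume "bc \<in> C"
  then obtain b c where bc: "bc = (b, c)" "(b, c) \<in> C" by (cases bc) auto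
  note c = c_props[OF bc(2)]
  have lv: "lev c < lev v" if "v \<in> J bc" for v
    using that below_lev[OF c(3)] by (auto simp: J_def bc)
  have "v \<notin> below m x" if "v \<in> J bc" for v
    using lv[OF that] below_lev[OF x, of v m] c(4) by auto
  moreover have "v \<notin> below (cut b') b'" if v: "v \<in> J bc" and b': "b' \<in> desc m x" for v b'
  proof (cases "b' = b")
    case True
    then show ?thesis using lv[OF v] below_lev[OF b_props(1)[OF c(1)], of v "cut b"] b_props(2)[OF c(1)] c(4) by auto
  next
    case False
    have "below (cut b + dep b) b \<inter> below (cut b') b' = {}"
      using False b_props c(1) b' by (intro below_disjoint) auto
    then show ?thesis using c(5) v by (auto simp: bc)
  qed
  ultimately show ?thesis unfolding A0_def by blast
qed

lemma depends_on_S: "depends_on (S g) A0"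
proof (rule depends_onI)
  fix \<omega> \<omega>' :: "'v \<Rightarrow> 'b" assume *: "\<And>v. v \<in> A0 \<Longrightarrow> \<omega> v = \<omega>' v"
  have m: "rch (ob g) \<omega> m x = rch (ob g) \<omega>' m x"
    by (rule reach_cong) (use * in \<open>auto simp: A0_def\<close>)
  have "rch (ob g) \<omega> (cut b) b = rch (ob g) \<omega>' (cut b) b" if "b \<in> rch (ob g) \<omega>' m x" for b
  proof (rule reach_cong)
    fix v assume "v \<in> below (cut b) b"
    moreover have "b \<in> desc m x" using that reach_subset_desc by blast
    ultimately have "v \<in> A0" unfolding A0_def by blast
    then show "ob g (\<omega> v) = ob g (\<omega>' v)" using *[of v] by simp
  qed
  then show "S g \<omega> = S g \<omega>'" unfolding S_def m by auto
qed

lemma S_C: "S g \<omega> \<subseteq> C"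
  unfolding S_def C_def using reach_subset_desc by fastforce

lemma depends_on_K: "depends_on (K g bc) (J bc)"
  unfolding K_def
  by (rule depends_on_compose[where g = "\<lambda>R. of_bool (R = {}) / \<beta> (fst bc)"], rule depends_on_reach)
     (simp add: J_def)

lemma pr_eq: "g < G \<Longrightarrow> pr (ob g) = p"
  using p by auto

lemma EE_K:
  assumes "bc \<in> C" "g < G"
  shows "EE (K g bc) = 1"
proof -
  obtain b c where bc: "bc = (b, c)" "(b, c) \<in> C" using assms by (cases bc) auto
  note c = c_props[OF bc(2)]
  have "EE (\<lambda>\<omega>. of_bool (rch (ob g) \<omega> (dep b) c = {})) = \<beta> b"
    using EE_dead[OF c(3), of "dep b" "ob g"] c(4,6) pr_eq[OF assms(2)] by (simp add: J_def)
  then show ?thesis using \<beta>_pos[OF c(1)] by (simp add: K_def[abs_def] bc)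
qed

lemma EE_KK:
  assumes "bc \<in> C" "g < G" "h < G"
  shows "EE (\<lambda>\<omega>. K g bc \<omega> * K h bc \<omega>) = ratio g h (fst bc)"
proof -
  obtain b c where bc: "bc = (b, c)" "(b, c) \<in> C" using assms by (cases bc) auto
  note c = c_props[OF bc(2)]
  have "EE (\<lambda>\<omega>. of_bool (rch (ob g) \<omega> (dep b) c = {}) * of_bool (rch (ob h) \<omega> (dep b) c = {})) =
      joint d p (r g h) (dep b) (lev c)"
    by (rule EE_joint) (use c p r assms in \<open>auto simp: J_def\<close>)
  moreover have "K g bc \<omega> * K h bc \<omega> = of_bool (rch (ob g) \<omega> (dep b) c = {}) * of_bool (rch (ob h) \<omega> (dep b) c = {}) / (\<beta> b)\<^sup>2" for \<omega>
    by (simp add: K_def bc power2_eq_square)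
  ultimately show ?thesis using c(4) by (simp add: bc)
qed

lemma EE_Y:
  assumes g: "g < G"
  shows "EE (Y g) = measure_pmf.prob Q {\<omega>. good (S g \<omega>)}"
proof -
  define H where "H = (\<lambda>bc s \<omega>. if bc \<in> s then K g bc \<omega> else 1)"
  have "EE (Y g) = EE (\<lambda>\<omega>. of_bool (good (S g \<omega>)) * (\<Prod>bc\<in>C. H bc (S g \<omega>) \<omega>))"
    by (simp add: Y_def[abs_def] H_def)
  also have "\<dots> = EE (\<lambda>\<omega>. of_bool (good (S g \<omega>)) * (\<Prod>bc\<in>C. EE (H bc (S g \<omega>))))"
  proof (rule EE_cut[OF depends_on_S A0_A finite_C disjoint_J _ A0_J])
    show "J bc \<subseteq> A" if "bc \<in> C" for bc using c_props(6)[of "fst bc" "snd bc"] that by simp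
    show "depends_on (H bc s) (J bc)" for bc s
      using depends_on_K by (cases "bc \<in> s") (auto simp: H_def)
  qed auto
  also have "\<dots> = EE (\<lambda>\<omega>. of_bool (good (S g \<omega>)))"
  proof (rule EE_cong)
    fix \<omega>
    have "EE (H bc (S g \<omega>)) = 1" if "bc \<in> C" for bc
      using EE_K[OF that g] by (cases "bc \<in> S g \<omega>") (simp_all add: H_def)
    then have "(\<Prod>bc\<in>C. EE (H bc (S g \<omega>))) = 1" by (intro prod.neutral) blast
    then show "of_bool (good (S g \<omega>)) * (\<Prod>bc\<in>C. EE (H bc (S g \<omega>))) = of_bool (good (S g \<omega>))" by simp
  qed
  finally show ?thesis by (simp add: prob_eq_EE)
qed

text \<open>Given the vertices reached at the two times, one reached at a single time contributes 1
  and a common one contributes \<open>ratio \<ge> 1\<close>; \<open>good\<close> allows at most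
  \<open>\<theta> b\<close> common ones below \<open>b\<close>.\<close>

lemma EE_YY:
  assumes gh: "g < G" "h < G"
  shows "EE (\<lambda>\<omega>. Y g \<omega> * Y h \<omega>) \<le> (\<Prod>b\<in>desc m x. ratio g h b ^ \<theta> b)"
proof -
  define H where "H = (\<lambda>bc s \<omega>. (if bc \<in> fst s then K g bc \<omega> else 1) * (if bc \<in> snd s then K h bc \<omega> else 1))"
  define D where "D = (\<lambda>s. of_bool (good (fst s)) * of_bool (good (snd s)) :: real)"
  define \<sigma> where "\<sigma> = (\<lambda>\<omega>. (S g \<omega>, S h \<omega>))"
  have \<sigma>: "depends_on \<sigma> A0"
    unfolding \<sigma>_def by (rule depends_on_compose2[OF depends_on_S depends_on_S])
  have "EE (\<lambda>\<omega>. Y g \<omega> * Y h \<omega>) = EE (\<lambda>\<omega>. D (\<sigma> \<omega>) * (\<Prod>bc\<in>C. H bc (\<sigma> \<omega>) \<omega>))"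
    by (simp add: Y_def H_def D_def \<sigma>_def prod.distrib mult_ac)
  also have "\<dots> = EE (\<lambda>\<omega>. D (\<sigma> \<omega>) * (\<Prod>bc\<in>C. EE (H bc (\<sigma> \<omega>))))"
  proof (rule EE_cut[OF \<sigma> A0_A finite_C disjoint_J _ A0_J])
    show "J bc \<subseteq> A" if "bc \<in> C" for bc using c_props(6)[of "fst bc" "snd bc"] that by simp
    fix bc s
    have "depends_on (\<lambda>\<omega>. if bc \<in> fst s then K g bc \<omega> else 1) (J bc)"
      "depends_on (\<lambda>\<omega>. if bc \<in> snd s then K h bc \<omega> else 1) (J bc)"
      using depends_on_K by (cases "bc \<in> fst s"; cases "bc \<in> snd s"; simp)+
    then show "depends_on (H bc s) (J bc)" unfolding H_def by (rule depends_on_compose2)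
  qed auto
  also have "\<dots> \<le> EE (\<lambda>\<omega>. \<Prod>b\<in>desc m x. ratio g h b ^ \<theta> b)"
  proof (rule EE_mono)
    fix \<omega>
    have r1: "1 \<le> ratio g h b" if "b \<in> desc m x" for b by (rule ratio_ge[OF that gh])
    have "(\<Prod>bc\<in>C. EE (H bc (\<sigma> \<omega>))) = (\<Prod>bc\<in>C. if bc \<in> S g \<omega> \<inter> S h \<omega> then ratio g h (fst bc) else 1)"
    proof (rule prod.cong[OF refl])
      fix bc assume "bc \<in> C"
      then show "EE (H bc (\<sigma> \<omega>)) = (if bc \<in> S g \<omega> \<inter> S h \<omega> then ratio g h (fst bc) else 1)"
        using EE_K[OF _ gh(1)] EE_K[OF _ gh(2)] EE_KK[OF _ gh]
        by (cases "bc \<in> S g \<omega>"; cases "bc \<in> S h \<omega>") (simp_all add: H_def \<sigma>_def)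
    qed
    also have "\<dots> = (\<Prod>b\<in>desc m x. \<Prod>c\<in>desc (cut b) b. if (b, c) \<in> S g \<omega> \<inter> S h \<omega> then ratio g h b else 1)"
      unfolding C_def using desc_fin[OF x] b_props(1) desc_fin
      by (subst prod.Sigma) (auto simp: case_prod_unfold)
    also have "\<dots> = (\<Prod>b\<in>desc m x. ratio g h b ^ card {c \<in> desc (cut b) b. (b, c) \<in> S g \<omega> \<inter> S h \<omega>})"
    proof (rule prod.cong[OF refl])
      fix b assume "b \<in> desc m x"
      then have "finite (desc (cut b) b)" using b_props(1) desc_fin by blast
      then show "(\<Prod>c\<in>desc (cut b) b. if (b, c) \<in> S g \<omega> \<inter> S h \<omega> then ratio g h b else 1) =
          ratio g h b ^ card {c \<in> desc (cut b) b. (b, c) \<in> S g \<omega> \<inter> S h \<omega>}"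
        by (subst prod.inter_filter[symmetric]) auto
    qed
    finally have eq: "(\<Prod>bc\<in>C. EE (H bc (\<sigma> \<omega>))) =
        (\<Prod>b\<in>desc m x. ratio g h b ^ card {c \<in> desc (cut b) b. (b, c) \<in> S g \<omega> \<inter> S h \<omega>})" .
    show "D (\<sigma> \<omega>) * (\<Prod>bc\<in>C. EE (H bc (\<sigma> \<omega>))) \<le> (\<Prod>b\<in>desc m x. ratio g h b ^ \<theta> b)"
    proof (cases "good (S g \<omega>)")
      case True
      have "(\<Prod>b\<in>desc m x. ratio g h b ^ card {c \<in> desc (cut b) b. (b, c) \<in> S g \<omega> \<inter> S h \<omega>})
          \<le> (\<Prod>b\<in>desc m x. ratio g h b ^ \<theta> b)"
      proof (rule prod_mono, intro conjI)
        fix b assume b: "b \<in> desc m x"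
        show "0 \<le> ratio g h b ^ card {c \<in> desc (cut b) b. (b, c) \<in> S g \<omega> \<inter> S h \<omega>}"
          using r1[OF b] by (intro zero_le_power) linarith
        have sub: "{c. (b, c) \<in> S g \<omega>} \<subseteq> desc (cut b) b" using S_C[of g \<omega>] by (auto simp: C_def)
        have "card {c \<in> desc (cut b) b. (b, c) \<in> S g \<omega> \<inter> S h \<omega>} \<le> card {c. (b, c) \<in> S g \<omega>}"
          by (rule card_mono[OF finite_subset[OF sub desc_fin[OF b_props(1)[OF b]]]]) auto
        also have "\<dots> \<le> \<theta> b" using True b by (auto simp: good_def)
        finally show "ratio g h b ^ card {c \<in> desc (cut b) b. (b, c) \<in> S g \<omega> \<inter> S h \<omega>} \<le> ratio g h b ^ \<theta> b"
          by (intro power_increasing r1[OF b])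
      qed
      moreover have "0 \<le> (\<Prod>b\<in>desc m x. ratio g h b ^ card {c \<in> desc (cut b) b. (b, c) \<in> S g \<omega> \<inter> S h \<omega>})"
        by (intro prod_nonneg zero_le_power) (use r1 in fastforce)
      moreover have "0 \<le> D (\<sigma> \<omega>)" "D (\<sigma> \<omega>) \<le> 1" by (simp_all add: D_def)
      ultimately show ?thesis
        unfolding eq by (intro order.trans[OF mult_left_le_one_le]) blast+
    next
      case False
      have "0 \<le> (\<Prod>b\<in>desc m x. ratio g h b ^ \<theta> b)"
        by (intro prod_nonneg zero_le_power) (use r1 in fastforce)
      then show ?thesis using False by (simp add: D_def \<sigma>_def)
    qed
  qed
  finally show ?thesis by simp
qed

text \<open>A path down to depth \<open>N\<close> passes through some \<open>b\<close> and then
  through some \<open>c\<close> at the scale of \<open>b\<close>, and survives \<open>dep b\<close>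
  levels further, so one factor of \<open>Y\<close> vanishes.\<close>

lemma Y_eq_0:
  assumes "rch (ob g) \<omega> N x \<noteq> {}"
  shows "Y g \<omega> = 0"
proof -
  have "N = m + (N - m)" using mN by simp
  then have "rch (ob g) \<omega> N x = (\<Union>b\<in>rch (ob g) \<omega> m x. rch (ob g) \<omega> (N - m) b)"
    using reach_add[of "\<lambda>v. ob g (\<omega> v)" m "N - m" x] by simp
  then obtain b where b: "b \<in> rch (ob g) \<omega> m x" "rch (ob g) \<omega> (N - m) b \<noteq> {}" using assms by auto
  have bm: "b \<in> desc m x" using b reach_subset_desc by blast
  define k where "k = N - m - cut b - dep b"
  have k: "N - m = cut b + (dep b + k)" using N[OF bm] by (simp add: k_def)
  have "rch (ob g) \<omega> (N - m) b =
      (\<Union>c\<in>rch (ob g) \<omega> (cut b) b. \<Union>c'\<in>rch (ob g) \<omega> (dep b) c. rch (ob g) \<omega> k c')"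
    unfolding k reach_add ..
  then obtain c where c: "c \<in> rch (ob g) \<omega> (cut b) b" "rch (ob g) \<omega> (dep b) c \<noteq> {}" using b by auto
  have "(b, c) \<in> S g \<omega>" using b c by (simp add: S_def)
  moreover have "K g (b, c) \<omega> = 0" using c by (simp add: K_def)
  moreover have "(b, c) \<in> C" using S_C calculation by blast
  ultimately have "(\<Prod>bc\<in>C. if bc \<in> S g \<omega> then K g bc \<omega> else 1) = 0"
    using finite_C by (intro prod_zero bexI[of _ "(b, c)"]) auto
  then show ?thesis by (simp add: Y_def)
qed

text \<open>If every grid time has a long path then the average of the \<open>Y\<close> vanishes, and hence it is
  at distance 1 from its approximate mean.\<close>

lemma all_alive_prob:
  assumes G: "G > 0"
    and mean: "\<And>g. g < G \<Longrightarrow> measure_pmf.prob Q {\<omega>. \<not> good (S g \<omega>)} \<le> \<epsilon>"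
    and sq: "(\<Sum>g<G. \<Sum>h<G. \<Prod>b\<in>desc m x. ratio g h b ^ \<theta> b) \<le> (1 + \<epsilon>) * (real G)\<^sup>2"
  shows "measure_pmf.prob Q {\<omega>. \<forall>g<G. rch (ob g) \<omega> N x \<noteq> {}} \<le> 3 * \<epsilon>"
proof -
  define Z where "Z = (\<lambda>\<omega>. (\<Sum>g<G. Y g \<omega>) / real G)"
  have 1: "EE Z \<ge> 1 - \<epsilon>"
  proof -
    have "EE (Y g) \<ge> 1 - \<epsilon>" if "g < G" for g
    proof -
      have "measure_pmf.prob Q {\<omega>. \<not> good (S g \<omega>)} = 1 - measure_pmf.prob Q {\<omega>. good (S g \<omega>)}"
        using measure_pmf.prob_compl[of "{\<omega>. good (S g \<omega>)}" Q] by (simp add: Compl_eq_Diff_UNIV[symmetric] Collect_neg_eq)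
      then show ?thesis using mean[OF that] EE_Y[OF that] by linarith
    qed
    then have "(\<Sum>g<G. 1 - \<epsilon>) \<le> (\<Sum>g<G. EE (Y g))" by (intro sum_mono) auto
    then have "real G * (1 - \<epsilon>) \<le> EE (\<lambda>\<omega>. \<Sum>g<G. Y g \<omega>)" by (simp add: EE_sum)
    then show ?thesis using G by (simp add: Z_def field_simps)
  qed
  have 2: "EE (\<lambda>\<omega>. (Z \<omega>)\<^sup>2) \<le> 1 + \<epsilon>"
  proof -
    have "(Z \<omega>)\<^sup>2 = (\<Sum>g<G. \<Sum>h<G. Y g \<omega> * Y h \<omega>) / (real G)\<^sup>2" for \<omega>
      by (simp add: Z_def power2_eq_square sum_product)
    then have "EE (\<lambda>\<omega>. (Z \<omega>)\<^sup>2) = (\<Sum>g<G. \<Sum>h<G. EE (\<lambda>\<omega>. Y g \<omega> * Y h \<omega>)) / (real G)\<^sup>2"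
      by (simp add: EE_sum)
    also have "\<dots> \<le> (\<Sum>g<G. \<Sum>h<G. \<Prod>b\<in>desc m x. ratio g h b ^ \<theta> b) / (real G)\<^sup>2"
      by (intro divide_right_mono sum_mono EE_YY) auto
    also have "\<dots> \<le> (1 + \<epsilon>) * (real G)\<^sup>2 / (real G)\<^sup>2" by (intro divide_right_mono sq) auto
    finally show ?thesis using G by simp
  qed
  have "measure_pmf.prob Q {\<omega>. \<forall>g<G. rch (ob g) \<omega> N x \<noteq> {}} =
      EE (\<lambda>\<omega>. of_bool (\<forall>g<G. rch (ob g) \<omega> N x \<noteq> {}))"
    by (rule prob_eq_EE)
  \<comment> \<open>Chebyshev's inequality around 1 instead of the mean: the result is
    \<open>(1 + \<epsilon>) - 2 * (1 - \<epsilon>) + 1\<close>.\<close>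
  also have "\<dots> \<le> EE (\<lambda>\<omega>. (Z \<omega>)\<^sup>2 - 2 * Z \<omega> + 1)"
  proof (rule EE_mono)
    fix \<omega>
    have "(Z \<omega>)\<^sup>2 - 2 * Z \<omega> + 1 = (Z \<omega> - 1)\<^sup>2" by (simp add: power2_eq_square algebra_simps)
    moreover have "Z \<omega> = 0" if "\<forall>g<G. rch (ob g) \<omega> N x \<noteq> {}"
      using that Y_eq_0 by (simp add: Z_def)
    ultimately show "of_bool (\<forall>g<G. rch (ob g) \<omega> N x \<noteq> {}) \<le> (Z \<omega>)\<^sup>2 - 2 * Z \<omega> + 1"
      by (cases "\<forall>g<G. rch (ob g) \<omega> N x \<noteq> {}") auto
  qed
  also have "\<dots> = EE (\<lambda>\<omega>. (Z \<omega>)\<^sup>2) - 2 * EE Z + 1" by simp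
  also have "\<dots> \<le> 3 * \<epsilon>" using 1 2 by linarith
  finally show ?thesis .
qed

text \<open>Union bound over the reached \<open>b\<close> only: reaching \<open>b\<close> depends on
  edges above it and is independent of what happens below, so the number of candidates enters
  through its mean.\<close>

lemma not_good_prob:
  assumes \<tau>: "\<And>b. b \<in> desc m x \<Longrightarrow>
      measure_pmf.prob Q {\<omega>. \<theta> b < card (rch (ob g) \<omega> (cut b) b)} \<le> \<tau>"
    and g: "g < G"
  shows "measure_pmf.prob Q {\<omega>. \<not> good (S g \<omega>)} \<le> (\<Prod>i<m. real (d (lev x + i)) * p (Suc (lev x + i))) * \<tau>"
proof -
  let ?I = "\<lambda>b \<omega>. of_bool (b \<in> rch (ob g) \<omega> m x) :: real"
  let ?T = "\<lambda>b \<omega>. of_bool (\<theta> b < card (rch (ob g) \<omega> (cut b) b)) :: real"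
  have fin: "finite (desc m x)" by (rule desc_fin[OF x])
  have "measure_pmf.prob Q {\<omega>. \<not> good (S g \<omega>)} = EE (\<lambda>\<omega>. of_bool (\<not> good (S g \<omega>)))"
    by (rule prob_eq_EE)
  also have "\<dots> \<le> EE (\<lambda>\<omega>. \<Sum>b\<in>desc m x. ?I b \<omega> * ?T b \<omega>)"
  proof (rule EE_mono)
    fix \<omega>
    show "of_bool (\<not> good (S g \<omega>)) \<le> (\<Sum>b\<in>desc m x. ?I b \<omega> * ?T b \<omega>)"
    proof (cases "good (S g \<omega>)")
      case True
      then show ?thesis by (simp add: sum_nonneg)
    next
      case False
      then obtain b where b: "b \<in> desc m x" "\<theta> b < card {c. (b, c) \<in> S g \<omega>}"
        by (auto simp: good_def not_le)
      have "{c. (b, c) \<in> S g \<omega>} = (if b \<in> rch (ob g) \<omega> m x then rch (ob g) \<omega> (cut b) b else {})"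
        by (auto simp: S_def)
      then have "?I b \<omega> * ?T b \<omega> = 1" using b by (auto split: if_splits)
      moreover have "?I b \<omega> * ?T b \<omega> \<le> (\<Sum>b\<in>desc m x. ?I b \<omega> * ?T b \<omega>)"
        by (rule member_le_sum[OF b(1) _ fin]) auto
      ultimately show ?thesis using False by simp
    qed
  qed
  also have "\<dots> = (\<Sum>b\<in>desc m x. EE (\<lambda>\<omega>. ?I b \<omega> * ?T b \<omega>))" by (rule EE_sum)
  also have "\<dots> \<le> (\<Sum>b\<in>desc m x. EE (?I b) * \<tau>)"
  proof (rule sum_mono)
    fix b assume b: "b \<in> desc m x"
    note bp = b_props[OF b]
    have sub: "below m x \<subseteq> A" "below (cut b) b \<subseteq> A" using A0_A b by (auto simp: A0_def)
    have "EE (\<lambda>\<omega>. ?I b \<omega> * ?T b \<omega>) = EE (?I b) * EE (?T b)"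
    proof (rule EE_mult)
      show "depends_on (?I b) (below m x)"
        by (rule depends_on_compose[OF depends_on_reach[OF subset_refl], of "\<lambda>R. of_bool (b \<in> R)"])
      show "depends_on (?T b) (below (cut b) b)"
        by (rule depends_on_compose[OF depends_on_reach[OF subset_refl], of "\<lambda>R. of_bool (\<theta> b < card R)"])
      show "below m x \<inter> below (cut b) b = {}"
        using below_lev[OF x, of _ m] below_lev[OF bp(1), of _ "cut b"] bp(2)
        by (metis (no_types, lifting) disjoint_iff not_less)
    qed (use sub in auto)
    also have "EE (?T b) \<le> \<tau>" using \<tau>[OF b] by (simp add: prob_eq_EE)
    then have "EE (?I b) * EE (?T b) \<le> EE (?I b) * \<tau>"
      by (intro mult_left_mono integral_nonneg_AE) auto
    finally show "EE (\<lambda>\<omega>. ?I b \<omega> * ?T b \<omega>) \<le> EE (?I b) * \<tau>" .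
  qed
  also have "\<dots> = EE (\<lambda>\<omega>. \<Sum>b\<in>desc m x. ?I b \<omega>) * \<tau>"
    by (simp add: EE_sum sum_distrib_right)
  also have "EE (\<lambda>\<omega>. \<Sum>b\<in>desc m x. ?I b \<omega>) = EE (\<lambda>\<omega>. real (card (rch (ob g) \<omega> m x)))"
  proof (rule EE_cong)
    fix \<omega>
    have "desc m x \<inter> {b. b \<in> rch (ob g) \<omega> m x} = rch (ob g) \<omega> m x"
      using reach_subset_desc by blast
    then show "(\<Sum>b\<in>desc m x. ?I b \<omega>) = real (card (rch (ob g) \<omega> m x))" using fin by simp
  qed
  also have "\<dots> = (\<Prod>i<m. real (d (lev x + i)) * p (Suc (lev x + i)))"
  proof -
    have "below m x \<subseteq> A" using A0_A by (auto simp: A0_def)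
    then show ?thesis using EE_card_reach[OF x, of m "ob g"] pr_eq[OF g] by simp
  qed
  finally show ?thesis .
qed

end


section \<open>From independent variables to a product of finite distributions\<close>

text \<open>The bridge from the given probability space to computations with \<open>Pi_pmf\<close>:
  both sides are finite sums over the possible configurations.\<close>

lemma (in prob_space) transfer_finite_product:
  fixes dflt :: 'b and \<xi> :: "'v \<Rightarrow> 'a \<Rightarrow> 'b" and P :: "'v \<Rightarrow> 'b pmf" and f :: "('v \<Rightarrow> 'b) \<Rightarrow> real"
  assumes A: "finite A" and R: "finite R" "\<And>v \<omega>. v \<in> A \<Longrightarrow> \<omega> \<in> space M \<Longrightarrow> \<xi> v \<omega> \<in> R"
    and rv: "\<And>v. v \<in> A \<Longrightarrow> \<xi> v \<in> measurable M (count_space UNIV)"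
    and supp: "\<And>v. v \<in> A \<Longrightarrow> set_pmf (P v) \<subseteq> R"
    and ind: "\<And>g. prob {\<omega> \<in> space M. \<forall>v\<in>A. \<xi> v \<omega> = g v} = (\<Prod>v\<in>A. pmf (P v) (g v))"
  defines "\<Xi> \<equiv> \<lambda>\<omega> v. if v \<in> A then \<xi> v \<omega> else dflt"
  shows "\<And>g. {\<omega> \<in> space M. \<Xi> \<omega> = g} \<in> events"
    and "expectation (\<lambda>\<omega>. f (\<Xi> \<omega>)) = measure_pmf.expectation (Pi_pmf A dflt P) f"
    and "{\<omega> \<in> space M. Q (\<Xi> \<omega>)} \<in> events"
    and "prob {\<omega> \<in> space M. Q (\<Xi> \<omega>)} = measure_pmf.prob (Pi_pmf A dflt P) {g. Q g}"
proof -
  define S where "S = PiE_dflt A dflt (\<lambda>_. R)"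
  have S: "finite S" unfolding S_def using A R by (intro finite_PiE_dflt) auto
  have \<Xi>S: "\<Xi> \<omega> \<in> S" if "\<omega> \<in> space M" for \<omega>
    using R that by (auto simp: S_def \<Xi>_def PiE_dflt_def)
  have eqs: "{\<omega> \<in> space M. \<Xi> \<omega> = g} = (if \<forall>v. v \<notin> A \<longrightarrow> g v = dflt
      then {\<omega> \<in> space M. \<forall>v\<in>A. \<xi> v \<omega> = g v} else {})" for g
    by (auto simp: \<Xi>_def fun_eq_iff)
  have sing: "{\<omega> \<in> space M. \<xi> v \<omega> = y} \<in> events" if "v \<in> A" for v y
  proof -
    have "{\<omega> \<in> space M. \<xi> v \<omega> = y} = \<xi> v -` {y} \<inter> space M" by blast
    then show ?thesis using measurable_sets[OF rv[OF that], of "{y}"] by simp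
  qed
  have ev: "{\<omega> \<in> space M. \<forall>v\<in>A. \<xi> v \<omega> = g v} \<in> events" for g
    by (rule sets.sets_Collect_finite_All[OF sing A])
  show ev': "{\<omega> \<in> space M. \<Xi> \<omega> = g} \<in> events" for g
    unfolding eqs using ev by simp
  have pr: "prob {\<omega> \<in> space M. \<Xi> \<omega> = g} = pmf (Pi_pmf A dflt P) g" for g
  proof (cases "\<forall>v. v \<notin> A \<longrightarrow> g v = dflt")
    case True
    then show ?thesis unfolding eqs using ind[of g] A by (simp add: pmf_Pi')
  next
    case False
    then show ?thesis unfolding eqs using pmf_Pi[OF A, of dflt P g] by (auto simp: if_not_P)
  qed
  have main: "expectation (\<lambda>\<omega>. f (\<Xi> \<omega>)) = measure_pmf.expectation (Pi_pmf A dflt P) f"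
    for f :: "('v \<Rightarrow> 'b) \<Rightarrow> real"
  proof -
    have "expectation (\<lambda>\<omega>. f (\<Xi> \<omega>)) =
        expectation (\<lambda>\<omega>. \<Sum>g\<in>S. f g * indicator {\<omega> \<in> space M. \<Xi> \<omega> = g} \<omega>)"
    proof (rule Bochner_Integration.integral_cong[OF refl])
      fix \<omega> assume \<omega>: "\<omega> \<in> space M"
      have "(\<Sum>g\<in>S. f g * indicator {\<omega> \<in> space M. \<Xi> \<omega> = g} \<omega>) = (\<Sum>g\<in>S. if g = \<Xi> \<omega> then f g else 0)"
        using \<omega> by (intro sum.cong) auto
      then show "f (\<Xi> \<omega>) = (\<Sum>g\<in>S. f g * indicator {\<omega> \<in> space M. \<Xi> \<omega> = g} \<omega>)"
        using \<Xi>S[OF \<omega>] S by simp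
    qed
    also have "\<dots> = (\<Sum>g\<in>S. f g * prob {\<omega> \<in> space M. \<Xi> \<omega> = g})"
      using ev' by (subst Bochner_Integration.integral_sum) (auto intro!: integrable_real_indicator simp: emeasure_eq_measure)
    also have "\<dots> = (\<Sum>g\<in>S. f g * pmf (Pi_pmf A dflt P) g)"
      by (simp add: pr)
    also have "\<dots> = measure_pmf.expectation (Pi_pmf A dflt P) f"
    proof (rule integral_measure_pmf_real[OF S, symmetric])
      fix g assume "g \<in> set_pmf (Pi_pmf A dflt P)"
      then show "g \<in> S" using supp A by (auto simp: S_def set_Pi_pmf PiE_dflt_def)
    qed
    finally show ?thesis .
  qed
  show "expectation (\<lambda>\<omega>. f (\<Xi> \<omega>)) = measure_pmf.expectation (Pi_pmf A dflt P) f" by (rule main)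
  have "{\<omega> \<in> space M. Q (\<Xi> \<omega>)} = (\<Union>g\<in>{g \<in> S. Q g}. {\<omega> \<in> space M. \<Xi> \<omega> = g})"
    using \<Xi>S by auto
  also have "\<dots> \<in> events" using S ev' by (intro sets.finite_UN) auto
  finally show Qe: "{\<omega> \<in> space M. Q (\<Xi> \<omega>)} \<in> events" .
  have "prob {\<omega> \<in> space M. Q (\<Xi> \<omega>)} = expectation (indicator {\<omega> \<in> space M. Q (\<Xi> \<omega>)})"
    using Qe by simp
  also have "\<dots> = expectation (\<lambda>\<omega>. indicator {g. Q g} (\<Xi> \<omega>))"
    by (intro Bochner_Integration.integral_cong) (auto simp: indicator_def)
  also have "\<dots> = measure_pmf.prob (Pi_pmf A dflt P) {g. Q g}"
    unfolding main by simp
  finally show "prob {\<omega> \<in> space M. Q (\<Xi> \<omega>)} = measure_pmf.prob (Pi_pmf A dflt P) {g. Q g}" .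
qed


section \<open>The level structure of a spherically symmetric tree\<close>

locale sph_tree =
  fixes V :: "'v set" and E :: "'v set set" and \<rho> :: 'v
  assumes sph: "spherically_symmetric_tree V E \<rho>"
begin

lemma root_V: "\<rho> \<in> V"
  using sph by (auto simp: spherically_symmetric_tree_def)

lemma edge_V: "{x, y} \<in> E \<Longrightarrow> x \<in> V \<and> y \<in> V \<and> x \<noteq> y"
  using sph unfolding spherically_symmetric_tree_def tree_def simple_graph_def
  by (metis doubleton_eq_iff)

lemma path_ex1: "x \<in> V \<Longrightarrow> \<exists>!xs. simple_path E \<rho> xs x"
  using sph root_V unfolding spherically_symmetric_tree_def tree_def by blast

text \<open>The tree is given only by uniqueness of simple paths; level, parent and children are all
  read off the path from the root.\<close>

definition pth where "pth x = (THE xs. simple_path E \<rho> xs x)"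

lemma pth: "x \<in> V \<Longrightarrow> simple_path E \<rho> (pth x) x"
  unfolding pth_def by (rule theI') (rule path_ex1)

lemma pth_unique: "x \<in> V \<Longrightarrow> simple_path E \<rho> xs x \<Longrightarrow> pth x = xs"
  using path_ex1 pth by blast

lemma pth_root: "pth \<rho> = [\<rho>]"
  by (rule pth_unique[OF root_V]) (simp add: simple_path_def)

lemma simple_path_snoc:
  assumes "simple_path E a xs x" "{x, y} \<in> E" "y \<notin> set xs"
  shows "simple_path E a (xs @ [y]) y"
  using assms by (auto simp: simple_path_def successively_append_iff hd_append)

text \<open>If \<open>y\<close> is not on the path to \<open>x\<close>, it can be appended to that
  path. Otherwise the part of the path up to \<open>y\<close> is the path to \<open>y\<close>, it
  avoids \<open>x\<close>, and \<open>x\<close> can be appended to it.\<close>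

lemma edge_cases:
  assumes e: "{x, y} \<in> E"
  shows "pth y = pth x @ [y] \<or> pth x = pth y @ [x]"
proof (cases "y \<in> set (pth x)")
  case False
  then have "pth y = pth x @ [y]"
    using edge_V[OF e] by (intro pth_unique simple_path_snoc[OF pth e False]) auto
  then show ?thesis ..
next
  case True
  have V: "x \<in> V" "y \<in> V" "x \<noteq> y" using edge_V[OF e] by auto
  note px = pth[OF V(1)]
  obtain as bs where s: "pth x = as @ y # bs" using True by (meson split_list)
  have "bs \<noteq> []" using px V s by (auto simp: simple_path_def)
  then have xb: "x \<in> set bs" using px s by (auto simp: simple_path_def)
  have "simple_path E \<rho> (as @ [y]) y"
    using px unfolding s by (auto simp: simple_path_def successively_append_iff hd_append)
  then have py: "pth y = as @ [y]" by (rule pth_unique[OF V(2)])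
  have "x \<notin> set (pth y)" using px xb unfolding py s simple_path_def by auto
  moreover have "{y, x} \<in> E" using e by (simp add: insert_commute)
  ultimately have "pth x = pth y @ [x]"
    using V by (intro pth_unique simple_path_snoc[OF pth]) auto
  then show ?thesis ..
qed

lemma relpow_pth: "simple_path E a xs x \<Longrightarrow> (a, x) \<in> adj E ^^ (length xs - 1)"
proof -
  have "xs \<noteq> [] \<Longrightarrow> successively (\<lambda>u v. {u, v} \<in> E) xs \<Longrightarrow> (hd xs, last xs) \<in> adj E ^^ (length xs - 1)"
  proof (induction xs rule: rev_induct)
    case (snoc y xs)
    show ?case
    proof (cases "xs = []")
      case False
      then have "(hd xs, last xs) \<in> adj E ^^ (length xs - 1)" "{last xs, y} \<in> E"
        using snoc by (auto simp: successively_append_iff)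
      then have "(hd xs, y) \<in> adj E ^^ Suc (length xs - 1)" by (auto simp: adj_def)
      then show ?thesis using False by (simp add: hd_append)
    qed simp
  qed simp
  then show "simple_path E a xs x \<Longrightarrow> (a, x) \<in> adj E ^^ (length xs - 1)"
    by (auto simp: simple_path_def)
qed

text \<open>By \<open>edge_cases\<close> an edge lengthens the path from the root by at most one
  vertex; this identifies \<open>level\<close> with the length of that path.\<close>

lemma pth_length_le: "(\<rho>, x) \<in> adj E ^^ n \<Longrightarrow> x \<in> V \<and> length (pth x) \<le> Suc n"
proof (induction n arbitrary: x)
  case (Suc n)
  then obtain z where z: "(\<rho>, z) \<in> adj E ^^ n" "{z, x} \<in> E" by (auto simp: adj_def)
  then show ?case using Suc.IH[OF z(1)] edge_cases[OF z(2)] edge_V[OF z(2)] by auto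
qed (auto simp: root_V pth_root)

abbreviation lev where "lev \<equiv> level E \<rho>"
abbreviation ch where "ch \<equiv> children E \<rho>"

lemma length_pth: "x \<in> V \<Longrightarrow> length (pth x) = Suc (lev x)"
proof -
  assume x: "x \<in> V"
  have 1: "(\<rho>, x) \<in> adj E ^^ (length (pth x) - 1)" by (rule relpow_pth[OF pth[OF x]])
  have ne: "pth x \<noteq> []" using pth[OF x] by (simp add: simple_path_def)
  have "(\<rho>, x) \<in> adj E ^^ lev x" unfolding level_def by (rule LeastI[of "\<lambda>n. (\<rho>, x) \<in> adj E ^^ n", OF 1])
  then have "length (pth x) \<le> Suc (lev x)" using pth_length_le by auto
  moreover have "lev x \<le> length (pth x) - 1" unfolding level_def by (rule Least_le[of "\<lambda>n. (\<rho>, x) \<in> adj E ^^ n", OF 1])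
  ultimately show ?thesis using ne by (cases "pth x") auto
qed

lemma lev_root: "lev \<rho> = 0"
  using length_pth[OF root_V] by (simp add: pth_root)

lemma lev_0: "x \<in> V \<Longrightarrow> lev x = 0 \<Longrightarrow> x = \<rho>"
proof -
  assume x: "x \<in> V" "lev x = 0"
  then have "length (pth x) = 1" using length_pth by simp
  then obtain a where "pth x = [a]" by (auto simp: length_Suc_conv)
  then show ?thesis using pth[OF x(1)] by (auto simp: simple_path_def)
qed

definition par where "par x = last (butlast (pth x))"

lemma ch_iff: "y \<in> ch x \<longleftrightarrow> {x, y} \<in> E \<and> pth y = pth x @ [y]"
proof
  assume y: "y \<in> ch x"
  then have e: "{x, y} \<in> E" "lev y = Suc (lev x)" by (auto simp: children_def)
  then show "{x, y} \<in> E \<and> pth y = pth x @ [y]"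
    using edge_cases[OF e(1)] edge_V[OF e(1)] length_pth[of x] length_pth[of y] by auto
next
  assume y: "{x, y} \<in> E \<and> pth y = pth x @ [y]"
  then show "y \<in> ch x"
    using edge_V[of x y] length_pth[of x] length_pth[of y] by (auto simp: children_def)
qed

lemma edge_ch: "{x, y} \<in> E \<Longrightarrow> y \<in> ch x \<or> x \<in> ch y"
  using edge_cases[of x y] by (auto simp: ch_iff insert_commute)

lemma par_ch: "y \<in> ch x \<Longrightarrow> par y = x"
  using edge_V[of x y] pth[of x] by (auto simp: ch_iff par_def simple_path_def)

lemma par_parent: "y \<in> V \<Longrightarrow> y \<noteq> \<rho> \<Longrightarrow> par y \<in> V \<and> y \<in> ch (par y)"
proof -
  assume y: "y \<in> V" "y \<noteq> \<rho>"
  note py = pth[OF y(1)]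
  have "lev y \<noteq> 0" using lev_0 y by auto
  moreover have "pth y \<noteq> []" "last (pth y) = y" using py by (auto simp: simple_path_def)
  then obtain as where as: "pth y = as @ [y]" by (metis append_butlast_last_id)
  ultimately have "as \<noteq> []" using length_pth[OF y(1)] by auto
  note as = as this
  have e: "{last as, y} \<in> E"
    using py as by (auto simp: simple_path_def successively_append_iff)
  have "y \<in> ch (last as)"
  proof (rule ccontr)
    assume "y \<notin> ch (last as)"
    then have "pth (last as) = pth y @ [last as]" using edge_cases[OF e] e by (auto simp: ch_iff)
    moreover have "distinct (pth (last as))" using pth edge_V[OF e] by (auto simp: simple_path_def)
    ultimately show False using as by (auto simp: distinct_append)
  qed
  then show ?thesis using edge_V[OF e] par_ch by auto
qed

definition dg where "dg k = (if \<exists>x\<in>V. lev x = k then card (ch (SOME x. x \<in> V \<and> lev x = k)) else 1)"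

lemma card_ch: "x \<in> V \<Longrightarrow> card (ch x) = dg (lev x)"
proof -
  assume x: "x \<in> V"
  define y where "y = (SOME y. y \<in> V \<and> lev y = lev x)"
  have "y \<in> V \<and> lev y = lev x" unfolding y_def by (rule someI[of _ x]) (use x in simp)
  then have "card (ch x) = card (ch y)"
    using sph x unfolding spherically_symmetric_tree_def by metis
  then show ?thesis using x by (auto simp: dg_def y_def)
qed

sublocale level_tree V ch par lev dg
proof
  fix x assume x: "x \<in> V"
  show "ch x \<subseteq> V" using edge_V by (auto simp: children_def)
  have "finite {y. {x, y} \<in> E}" using sph x by (auto simp: spherically_symmetric_tree_def)
  then show "finite (ch x)" by (rule finite_subset[rotated]) (auto simp: children_def)
  show "card (ch x) = dg (lev x)" by (rule card_ch[OF x])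
  show "lev c = Suc (lev x)" if "c \<in> ch x" for c using that by (simp add: children_def)
  show "par c = x" if "c \<in> ch x" for c using that by (rule par_ch)
qed

text \<open>The way back from a vertex to the edge it stands for.\<close>

abbreviation uedge :: "'v \<Rightarrow> 'v set" where "uedge \<equiv> (\<lambda>v. {par v, v})"

lemma uedge_E: "v \<in> V \<Longrightarrow> v \<noteq> \<rho> \<Longrightarrow> uedge v \<in> E"
  using par_parent[of v] by (auto simp: children_def)

lemma uedge_level: "v \<in> V \<Longrightarrow> v \<noteq> \<rho> \<Longrightarrow> edge_level E \<rho> (uedge v) = lev v"
  using par_parent[of v] by (auto simp: children_def edge_level_def)

lemma uedge_inj: "inj_on uedge (V - {\<rho>})"
proof (rule inj_onI)
  fix v u assume *: "v \<in> V - {\<rho>}" "u \<in> V - {\<rho>}" "uedge v = uedge u"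
  then have "lev v = Suc (lev (par v))" "lev u = Suc (lev (par u))"
    using par_parent[of v] par_parent[of u] by (auto simp: children_def)
  then show "v = u" using *(3) by (auto simp: doubleton_eq_iff)
qed

lemma not_root_desc: "x \<in> V \<Longrightarrow> v \<in> below n x \<Longrightarrow> v \<in> V \<and> v \<noteq> \<rho>"
  using below_lev[of x v n] below_V[of x n] lev_root by auto

lemma desc_root: "desc n \<rho> = level_set V E \<rho> n"
proof
  show "desc n \<rho> \<subseteq> level_set V E \<rho> n"
    using desc_lev[OF root_V] desc_V[OF root_V] by (auto simp: level_set_def lev_root)
  have "x \<in> V \<Longrightarrow> lev x = n \<Longrightarrow> x \<in> desc n \<rho>" for x
  proof (induction n arbitrary: x)
    case (Suc n)
    then have "x \<noteq> \<rho>" using lev_root by auto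
    then have p: "par x \<in> V" "x \<in> ch (par x)" using par_parent Suc by auto
    then have "lev (par x) = n" using Suc.prems by (auto simp: children_def)
    then have "par x \<in> desc n \<rho>" using Suc.IH p by auto
    then have "x \<in> desc (n + 1) \<rho>" using p unfolding desc_add by auto
    then show ?case by simp
  qed (use lev_0 in auto)
  then show "level_set V E \<rho> n \<subseteq> desc n \<rho>" by (auto simp: level_set_def)
qed

lemma countable_V: "countable V"
proof -
  have "V \<subseteq> (\<Union>n. desc n \<rho>)" unfolding desc_root by (auto simp: level_set_def)
  moreover have "countable (\<Union>n. desc n \<rho>)"
    using desc_fin[OF root_V] by (intro countable_UN) (auto intro: countable_finite)
  ultimately show ?thesis by (rule countable_subset)
qed

lemma reach_Suc_last: "reach ob (Suc n) x = (\<Union>y\<in>reach ob n x. {c \<in> ch y. ob c})"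
  using reach_add[of ob n 1 x] by simp

lemma reach_empty_mono: "reach ob n x = {} \<Longrightarrow> n \<le> m \<Longrightarrow> reach ob m x = {}"
  using reach_add[of ob n "m - n" x] by simp

lemma reach_cluster: "x \<in> V \<Longrightarrow> y \<in> reach (\<lambda>v. uedge v \<in> F) n x \<Longrightarrow> y \<in> cluster F x"
proof (induction n arbitrary: y)
  case (Suc n)
  then obtain z where z: "z \<in> reach (\<lambda>v. uedge v \<in> F) n x" "y \<in> ch z" "uedge y \<in> F"
    unfolding reach_Suc_last by auto
  then have "(z, y) \<in> adj F" using par_ch by (auto simp: adj_def)
  then show ?case using Suc.IH[OF Suc.prems(1) z(1)] by (auto simp: cluster_def)
qed (simp add: cluster_def)

text \<open>If \<open>z\<close> has least level in its cluster, an open path from \<open>z\<close>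
  never climbs above it. A downward step extends \<open>reach\<close>, and an upward step undoes the
  last one because parents are unique.\<close>

lemma cluster_reach:
  assumes F: "F \<subseteq> E" and min: "\<And>y. y \<in> cluster F z \<Longrightarrow> lev z \<le> lev y" and y: "y \<in> cluster F z"
  shows "y \<in> reach (\<lambda>v. uedge v \<in> F) (lev y - lev z) z"
proof -
  have "(z, y) \<in> (adj F)\<^sup>*" using y by (simp add: cluster_def)
  then show ?thesis
  proof (induction rule: rtrancl_induct)
    case (step y y')
    have c: "y \<in> cluster F z" "y' \<in> cluster F z"
      using step by (auto simp: cluster_def)
    have e: "{y, y'} \<in> F" using step by (simp add: adj_def)
    then have "y' \<in> ch y \<or> y \<in> ch y'" using edge_ch F by blast
    then show ?case
    proof
      assume y': "y' \<in> ch y"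
      then have "lev y' = Suc (lev y)" "par y' = y" using par_ch by (auto simp: children_def)
      moreover have "lev z \<le> lev y" using min c by simp
      ultimately have "lev y' - lev z = Suc (lev y - lev z)" by simp
      moreover have "y' \<in> reach (\<lambda>v. uedge v \<in> F) (Suc (lev y - lev z)) z"
        unfolding reach_Suc_last using step.IH y' e \<open>par y' = y\<close> by auto
      ultimately show ?thesis by (simp only:)
    next
      assume y': "y \<in> ch y'"
      then have l: "lev y = Suc (lev y')" "par y = y'" using par_ch by (auto simp: children_def)
      have "lev z \<le> lev y'" using min c by simp
      then have "lev y - lev z = Suc (lev y' - lev z)" using l by simp
      then have "y \<in> reach (\<lambda>v. uedge v \<in> F) (Suc (lev y' - lev z)) z" using step.IH by simp
      then obtain u where "u \<in> reach (\<lambda>v. uedge v \<in> F) (lev y' - lev z) z" "y \<in> ch u"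
        unfolding reach_Suc_last by auto
      then show ?thesis using par_ch l by auto
    qed
  qed simp
qed

lemma W_perc_eq:
  "W_perc V E \<rho> n \<omega> = card (reach (\<lambda>v. uedge v \<in> {e \<in> E. \<omega> e}) n \<rho>)"
proof -
  let ?F = "{e \<in> E. \<omega> e}"
  have "{x \<in> level_set V E \<rho> n. x \<in> cluster ?F \<rho>} = reach (\<lambda>v. uedge v \<in> ?F) n \<rho>"
  proof
    show "{x \<in> level_set V E \<rho> n. x \<in> cluster ?F \<rho>} \<subseteq> reach (\<lambda>v. uedge v \<in> ?F) n \<rho>"
      using cluster_reach[of ?F \<rho>] by (auto simp: level_set_def lev_root)
    show "reach (\<lambda>v. uedge v \<in> ?F) n \<rho> \<subseteq> {x \<in> level_set V E \<rho> n. x \<in> cluster ?F \<rho>}"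
      using reach_subset_desc desc_root reach_cluster[OF root_V] by blast
  qed
  then show ?thesis by (simp add: W_perc_def)
qed

text \<open>The witness is a vertex of least level in an infinite cluster: the cluster hangs below
  it and would be finite if its open descent stopped at some depth.\<close>

lemma percolates_imp_reach:
  assumes F: "F \<subseteq> E" and perc: "percolates V F"
  shows "\<exists>z\<in>V. \<forall>N. reach (\<lambda>v. uedge v \<in> F) N z \<noteq> {}"
proof -
  obtain x where x: "x \<in> V" "infinite (cluster F x)" using perc by (auto simp: percolates_def)
  have inV: "y \<in> V" if "y \<in> cluster F x" for y
  proof -
    have "(x, y) \<in> (adj F)\<^sup>*" using that by (simp add: cluster_def)
    then show ?thesis
      by (induction rule: rtrancl_induct) (use x F edge_V in \<open>auto simp: adj_def\<close>)
  qed
  have "x \<in> cluster F x" by (simp add: cluster_def)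
  then obtain z where z: "z \<in> cluster F x" "\<And>y. y \<in> cluster F x \<Longrightarrow> lev z \<le> lev y"
    using ex_has_least_nat[of "\<lambda>y. y \<in> cluster F x" x lev] by blast
  have sym: "sym ((adj F)\<^sup>*)"
    by (rule sym_rtrancl) (auto simp: sym_def adj_def insert_commute)
  have eq: "cluster F z = cluster F x"
    using z(1) sym unfolding cluster_def sym_def by (auto intro: rtrancl_trans)
  have zV: "z \<in> V" using inV z by auto
  have "reach (\<lambda>v. uedge v \<in> F) N z \<noteq> {}" for N
  proof
    assume e: "reach (\<lambda>v. uedge v \<in> F) N z = {}"
    have "cluster F x \<subseteq> (\<Union>n\<in>{..<N}. reach (\<lambda>v. uedge v \<in> F) n z)"
    proof
      fix y assume "y \<in> cluster F x"
      then have y: "y \<in> reach (\<lambda>v. uedge v \<in> F) (lev y - lev z) z"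
        using cluster_reach[OF F, of z y] z eq by auto
      then have "lev y - lev z < N" using reach_empty_mono[OF e] by (metis empty_iff not_less)
      then show "y \<in> (\<Union>n\<in>{..<N}. reach (\<lambda>v. uedge v \<in> F) n z)" using y by auto
    qed
    moreover have "finite (\<Union>n\<in>{..<N}. reach (\<lambda>v. uedge v \<in> F) n z)"
      using reach_fin[OF zV] by auto
    ultimately show False using x(2) finite_subset by blast
  qed
  then show ?thesis using zV by blast
qed

text \<open>Once \<open>reach\<close> is empty it stays empty, so among finitely many candidates
  with arbitrarily long paths one has paths of every length.\<close>

lemma reach_imp_percolates:
  assumes "finite B" "B \<subseteq> V" "\<And>N. \<exists>M\<ge>N. \<exists>z\<in>B. reach (\<lambda>v. uedge v \<in> F) M z \<noteq> {}"
  shows "percolates V F"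
proof -
  let ?r = "reach (\<lambda>v. uedge v \<in> F)"
  have "\<exists>z\<in>B. \<forall>N. ?r N z \<noteq> {}"
  proof (rule ccontr)
    assume "\<not> (\<exists>z\<in>B. \<forall>N. ?r N z \<noteq> {})"
    then obtain f where f: "\<And>z. z \<in> B \<Longrightarrow> ?r (f z) z = {}" by metis
    obtain K where K: "\<And>z. z \<in> B \<Longrightarrow> f z \<le> K"
      using assms(1) by (metis finite_imageI finite_nat_set_iff_bounded_le imageI)
    from assms(3)[of K] obtain M z where "M \<ge> K" "z \<in> B" "?r M z \<noteq> {}" by blast
    then show False using reach_empty_mono[OF f[of z], of M] K[of z] by auto
  qed
  then obtain z where z: "z \<in> B" "\<And>N. ?r N z \<noteq> {}" by blast
  have zV: "z \<in> V" using z assms by auto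
  \<comment> \<open>One vertex per level suffices for an infinite cluster; distinct levels make the
    choice injective.\<close>
  define g where "g = (\<lambda>N. SOME y. y \<in> ?r N z)"
  have g: "g N \<in> ?r N z" for N
    unfolding g_def using z(2)[of N] by (simp add: some_in_eq)
  have lg: "lev (g N) = lev z + N" for N
    using subsetD[OF reach_subset_desc g[of N]] by (rule desc_lev[OF zV])
  have "inj g"
  proof (rule injI)
    fix i j assume ij: "g i = g j"
    have "lev z + i = lev (g i)" by (rule lg[symmetric])
    also have "\<dots> = lev (g j)" by (simp only: ij)
    also have "\<dots> = lev z + j" by (rule lg)
    finally show "i = j" by (rule add_left_imp_eq)
  qed
  then have "infinite (range g)" by (rule range_inj_infinite)
  moreover have "range g \<subseteq> cluster F z"
  proof
    fix y assume "y \<in> range g"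
    then obtain N where "y = g N" by blast
    then show "y \<in> cluster F z" using reach_cluster[OF zV g[of N]] by simp
  qed
  ultimately have "infinite (cluster F z)" using finite_subset by blast
  then show ?thesis using zV by (auto simp: percolates_def)
qed

lemma w_perc_eq:
  assumes p: "\<And>n. n \<ge> 1 \<Longrightarrow> 0 \<le> p n \<and> p n \<le> 1"
  shows "w_perc V E \<rho> p n = (\<Prod>i<n. real (dg i) * p (Suc i))"
proof -
  define A where "A = below n \<rho>"
  define law where "law = (\<lambda>k. bernoulli_pmf (p k))"
  interpret perc_tree V ch par lev dg A False law
    by unfold_locales (use below_fin[OF root_V] in \<open>auto simp: A_def law_def intro: finite_subset[of _ UNIV]\<close>)
  interpret pp: product_prob_space "\<lambda>e. measure_pmf (bernoulli_pmf (p (edge_level E \<rho> e)))" E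
    by (intro product_prob_spaceI measure_pmf.prob_space_axioms)
  interpret prob_space "static_percolation E \<rho> p"
    unfolding static_percolation_def by (rule pp.prob_space_axioms)
  let ?M = "static_percolation E \<rho> p"
  have AE: "uedge v \<in> E" "v \<noteq> \<rho>" "v \<in> V" if "v \<in> A" for v
    using that not_root_desc[OF root_V, of v n] uedge_E[of v] by (auto simp: A_def)
  define \<xi> where "\<xi> = (\<lambda>v \<omega>. \<omega> (uedge v) :: bool)"
  have rv: "\<xi> v \<in> measurable ?M (count_space UNIV)" if "v \<in> A" for v
    unfolding static_percolation_def \<xi>_def
    using measurable_component_singleton[OF AE(1)[OF that], of "\<lambda>e. measure_pmf (bernoulli_pmf (p (edge_level E \<rho> e)))"]
    by (simp cong: measurable_cong_sets)
  have inj: "inj_on uedge A" using AE by (intro inj_on_subset[OF uedge_inj]) auto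
  have ind: "prob {\<omega> \<in> space ?M. \<forall>v\<in>A. \<xi> v \<omega> = g v} = (\<Prod>v\<in>A. pmf (law (lev v)) (g v))" for g
  proof -
    \<comment> \<open>Events about vertices are rewritten as events about edges, which index the
      static product measure.\<close>
    define h where "h = (\<lambda>e. {g (the_inv_into A uedge e)})"
    have h: "h (uedge v) = {g v}" if "v \<in> A" for v
      unfolding h_def using the_inv_into_f_f[OF inj that] by simp
    have "{\<omega> \<in> space ?M. \<forall>v\<in>A. \<xi> v \<omega> = g v} = {\<omega> \<in> space ?M. \<forall>e\<in>uedge ` A. \<omega> e \<in> h e}"
      using h by (auto simp: \<xi>_def)
    also have "emeasure ?M \<dots> = (\<Prod>e\<in>uedge ` A. emeasure (measure_pmf (bernoulli_pmf (p (edge_level E \<rho> e)))) (h e))"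
      unfolding static_percolation_def by (rule pp.emeasure_PiM_Collect) (use AE finA in auto)
    also have "\<dots> = (\<Prod>v\<in>A. emeasure (measure_pmf (law (lev v))) {g v})"
      unfolding prod.reindex[OF inj] o_def
      by (rule prod.cong) (use AE h in \<open>auto simp: law_def uedge_level\<close>)
    also have "\<dots> = ennreal (\<Prod>v\<in>A. pmf (law (lev v)) (g v))"
      by (simp add: emeasure_pmf_single prod_ennreal)
    finally show ?thesis by (intro measure_eq_emeasure_eq_ennreal prod_nonneg) auto
  qed
  have pr: "pr (\<lambda>s. s) k = p k" if "k \<ge> 1" for k
  proof -
    have "{s. s} = {True}" by auto
    then show ?thesis
      by (subst pr_def) (use p[OF that] in \<open>simp add: law_def measure_pmf_single\<close>)
  qed
  have "w_perc V E \<rho> p n = expectation (\<lambda>\<omega>. real (card (rch (\<lambda>s. s) (\<lambda>v. if v \<in> A then \<xi> v \<omega> else False) n \<rho>)))"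
    unfolding w_perc_def
  proof (intro Bochner_Integration.integral_cong refl arg_cong[of _ _ real])
    fix \<omega>
    show "W_perc V E \<rho> n \<omega> = card (reach (\<lambda>v. if v \<in> A then \<xi> v \<omega> else False) n \<rho>)"
      unfolding W_perc_eq
      by (intro arg_cong[of _ _ card] reach_cong) (use AE in \<open>auto simp: A_def \<xi>_def\<close>)
  qed
  also have "\<dots> = EE (\<lambda>g. real (card (rch (\<lambda>s. s) g n \<rho>)))"
    by (rule transfer_finite_product(2)[of A UNIV, OF finA _ _ rv _ ind]) auto
  also have "\<dots> = (\<Prod>i<n. real (dg i) * pr (\<lambda>s. s) (Suc i))"
    by (subst EE_card_reach) (auto simp: root_V A_def lev_root)
  also have "\<dots> = (\<Prod>i<n. real (dg i) * p (Suc i))"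
    by (simp add: pr)
  finally show ?thesis .
qed

end


section \<open>The two-state chain\<close>

text \<open>One predicate for a time (\<open>s = t\<close>) and for a whole interval, so that a
  single renewal argument serves both.\<close>

definition open_on :: "real \<Rightarrow> bool \<Rightarrow> (nat \<Rightarrow> real) \<Rightarrow> real \<Rightarrow> real \<Rightarrow> bool" where
  "open_on p b u s t \<longleftrightarrow>
     (\<exists>k. chain_state b k \<and> jump_time p b u k \<le> s \<and> t \<le> jump_time p b u (Suc k))"

lemma open_at_eq: "open_at p b u t \<longleftrightarrow> open_on p b u t t"
  by (simp add: open_at_def open_on_def)

lemma open_on_imp_open_at: "open_on p b u s t \<Longrightarrow> s \<le> r \<Longrightarrow> r \<le> t \<Longrightarrow> open_at p b u r"
  unfolding open_on_def open_at_def by (meson order.trans)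

lemma chain_state_Suc: "chain_state b (Suc k) = chain_state (\<not> b) k"
  by (simp add: chain_state_def)

lemma jump_time_Suc_shift:
  "jump_time p b (case_nat v u) (Suc k) = v / leave_rate p b + jump_time p (\<not> b) u k"
proof -
  have "jump_time p b (case_nat v u) (Suc k) =
      v / leave_rate p (chain_state b 0) + (\<Sum>i<k. u i / leave_rate p (chain_state b (Suc i)))"
    unfolding jump_time_def by (subst sum.lessThan_Suc_shift) simp
  then show ?thesis
    by (simp only: chain_state_Suc jump_time_def) (simp add: chain_state_def)
qed

lemma jump_time_0: "jump_time p b u 0 = 0"
  by (simp add: jump_time_def)

text \<open>Renewal at the first jump: after the first holding time the chain starts afresh in the
  other state.\<close>

lemma open_on_shift:
  "open_on p b (case_nat v u) s t \<longleftrightarrow>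
     (b \<and> 0 \<le> s \<and> t \<le> v / leave_rate p b) \<or>
     open_on p (\<not> b) u (s - v / leave_rate p b) (t - v / leave_rate p b)"
proof -
  have ex: "(\<exists>k. R k) \<longleftrightarrow> R 0 \<or> (\<exists>k. R (Suc k))" for R :: "nat \<Rightarrow> bool"
    by (metis not0_implies_Suc)
  show ?thesis
    unfolding open_on_def
    apply (subst ex)
    apply (simp only: jump_time_Suc_shift chain_state_Suc jump_time_0)
    apply (simp add: chain_state_def jump_time_0 algebra_simps)
    done
qed

abbreviation exp_law :: "real measure" where
  "exp_law \<equiv> density lborel (exponential_density 1)"

abbreviation holding_law :: "(nat \<Rightarrow> real) measure" where
  "holding_law \<equiv> \<Pi>\<^sub>M k\<in>UNIV. exp_law"

interpretation exp_law: prob_space exp_law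
  by (rule prob_space_exponential_density) simp

interpretation seq: sequence_space exp_law
  by unfold_locales

lemma prob_space_holding_law: "prob_space holding_law"
  by (rule prob_space_PiM) (rule exp_law.prob_space_axioms)

lemmas holding_law_measure_UNIV = prob_space.prob_space[OF prob_space_holding_law]
lemmas holding_law_integrable =
  finite_measure.integrable_const_bound[OF prob_space.finite_measure[OF prob_space_holding_law]]
lemmas holding_law_measurable_integral =
  sigma_finite_measure.borel_measurable_lebesgue_integral[OF prob_space_imp_sigma_finite[OF prob_space_holding_law]]

lemma sets_holding_law: "sets holding_law = sets (\<Pi>\<^sub>M k\<in>UNIV. borel)"
  by (intro sets_PiM_cong) auto

lemma measurable_jump_time [measurable]:
  "(\<lambda>u. jump_time p b u k) \<in> borel_measurable (\<Pi>\<^sub>M k\<in>UNIV. borel)"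
  unfolding jump_time_def by measurable

lemma measurable_jump_time' [measurable]:
  "(\<lambda>u. jump_time p b u k) \<in> borel_measurable holding_law"
  unfolding measurable_cong_sets[OF sets_holding_law refl] by measurable

lemma measurable_open_on [measurable (raw)]:
  assumes [measurable]: "f \<in> borel_measurable N" "g \<in> borel_measurable N" "h \<in> measurable N holding_law"
  shows "Measurable.pred N (\<lambda>x. open_on p b (h x) (f x) (g x))"
  unfolding open_on_def by measurable

lemma exp_law_integral:
  fixes f :: "real \<Rightarrow> real"
  assumes [measurable]: "f \<in> borel_measurable borel"
  shows "(\<integral>v. f v \<partial>exp_law) = (\<integral>v. indicator {0..} v * exp (- v) * f v \<partial>lborel)"
proof -
  have "(\<integral>v. f v \<partial>exp_law) = (\<integral>v. exponential_density 1 v *\<^sub>R f v \<partial>lborel)"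
    by (rule integral_density) (auto simp: exponential_density_nonneg)
  also have "\<dots> = (\<integral>v. indicator {0..} v * exp (- v) * f v \<partial>lborel)"
    by (intro Bochner_Integration.integral_cong) (auto simp: exponential_density_def indicator_def)
  finally show ?thesis .
qed

lemma exp_law_integrable:
  fixes f :: "real \<Rightarrow> real"
  assumes [measurable]: "f \<in> borel_measurable borel" and B: "\<And>v. \<bar>f v\<bar> \<le> B"
  shows "integrable lborel (\<lambda>v. indicator {0..} v * exp (- v) * f v)"
proof -
  have "integrable exp_law f"
    by (rule exp_law.integrable_const_bound[of _ B]) (use B in auto)
  then have "integrable lborel (\<lambda>v. exponential_density 1 v *\<^sub>R f v)"
    by (subst (asm) integrable_density) (auto simp: exponential_density_nonneg)
  then show ?thesis
    by (rule Bochner_Integration.integrable_cong[THEN iffD1, rotated -1])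
       (auto simp: exponential_density_def indicator_def)
qed

text \<open>Splits off the first holding time; the remaining sequence has the same law as the
  whole.\<close>

lemma holding_law_integral_first:
  fixes F :: "(nat \<Rightarrow> real) \<Rightarrow> real"
  assumes [measurable]: "F \<in> borel_measurable holding_law" and B: "\<And>u. \<bar>F u\<bar> \<le> B"
  shows "(\<integral>u. F u \<partial>holding_law) = (\<integral>v. (\<integral>u. F (case_nat v u) \<partial>holding_law) \<partial>exp_law)"
proof -
  interpret pair: pair_prob_space exp_law holding_law ..
  have m: "(\<lambda>(v, u). case_nat v u) \<in> measurable (exp_law \<Otimes>\<^sub>M holding_law) holding_law"
    by measurable
  have "(\<integral>u. F u \<partial>holding_law) = (\<integral>u. F u \<partial>distr (exp_law \<Otimes>\<^sub>M holding_law) holding_law (\<lambda>(v, u). case_nat v u))"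
    by (simp add: seq.PiM_iter)
  also have "\<dots> = (\<integral>x. F (case x of (v, u) \<Rightarrow> case_nat v u) \<partial>(exp_law \<Otimes>\<^sub>M holding_law))"
    by (rule integral_distr[OF m]) simp
  also have "\<dots> = (\<integral>x. (case x of (v, u) \<Rightarrow> F (case_nat v u)) \<partial>(exp_law \<Otimes>\<^sub>M holding_law))"
    by (intro Bochner_Integration.integral_cong) auto
  also have "\<dots> = (\<integral>v. (\<integral>u. F (case_nat v u) \<partial>holding_law) \<partial>exp_law)"
  proof (rule pair.integral_fst[symmetric])
    have "(\<lambda>x. F (case x of (v, u) \<Rightarrow> case_nat v u)) \<in> borel_measurable (exp_law \<Otimes>\<^sub>M holding_law)"
      by (rule measurable_compose[OF m]) simp
    then have "(\<lambda>(v, u). F (case_nat v u)) \<in> borel_measurable (exp_law \<Otimes>\<^sub>M holding_law)"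
      by (simp add: case_prod_unfold)
    then show "integrable (exp_law \<Otimes>\<^sub>M holding_law) (\<lambda>(v, u). F (case_nat v u))"
      by (intro pair.P.integrable_const_bound[of _ B]) (use B in auto)
  qed
  finally show ?thesis .
qed

text \<open>A bounded solution of the renewal equation is determined by its values at time 0, because
  the integral operator is a contraction on each bounded time interval.\<close>

lemma renewal_unique:
  fixes G :: "bool \<Rightarrow> real \<Rightarrow> real"
  assumes r: "\<And>b. 0 < r b" "\<And>b. r b \<le> 1"
    and meas [measurable]: "\<And>b. G b \<in> borel_measurable borel" and bd: "\<And>b s. \<bar>G b s\<bar> \<le> B"
    and eq: "\<And>b s. 0 \<le> s \<Longrightarrow>
      G b s = (\<integral>v. indicator {0..} v * exp (- v) * (indicator {..<r b * s} v * G (\<not> b) (s - v / r b)) \<partial>lborel)"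
    and s: "0 \<le> s"
  shows "G b s = 0"
proof -
  define T where "T = s"
  \<comment> \<open>The supremum runs over both states because the equation exchanges them.\<close>
  define A where "A = Sup {\<bar>G b x\<bar> | b x. 0 \<le> x \<and> x \<le> T}"
  have bdd: "bdd_above {\<bar>G b x\<bar> | b x. 0 \<le> x \<and> x \<le> T}"
    using bd by (auto intro!: bdd_aboveI[of _ B])
  have A: "\<bar>G b x\<bar> \<le> A" if "0 \<le> x" "x \<le> T" for b x
    unfolding A_def by (rule cSup_upper[OF _ bdd]) (use that in auto)
  have A0: "0 \<le> A" using A[of 0] s by (smt (verit) T_def)
  have "\<bar>G b x\<bar> \<le> (1 - exp (- T)) * A" if x: "0 \<le> x" "x \<le> T" for b x
  proof -
    let ?f = "\<lambda>v. indicator {..<r b * x} v * G (\<not> b) (x - v / r b)"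
    have int_A: "integrable lborel (\<lambda>v. indicator {0..} v * exp (- v) * (indicator {..r b * x} v * A))"
      by (rule exp_law_integrable[of _ A]) (use A0 in \<open>auto simp: indicator_def\<close>)
    have "\<bar>G b x\<bar> \<le> (\<integral>v. \<bar>indicator {0..} v * exp (- v) * ?f v\<bar> \<partial>lborel)"
      unfolding eq[OF x(1), of b] by (rule integral_abs_bound)
    also have "\<dots> \<le> (\<integral>v. indicator {0..} v * exp (- v) * (indicator {..r b * x} v * A) \<partial>lborel)"
    proof (rule integral_mono[OF _ int_A])
      show "integrable lborel (\<lambda>v. \<bar>indicator {0..} v * exp (- v) * ?f v\<bar>)"
      proof (intro integrable_abs exp_law_integrable[of _ B])
        have "0 \<le> B" using bd[of True 0] by linarith
        then show "\<bar>?f v\<bar> \<le> B" for v using bd by (auto simp: indicator_def)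
      qed simp
      fix v
      show "\<bar>indicator {0..} v * exp (- v) * ?f v\<bar> \<le> indicator {0..} v * exp (- v) * (indicator {..r b * x} v * A)"
      proof (cases "0 \<le> v \<and> v < r b * x")
        case True
        have "v / r b < x" using True r(1)[of b] by (simp add: field_simps)
        moreover have "0 \<le> v / r b" using True r(1)[of b] by simp
        ultimately have "\<bar>G (\<not> b) (x - v / r b)\<bar> \<le> A" using x by (intro A) auto
        then show ?thesis using True by (simp add: abs_mult)
      next
        case False
        then show ?thesis using A0 by (auto simp: indicator_def)
      qed
    qed
    also have "\<dots> = A * (\<integral>v. indicator {0..r b * x} v *\<^sub>R exp (- v) \<partial>lborel)"
      by (subst integral_mult_right_zero[symmetric])
         (intro Bochner_Integration.integral_cong, auto simp: indicator_def)
    also have "(\<integral>v. indicator {0..r b * x} v *\<^sub>R exp (- v) \<partial>lborel) = - exp (- (r b * x)) - - exp (- 0)"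
      by (rule integral_FTC_Icc)
         (use r(1)[of b] x in \<open>auto intro!: derivative_eq_intros continuous_intros simp: has_real_derivative_iff_has_vector_derivative[symmetric]\<close>)
    also have "A * (- exp (- (r b * x)) - - exp (- 0)) \<le> A * (1 - exp (- T))"
    proof (rule mult_left_mono[OF _ A0])
      have "r b * x \<le> 1 * T" using r[of b] x by (intro mult_mono) (auto simp: less_imp_le)
      then show "- exp (- (r b * x)) - - exp (- 0) \<le> 1 - exp (- T)" by simp
    qed
    finally show ?thesis by (simp add: mult.commute)
  qed
  moreover have "\<bar>G True 0\<bar> \<in> {\<bar>G b x\<bar> | b x. 0 \<le> x \<and> x \<le> T}"
    using s unfolding T_def by blast
  ultimately have "Sup {\<bar>G b x\<bar> | b x. 0 \<le> x \<and> x \<le> T} \<le> (1 - exp (- T)) * A"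
    by (intro cSup_least) blast+
  then have "A \<le> (1 - exp (- T)) * A" by (simp only: A_def[symmetric])
  then have "exp (- T) * A \<le> 0" by (simp add: algebra_simps)
  then have "A \<le> 0" by (simp add: mult_le_0_iff)
  then show ?thesis using A[of s b] s A0 by (simp add: T_def)
qed

locale chain =
  fixes p :: real
  assumes p: "0 < p" "p < 1"
begin

abbreviation r where "r \<equiv> leave_rate p"

lemma r_bounds: "0 < r b" "r b \<le> 1" "r (\<not> b) = 1 - r b"
  using p by (auto simp: leave_rate_def)

text \<open>A finite set of intervals that have to be open, shifted by \<open>s\<close>. Three
  choices of \<open>L\<close> cover what is needed: one time, two times, one interval.\<close>

definition ev :: "(real \<times> real) set \<Rightarrow> bool \<Rightarrow> real \<Rightarrow> (nat \<Rightarrow> real) \<Rightarrow> bool" where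
  "ev L b s u \<longleftrightarrow> (\<forall>(x, y)\<in>L. open_on p b u (s + x) (s + y))"

definition H :: "(real \<times> real) set \<Rightarrow> bool \<Rightarrow> real \<Rightarrow> real" where
  "H L b s = (\<integral>u. of_bool (ev L b s u) \<partial>holding_law)"

context
  fixes L :: "(real \<times> real) set"
  assumes L: "finite L" "\<forall>x y. (x, y) \<in> L \<longrightarrow> 0 \<le> x \<and> x \<le> y"
begin

lemma measurable_ev [measurable (raw)]:
  assumes [measurable]: "f \<in> borel_measurable N" "h \<in> measurable N holding_law"
  shows "Measurable.pred N (\<lambda>x. ev L b (f x) (h x))"
proof -
  have [simp]: "countable L" using L by (simp add: countable_finite)
  show ?thesis
    unfolding ev_def case_prod_unfold by (intro pred_intros_finite L(1)) measurable
qed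

lemma measurable_H [measurable]: "H L b \<in> borel_measurable borel"
proof -
  have "(\<lambda>s. \<integral>u. (of_bool (ev L b s u) :: real) \<partial>holding_law) \<in> borel_measurable borel"
    by (rule holding_law_measurable_integral) measurable
  then show ?thesis by (simp add: H_def[abs_def])
qed

lemma H_bounds: "0 \<le> H L b s" "H L b s \<le> 1"
proof -
  show "0 \<le> H L b s" unfolding H_def by (intro integral_nonneg_AE) auto
  have "H L b s \<le> (\<integral>u. 1 \<partial>holding_law)"
    unfolding H_def by (intro integral_mono) (auto intro!: holding_law_integrable[of _ 1])
  then show "H L b s \<le> 1" by (simp add: holding_law_measure_UNIV)
qed

text \<open>Split at the first jump. If it comes before \<open>s\<close>, the chain restarts in the
  other state; if it comes later, which has probability \<open>exp (- (r b * s))\<close>, lack of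
  memory reduces the situation to the one at time 0.\<close>

lemma H_renewal:
  assumes s: "0 \<le> s"
  shows "H L b s = exp (- (r b * s)) * H L b 0 +
    (\<integral>v. indicator {0..} v * exp (- v) * (indicator {..<r b * s} v * H L (\<not> b) (s - v / r b)) \<partial>lborel)"
proof -
  define K where "K = (\<lambda>s v. \<integral>u. of_bool (ev L b s (case_nat v u)) \<partial>holding_law :: real)"
  have [measurable]: "K s \<in> borel_measurable borel" for s
    unfolding K_def by (rule holding_law_measurable_integral) measurable
  have Kb: "\<bar>K s v\<bar> \<le> 1" for s v
  proof -
    have "K s v \<le> (\<integral>u. 1 \<partial>holding_law)"
      unfolding K_def by (intro integral_mono) (auto intro!: holding_law_integrable[of _ 1])
    moreover have "0 \<le> K s v" unfolding K_def by (intro integral_nonneg_AE) auto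
    ultimately show ?thesis by (simp add: holding_law_measure_UNIV)
  qed
  have HK: "H L b s = (\<integral>v. indicator {0..} v * exp (- v) * K s v \<partial>lborel)" for s
  proof -
    have "H L b s = (\<integral>v. K s v \<partial>exp_law)"
      unfolding H_def K_def by (rule holding_law_integral_first[of _ 1]) auto
    then show ?thesis by (simp add: exp_law_integral)
  qed
  let ?r = "r b"
  have r: "0 < ?r" by (rule r_bounds)
  have early: "K s v = H L (\<not> b) (s - v / ?r)" if "v < ?r * s" for v
  proof -
    have "v / ?r < s" using that r by (simp add: field_simps)
    then have "ev L b s (case_nat v u) \<longleftrightarrow> ev L (\<not> b) (s - v / ?r) u" for u
      unfolding ev_def
    proof (intro ball_cong refl)
      fix z assume z: "z \<in> L"
      obtain x y where xy: "z = (x, y)" by (cases z)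
      have "s + x - v / ?r = s - v / ?r + x" "s + y - v / ?r = s - v / ?r + y" by simp_all
      moreover have "\<not> s + y \<le> v / ?r" using L(2)[rule_format, of x y] z xy \<open>v / ?r < s\<close> by auto
      ultimately show "(case z of (x, y) \<Rightarrow> open_on p b (case_nat v u) (s + x) (s + y)) \<longleftrightarrow>
          (case z of (x, y) \<Rightarrow> open_on p (\<not> b) u (s - v / ?r + x) (s - v / ?r + y))"
        unfolding xy prod.case open_on_shift by (simp only:) simp
    qed
    then show ?thesis by (simp add: K_def H_def)
  qed
  have late: "K s v = K 0 (v - ?r * s)" if "v \<ge> ?r * s" for v
  proof -
    have eq: "(v - ?r * s) / ?r = v / ?r - s" using r by (simp add: field_simps)
    have "ev L b s (case_nat v u) \<longleftrightarrow> ev L b 0 (case_nat (v - ?r * s) u)" for u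
      unfolding ev_def
    proof (intro ball_cong refl)
      fix z assume z: "z \<in> L"
      obtain x y where xy: "z = (x, y)" by (cases z)
      have "s + x - v / ?r = 0 + x - (v / ?r - s)" "s + y - v / ?r = 0 + y - (v / ?r - s)" by simp_all
      moreover have "(b \<and> 0 \<le> s + x \<and> s + y \<le> v / ?r) \<longleftrightarrow> (b \<and> 0 \<le> 0 + x \<and> 0 + y \<le> v / ?r - s)"
        using L(2)[rule_format, of x y] z xy s by auto
      ultimately show "(case z of (x, y) \<Rightarrow> open_on p b (case_nat v u) (s + x) (s + y)) \<longleftrightarrow>
          (case z of (x, y) \<Rightarrow> open_on p b (case_nat (v - ?r * s) u) (0 + x) (0 + y))"
        unfolding xy prod.case open_on_shift eq by (simp only:)
    qed
    then show ?thesis by (simp add: K_def)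
  qed
  let ?f = "\<lambda>v. indicator {0..} v * exp (- v) * (indicator {..<?r * s} v * H L (\<not> b) (s - v / ?r))"
  let ?g = "\<lambda>v. indicator {0..} v * exp (- v) * (indicator {?r * s..} v * K 0 (v - ?r * s))"
  have int: "integrable lborel ?f" "integrable lborel ?g"
  proof -
    have "\<bar>H L (\<not> b) x\<bar> \<le> 1" for x using H_bounds[of "\<not> b" x] by simp
    then show "integrable lborel ?f" by (intro exp_law_integrable[of _ 1]) (auto simp: indicator_def)
    show "integrable lborel ?g" using Kb by (intro exp_law_integrable[of _ 1]) (auto simp: indicator_def)
  qed
  have "H L b s = (\<integral>v. ?f v + ?g v \<partial>lborel)"
    unfolding HK
    by (intro Bochner_Integration.integral_cong refl) (auto simp: indicator_def early late)
  also have "\<dots> = (\<integral>v. ?f v \<partial>lborel) + (\<integral>v. ?g v \<partial>lborel)"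
    by (rule Bochner_Integration.integral_add[OF int])
  also have "(\<integral>v. ?g v \<partial>lborel) = (\<integral>v. ?g (?r * s + 1 * v) \<partial>lborel)"
    by (subst lborel_integral_real_affine[of 1 _ "?r * s"]) auto
  also have "\<dots> = (\<integral>v. exp (- (?r * s)) * (indicator {0..} v * exp (- v) * K 0 v) \<partial>lborel)"
  proof (intro Bochner_Integration.integral_cong refl)
    fix v
    have "exp (- (?r * s + 1 * v)) = exp (- (?r * s)) * exp (- v)"
      by (simp add: mult_exp_exp)
    moreover have "0 \<le> ?r * s" using r s by simp
    ultimately show "?g (?r * s + 1 * v) = exp (- (?r * s)) * (indicator {0..} v * exp (- v) * K 0 v)"
      by (auto simp: indicator_def)
  qed
  also have "\<dots> = exp (- (?r * s)) * H L b 0"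
    unfolding HK by simp
  finally show ?thesis by simp
qed

text \<open>The stationary average of the initial values, and each state's deviation from it. The
  deviation decays at rate 1, the sum \<open>p + (1 - p)\<close> of the two jump rates.\<close>

definition mean where "mean = p * H L True 0 + (1 - p) * H L False 0"
definition dev where "dev b = (if b then 1 - p else - p) * (H L True 0 - H L False 0)"

text \<open>The formula solves the renewal equation by explicit integration, and bounded solutions
  are unique.\<close>

lemma H_solution:
  assumes s: "0 \<le> s"
  shows "H L b s = mean + dev b * exp (- s)"
proof -
  define h where "h = (\<lambda>b s. mean + dev b * exp (- s))"
  \<comment> \<open>The formula is cut off at negative times, where \<open>exp (- s)\<close> grows,
    since \<open>renewal_unique\<close> asks for a bound on the whole line.\<close>
  define G where "G = (\<lambda>b s. H L b s - (if 0 \<le> s then h b s else 0))"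
  have h0: "h b 0 = H L b 0" for b
    by (cases b) (simp_all add: h_def mean_def dev_def algebra_simps)
  \<comment> \<open>The relation between the two deviations that makes the \<open>exp (- s)\<close>
    terms of the renewal equation agree.\<close>
  have dev: "r b * dev (\<not> b) = - ((1 - r b) * dev b)" for b
    by (cases b) (simp_all add: dev_def leave_rate_def algebra_simps)
  have h_renewal: "h b s = exp (- (r b * s)) * h b 0 +
      (\<integral>v. indicator {0..} v * exp (- v) * (indicator {..<r b * s} v * h (\<not> b) (s - v / r b)) \<partial>lborel)"
    if s: "0 \<le> s" for b s
  proof -
    let ?r = "r b"
    have r: "0 < ?r" "?r \<le> 1" by (rule r_bounds)+
    define F where "F = (\<lambda>v. - mean * exp (- v) + dev b * exp (- s) * - exp (v * (1 - ?r) / ?r))"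
    have "(\<integral>v. indicator {0..} v * exp (- v) * (indicator {..<?r * s} v * h (\<not> b) (s - v / ?r)) \<partial>lborel)
       = (\<integral>v. indicator {0..?r * s} v *\<^sub>R (exp (- v) * h (\<not> b) (s - v / ?r)) \<partial>lborel)"
    proof (rule integral_cong_AE)
      have "AE v in lborel. v \<noteq> ?r * s" by (rule AE_lborel_singleton)
      then show "AE v in lborel. indicator {0..} v * exp (- v) * (indicator {..<?r * s} v * h (\<not> b) (s - v / ?r))
          = indicator {0..?r * s} v *\<^sub>R (exp (- v) * h (\<not> b) (s - v / ?r))"
        by eventually_elim (auto simp: indicator_def)
    qed (simp_all add: h_def)
    also have "\<dots> = F (?r * s) - F 0"
    proof (rule integral_FTC_Icc)
      show "0 \<le> ?r * s" using r s by simp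
      fix v
      have "(F has_real_derivative (mean * exp (- v) - dev b * exp (- s) * (exp (v * (1 - ?r) / ?r) * ((1 - ?r) / ?r)))) (at v)"
      proof -
        have "?r \<noteq> 0" using r by linarith
        then show ?thesis unfolding F_def by (auto intro!: derivative_eq_intros)
      qed
      also have "mean * exp (- v) - dev b * exp (- s) * (exp (v * (1 - ?r) / ?r) * ((1 - ?r) / ?r)) =
          exp (- v) * h (\<not> b) (s - v / ?r)"
      proof -
        have e: "exp (- v) * exp (- (s - v / ?r)) = exp (- s) * exp (v * (1 - ?r) / ?r)"
          unfolding exp_add[symmetric] using r by (intro arg_cong[of _ _ exp]) (simp add: field_simps)
        have d: "dev (\<not> b) = - (dev b * ((1 - ?r) / ?r))"
          using dev[of b] r by (simp add: field_simps)
        have "exp (- v) * h (\<not> b) (s - v / ?r) = mean * exp (- v) + dev (\<not> b) * (exp (- v) * exp (- (s - v / ?r)))"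
          by (simp add: h_def distrib_left mult_ac)
        then show ?thesis unfolding e d by (simp add: mult_ac)
      qed
      finally show "(F has_vector_derivative exp (- v) * h (\<not> b) (s - v / ?r)) (at v within {0..?r * s})"
        by (metis has_real_derivative_iff_has_vector_derivative has_vector_derivative_at_within)
      show "continuous_on {0..?r * s} (\<lambda>v. exp (- v) * h (\<not> b) (s - v / ?r))"
        unfolding h_def using r by (auto intro!: continuous_intros)
    qed
    also have "F (?r * s) - F 0 = mean * (1 - exp (- (?r * s))) + dev b * exp (- s) * (1 - exp (s * (1 - ?r)))"
    proof -
      have "?r \<noteq> 0" using r by linarith
      then have "?r * s * (1 - ?r) / ?r = s * (1 - ?r)" by simp
      then show ?thesis unfolding F_def by (simp only:) (simp add: algebra_simps)
    qed
    also have "dev b * exp (- s) * (1 - exp (s * (1 - ?r))) = dev b * exp (- s) - dev b * exp (- (?r * s))"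
    proof -
      have "exp (- s) * exp (s * (1 - ?r)) = exp (- (?r * s))"
        unfolding exp_add[symmetric] by (simp add: algebra_simps)
      then show ?thesis by (metis mult.assoc mult.right_neutral right_diff_distrib)
    qed
    finally show ?thesis by (simp add: h_def algebra_simps)
  qed
  have hb: "\<bar>h b s\<bar> \<le> \<bar>mean\<bar> + \<bar>dev b\<bar>" if "0 \<le> s" for b s
  proof -
    have "\<bar>dev b * exp (- s)\<bar> \<le> \<bar>dev b\<bar> * 1"
      unfolding abs_mult using that by (intro mult_left_mono) auto
    then show ?thesis unfolding h_def using abs_triangle_ineq[of mean "dev b * exp (- s)"] by linarith
  qed
  define B where "B = 1 + \<bar>mean\<bar> + \<bar>dev True\<bar> + \<bar>dev False\<bar>"
  have hB: "\<bar>h b s\<bar> \<le> B - 1" if "0 \<le> s" for b s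
    using hb[OF that, of b] by (cases b) (auto simp: B_def)
  have GB: "\<bar>G b s\<bar> \<le> B" for b s
    using hB[of s b] H_bounds[of b s] by (auto simp: G_def B_def)
  have Hm: "H L b \<in> borel_measurable borel" for b by measurable
  have hm [measurable]: "h b \<in> borel_measurable borel" for b
    unfolding h_def by measurable
  have Gm: "G b \<in> borel_measurable borel" for b
    unfolding G_def by measurable
  have "G b s = 0"
  proof (rule renewal_unique[of r, OF r_bounds(1,2) Gm GB _ s])
    fix b and s :: real assume s: "0 \<le> s"
    let ?i = "\<lambda>v. indicator {0..} v * exp (- v) :: real"
    let ?H = "\<lambda>v. ?i v * (indicator {..<r b * s} v * H L (\<not> b) (s - v / r b))"
    let ?h = "\<lambda>v. ?i v * (indicator {..<r b * s} v * (if 0 \<le> s - v / r b then h (\<not> b) (s - v / r b) else 0))"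
    have int: "integrable lborel ?H" "integrable lborel ?h"
    proof -
      show "integrable lborel ?H"
      proof -
        have "\<bar>H L (\<not> b) x\<bar> \<le> 1" for x using H_bounds[of "\<not> b" x] by simp
        then show ?thesis by (intro exp_law_integrable[of _ 1]) (auto simp: indicator_def)
      qed
      have "0 \<le> B - 1" by (simp add: B_def)
      then show "integrable lborel ?h"
        using hB by (intro exp_law_integrable[of _ "B - 1"]) (auto simp: indicator_def)
    qed
    have "G b s = H L b s - h b s" using s by (simp add: G_def)
    also have "\<dots> = (\<integral>v. ?H v \<partial>lborel) -
       (\<integral>v. ?i v * (indicator {..<r b * s} v * h (\<not> b) (s - v / r b)) \<partial>lborel)"
      unfolding H_renewal[OF s] h_renewal[OF s] h0 by simp
    also have "(\<integral>v. ?i v * (indicator {..<r b * s} v * h (\<not> b) (s - v / r b)) \<partial>lborel) = (\<integral>v. ?h v \<partial>lborel)"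
    proof (intro Bochner_Integration.integral_cong refl)
      fix v
      have "0 \<le> s - v / r b" if "v < r b * s"
        using that r_bounds(1)[of b] by (simp add: pos_divide_le_eq mult.commute)
      then show "?i v * (indicator {..<r b * s} v * h (\<not> b) (s - v / r b)) = ?h v"
        by (auto simp: indicator_def)
    qed
    also have "(\<integral>v. ?H v \<partial>lborel) - (\<integral>v. ?h v \<partial>lborel) = (\<integral>v. ?H v - ?h v \<partial>lborel)"
      by (rule Bochner_Integration.integral_diff[symmetric, OF int])
    also have "\<dots> = (\<integral>v. ?i v * (indicator {..<r b * s} v * G (\<not> b) (s - v / r b)) \<partial>lborel)"
      by (intro Bochner_Integration.integral_cong refl) (simp add: G_def right_diff_distrib)
    finally show "G b s = (\<integral>v. ?i v * (indicator {..<r b * s} v * G (\<not> b) (s - v / r b)) \<partial>lborel)" .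
  qed
  then show ?thesis using s by (simp add: G_def h_def)
qed

text \<open>Under the stationary weights the two deviations cancel.\<close>

lemma H_stationary:
  assumes "0 \<le> s"
  shows "p * H L True s + (1 - p) * H L False s = p * H L True 0 + (1 - p) * H L False 0"
proof -
  have 0: "p * dev True + (1 - p) * dev False = 0" by (simp add: dev_def)
  have "p * (mean + dev True * exp (- s)) + (1 - p) * (mean + dev False * exp (- s)) =
      mean + (p * dev True + (1 - p) * dev False) * exp (- s)"
    by (simp add: algebra_simps)
  then have "p * (mean + dev True * exp (- s)) + (1 - p) * (mean + dev False * exp (- s)) = mean"
    unfolding 0 by simp
  then show ?thesis
    unfolding H_solution[OF assms] by (simp only: mean_def)
qed

end

end

lemma exp_law_gt: "0 \<le> a \<Longrightarrow> measure exp_law {v. a < v} = exp (- a)"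
  and exp_law_pos: "AE v in exp_law. 0 < v"
proof -
  have "distributed exp_law lborel (\<lambda>x. x) (exponential_density 1)"
    by (auto simp: distributed_def intro!: distr_id2)
  from exp_law.exponential_distributedD_gt[OF this, of a]
  show "0 \<le> a \<Longrightarrow> measure exp_law {v. a < v} = exp (- a)" by simp
  have "AE v in lborel. v \<noteq> (0::real)" by (rule AE_lborel_singleton)
  then show "AE v in exp_law. 0 < v"
    by (subst AE_density) (auto simp: exponential_density_def elim!: eventually_mono split: if_splits)
qed

text \<open>Positivity makes the jump times strictly increasing, and infinitely many values above 1
  drive them to infinity, as jump rates are at most 1.\<close>

lemma AE_holding_law:
  "AE u in holding_law. (\<forall>i. 0 < u i) \<and> (\<forall>n. \<exists>i\<ge>n. 1 < u i)"
proof -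
  have pos: "AE u in holding_law. \<forall>i. 0 < u i"
    unfolding AE_all_countable
    by (intro allI AE_PiM_component[of UNIV "\<lambda>_. exp_law"] exp_law_pos) (auto simp: exp_law.prob_space_axioms)
  have "AE u in holding_law. \<exists>i\<ge>n. 1 < u i" for n
  proof -
    define N where "N = {u \<in> space holding_law. \<forall>i\<ge>n. u i \<in> {..1}}"
    have N: "N \<in> sets holding_law"
      unfolding N_def by measurable
    have q: "measure exp_law {..1} = 1 - exp (- 1)"
    proof -
      have "{..1::real} = space exp_law - {v. 1 < v}" by auto
      then show ?thesis
        using exp_law.prob_compl[of "{v. 1 < v}"] exp_law_gt[of 1] by simp
    qed
    have "measure holding_law N \<le> (1 - exp (- 1)) ^ k" for k
    proof -
      have "measure holding_law N \<le> measure holding_law {u \<in> space holding_law. \<forall>i\<in>{n..<n+k}. u i \<in> {..1}}"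
        by (intro finite_measure.finite_measure_mono prob_space.finite_measure prob_space_holding_law)
          (auto simp: N_def)
      also have "\<dots> = (\<Prod>i\<in>{n..<n+k}. measure exp_law {..1})"
      proof (rule measure_eq_emeasure_eq_ennreal)
        show "emeasure holding_law {u \<in> space holding_law. \<forall>i\<in>{n..<n+k}. u i \<in> {..1}} =
            ennreal (\<Prod>i\<in>{n..<n+k}. measure exp_law {..1})"
          by (subst seq.emeasure_PiM_Collect) (auto simp: exp_law.emeasure_eq_measure prod_ennreal ennreal_power)
      qed (auto intro!: prod_nonneg)
      finally show ?thesis by (simp add: q)
    qed
    moreover have "(\<lambda>k. (1 - exp (- 1)) ^ k) \<longlonglongrightarrow> (0::real)"
      by (rule LIMSEQ_power_zero) simp
    ultimately have "measure holding_law N \<le> 0"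
      by (meson LIMSEQ_le_const)
    then have "measure holding_law N = 0" using measure_nonneg[of holding_law N] by linarith
    then have "emeasure holding_law N = 0"
      using finite_measure.emeasure_eq_measure[OF prob_space.finite_measure[OF prob_space_holding_law]] by simp
    then have "N \<in> null_sets holding_law" using N by auto
    from AE_not_in[OF this] show ?thesis
      using AE_space by eventually_elim (auto simp: N_def not_le)
  qed
  then have "AE u in holding_law. \<forall>n. \<exists>i\<ge>n. 1 < u i" unfolding AE_all_countable by blast
  with pos show ?thesis by eventually_elim auto
qed

context chain
begin

lemma jump_time_Suc: "jump_time p b u (Suc k) = jump_time p b u k + u k / leave_rate p (chain_state b k)"
  by (simp add: jump_time_def)

lemma jump_time_strict_mono:
  assumes "\<forall>i. 0 < u i" "i < j"
  shows "jump_time p b u i < jump_time p b u j"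
  using assms(2)
proof (rule less_Suc_induct)
  fix k show "jump_time p b u k < jump_time p b u (Suc k)"
    using assms(1) r_bounds(1) by (simp add: jump_time_Suc)
qed auto

lemma jump_time_mono: "\<forall>i. 0 < u i \<Longrightarrow> i \<le> j \<Longrightarrow> jump_time p b u i \<le> jump_time p b u j"
  using jump_time_strict_mono[of u i j b] by (cases "i = j") auto

lemma jump_time_unbounded:
  assumes u: "\<forall>i. 0 < u i" "\<forall>n. \<exists>i\<ge>n. 1 < u i"
  shows "\<exists>k. t < jump_time p b u k"
proof -
  have "\<exists>k. real m \<le> jump_time p b u k" for m
  proof (induction m)
    case (Suc m)
    then obtain k where k: "real m \<le> jump_time p b u k" by auto
    obtain i where i: "i \<ge> k" "1 < u i" using u by auto
    have "1 \<le> u i / leave_rate p (chain_state b i)"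
      using r_bounds[of "chain_state b i"] i by (simp add: field_simps)
    then have "real (Suc m) \<le> jump_time p b u (Suc i)"
      using k jump_time_mono[OF u(1) i(1), of b] by (simp add: jump_time_Suc)
    then show ?case by blast
  qed (auto simp: jump_time_0 intro: exI[of _ 0])
  then show ?thesis by (meson less_le_trans reals_Archimedean2)
qed

text \<open>The convention that edges are open at jump times is essential here: a closed time lies
  in the interior of its holding interval, except that the first interval may have it at time
  0.\<close>

lemma closed_times_open:
  assumes u: "\<forall>i. 0 < u i" "\<forall>n. \<exists>i\<ge>n. 1 < u i"
    and t: "0 \<le> t" "\<not> open_at p b u t"
  shows "\<exists>\<epsilon>>0. \<forall>t'\<ge>0. \<bar>t' - t\<bar> < \<epsilon> \<longrightarrow> \<not> open_at p b u t'"
proof -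
  let ?j = "jump_time p b u"
  define n where "n = (LEAST n. t < ?j n)"
  have n: "t < ?j n" unfolding n_def by (rule LeastI_ex) (rule jump_time_unbounded[OF u])
  have "n \<noteq> 0" using n t(1) by (metis jump_time_0 not_less)
  then obtain k where k: "n = Suc k" by (cases n) auto
  have tk: "?j k \<le> t" using not_less_Least[of k "\<lambda>n. t < ?j n"] by (simp add: n_def[symmetric] k)
  have closed: "\<not> chain_state b k" using t n tk unfolding open_at_def k by (meson less_imp_le)
  \<comment> \<open>At the left end of a closed interval other than the first, an open interval
    ends, so the edge counts as open there.\<close>
  have k0: "k = 0 \<or> ?j k < t"
  proof (rule ccontr)
    assume "\<not> (k = 0 \<or> ?j k < t)"
    then obtain m where m: "k = Suc m" "t = ?j k" using tk by (cases k) auto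
    have "chain_state b m" using closed by (auto simp: m(1) chain_state_def)
    moreover have "?j m \<le> t" unfolding m by (rule jump_time_mono[OF u(1)]) simp
    ultimately show False using t m unfolding open_at_def by (metis order_refl)
  qed
  define \<epsilon> where "\<epsilon> = min (?j n - t) (if k = 0 then 1 else t - ?j k)"
  have "\<epsilon> > 0" using n k0 by (auto simp: \<epsilon>_def)
  moreover have "\<not> open_at p b u t'" if t': "0 \<le> t'" "\<bar>t' - t\<bar> < \<epsilon>" for t'
  proof
    assume "open_at p b u t'"
    then obtain k' where k': "chain_state b k'" "?j k' \<le> t'" "t' \<le> ?j (Suc k')"
      by (auto simp: open_at_def)
    have upper: "t' < ?j (Suc k)" using t' by (auto simp: \<epsilon>_def k)
    consider "k' < k" | "k' = k" | "k < k'" by linarith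
    then show False
    proof cases
      case 1
      then have "?j k < t'" using t' by (auto simp: \<epsilon>_def)
      moreover have "?j (Suc k') \<le> ?j k" by (rule jump_time_mono[OF u(1)]) (use 1 in simp)
      ultimately show False using k' by linarith
    next
      case 3
      have "?j (Suc k) \<le> ?j k'" by (rule jump_time_mono[OF u(1)]) (use 3 in simp)
      then show False using k' upper by linarith
    qed (use k' closed in simp)
  qed
  ultimately show ?thesis by blast
qed

lemma open_on_start:
  assumes "\<forall>i. 0 < u i"
  shows "open_on p True u 0 0" "\<not> open_on p False u 0 t"
proof -
  show "open_on p True u 0 0"
    unfolding open_on_def
    by (intro exI[of _ 0]) (use jump_time_strict_mono[OF assms, of 0 1 True] in \<open>auto simp: jump_time_0 chain_state_def\<close>)
  show "\<not> open_on p False u 0 t"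
  proof
    assume "open_on p False u 0 t"
    then obtain k where k: "chain_state False k" "jump_time p False u k \<le> 0"
      by (auto simp: open_on_def)
    then have "k > 0" by (auto simp: chain_state_def intro: ccontr)
    from jump_time_strict_mono[OF assms this, of False] k show False by (simp add: jump_time_0)
  qed
qed

text \<open>Started closed, the chain can be open at time 0 only if its first holding time is
  0.\<close>

lemma H_False_0:
  assumes L: "finite L" "\<forall>x y. (x, y) \<in> L \<longrightarrow> 0 \<le> x \<and> x \<le> y" "(0, y) \<in> L"
  shows "H L False 0 = 0"
proof -
  note [measurable] = measurable_ev[OF L(1,2)]
  have "H L False 0 = (\<integral>u. 0 \<partial>holding_law)"
    unfolding H_def
  proof (rule integral_cong_AE)
    show "AE u in holding_law. of_bool (ev L False 0 u) = (0::real)"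
      using AE_holding_law
    proof eventually_elim
      case (elim u)
      then have "\<not> open_on p False u (0 + 0) (0 + y)" using open_on_start(2)[of u "0 + y"] by simp
      then show ?case unfolding ev_def using L(3) by auto
    qed
  qed simp_all
  then show ?thesis by simp
qed

lemma H_point: 
  assumes "0 \<le> s"
  shows "H {(0, 0)} True s = p + (1 - p) * exp (- s)" "p * H {(0, 0)} True s + (1 - p) * H {(0, 0)} False s = p"
proof -
  have L: "finite {(0::real, 0::real)}" "\<forall>x y. (x, y) \<in> {(0::real, 0::real)} \<longrightarrow> 0 \<le> x \<and> x \<le> y" by auto
  note [measurable] = measurable_ev[OF L]
  have "H {(0, 0)} True 0 = (\<integral>u. 1 \<partial>holding_law)"
    unfolding H_def
  proof (rule integral_cong_AE)
    show "AE u in holding_law. of_bool (ev {(0, 0)} True 0 u) = (1::real)"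
      using AE_holding_law
    proof eventually_elim
      case (elim u)
      then show ?case using open_on_start(1)[of u] by (simp add: ev_def)
    qed
  qed simp_all
  then have 1: "H {(0, 0)} True 0 = 1" by (simp add: holding_law_measure_UNIV)
  have 0: "H {(0, 0)} False 0 = 0" by (rule H_False_0[OF L]) auto
  show "H {(0, 0)} True s = p + (1 - p) * exp (- s)"
    unfolding H_solution[OF L assms] mean_def[OF L] dev_def[OF L] 0 1 by simp
  show "p * H {(0, 0)} True s + (1 - p) * H {(0, 0)} False s = p"
    using H_stationary[OF L assms] by (simp add: 0 1)
qed

text \<open>Stationarity moves the pair of times to the start. There the first time forces the open
  state, and the second leaves the one-time probability from \<open>H_point\<close>.\<close>

lemma H_pair:
  assumes "0 \<le> s" "0 \<le> v"
  shows "p * H {(0, 0), (v, v)} True s + (1 - p) * H {(0, 0), (v, v)} False s = p\<^sup>2 + p * (1 - p) * exp (- v)"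
proof -
  let ?L = "{(0, 0), (v, v)}"
  have L: "finite ?L" "\<forall>x y. (x, y) \<in> ?L \<longrightarrow> 0 \<le> x \<and> x \<le> y" using assms by auto
  have L0: "finite {(0::real, 0::real)}" "\<forall>x y. (x, y) \<in> {(0::real, 0::real)} \<longrightarrow> 0 \<le> x \<and> x \<le> y" by auto
  note [measurable] = measurable_ev[OF L] measurable_ev[OF L0]
  have "H ?L True 0 = H {(0, 0)} True v"
    unfolding H_def
  proof (rule integral_cong_AE)
    show "AE u in holding_law. of_bool (ev ?L True 0 u) = (of_bool (ev {(0, 0)} True v u) :: real)"
      using AE_holding_law
    proof eventually_elim
      case (elim u)
      then show ?case using open_on_start(1)[of u] by (simp add: ev_def)
    qed
  qed simp_all
  moreover have "H ?L False 0 = 0" by (rule H_False_0[OF L]) auto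
  ultimately have "p * H ?L True s + (1 - p) * H ?L False s = p * (p + (1 - p) * exp (- v))"
    using H_stationary[OF L assms(1)] H_point(1)[OF assms(2)] by simp
  then show ?thesis by (simp add: algebra_simps power2_eq_square)
qed

text \<open>After moving the interval to the start, keep only the event that a chain started open
  does not jump before \<open>v\<close>. Its probability \<open>exp (- ((1 - p) * v))\<close> is
  weakened to a bound whose exponent is free of \<open>p\<close>.\<close>

lemma H_interval:
  assumes "0 \<le> s" "0 \<le> v"
  shows "p * exp (- v) \<le> p * H {(0, v)} True s + (1 - p) * H {(0, v)} False s"
proof -
  let ?L = "{(0, v)}"
  have L: "finite ?L" "\<forall>x y. (x, y) \<in> ?L \<longrightarrow> 0 \<le> x \<and> x \<le> y" using assms by auto
  note [measurable] = measurable_ev[OF L]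
  let ?A = "{u \<in> space holding_law. u 0 \<in> {x. (1 - p) * v < x}}"
  have "(1 - p) * v \<le> 1 * v" using p assms by (intro mult_right_mono) auto
  then have "exp (- v) \<le> exp (- ((1 - p) * v))" by simp
  also have "\<dots> = measure exp_law {x. (1 - p) * v < x}" by (rule exp_law_gt[symmetric]) (use p assms in simp)
  also have "\<dots> = measure holding_law ?A"
    unfolding measure_def by (subst seq.emeasure_PiM_Collect_single) auto
  also have "\<dots> = (\<integral>u. indicator ?A u \<partial>holding_law)" by simp
  also have "\<dots> \<le> H ?L True 0"
    unfolding H_def
  proof (rule integral_mono)
    fix u
    have "open_on p True u 0 v" if "(1 - p) * v < u 0"
      unfolding open_on_def
      by (intro exI[of _ 0])
         (use that p in \<open>auto simp: jump_time_def chain_state_def leave_rate_def pos_le_divide_eq mult.commute\<close>)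
    then show "indicator ?A u \<le> (of_bool (ev ?L True 0 u) :: real)"
      by (auto simp: indicator_def ev_def)
  qed (auto intro!: holding_law_integrable[of _ 1])
  finally have "exp (- v) \<le> H ?L True 0" .
  then have "p * exp (- v) \<le> p * H ?L True 0" using p by simp
  moreover have "H ?L False 0 = 0" by (rule H_False_0[OF L]) auto
  ultimately show ?thesis using H_stationary[OF L assms(1)] by simp
qed

abbreviation edge_law :: "(bool \<times> (nat \<Rightarrow> real)) measure" where
  "edge_law \<equiv> measure_pmf (bernoulli_pmf p) \<Otimes>\<^sub>M holding_law"

lemma measure_edge_law:
  assumes [measurable]: "\<And>b. Measurable.pred holding_law (R b)"
  shows "measure edge_law {x \<in> space edge_law. R (fst x) (snd x)} =
     p * (\<integral>u. of_bool (R True u) \<partial>holding_law) + (1 - p) * (\<integral>u. of_bool (R False u) \<partial>holding_law)"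
proof -
  interpret P: prob_space edge_law
    by (intro prob_space_pair prob_space_holding_law) (rule measure_pmf.prob_space_axioms)
  have int: "(\<integral>u. of_bool (R b u) \<partial>holding_law) = measure holding_law {u \<in> space holding_law. R b u}" for b
  proof -
    have "(\<integral>u. of_bool (R b u) \<partial>holding_law) = (\<integral>u. (indicator {u \<in> space holding_law. R b u} u :: real) \<partial>holding_law)"
      by (intro Bochner_Integration.integral_cong) (auto simp: indicator_def)
    then show ?thesis by simp
  qed
  have part: "measure edge_law ({b} \<times> {u \<in> space holding_law. R b u}) =
      pmf (bernoulli_pmf p) b * measure holding_law {u \<in> space holding_law. R b u}"
    and S: "{b} \<times> {u \<in> space holding_law. R b u} \<in> sets edge_law" for b
  proof -
    have "emeasure edge_law ({b} \<times> {u \<in> space holding_law. R b u}) =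
       emeasure (measure_pmf (bernoulli_pmf p)) {b} * emeasure holding_law {u \<in> space holding_law. R b u}"
      by (rule sigma_finite_measure.emeasure_pair_measure_Times[OF prob_space_imp_sigma_finite[OF prob_space_holding_law]]) auto
    then show "measure edge_law ({b} \<times> {u \<in> space holding_law. R b u}) =
      pmf (bernoulli_pmf p) b * measure holding_law {u \<in> space holding_law. R b u}"
      by (simp add: measure_def enn2real_mult emeasure_pmf_single)
    show "{b} \<times> {u \<in> space holding_law. R b u} \<in> sets edge_law"
      by (rule pair_measureI) auto
  qed
  have "{x \<in> space edge_law. R (fst x) (snd x)} =
     {True} \<times> {u \<in> space holding_law. R True u} \<union> {False} \<times> {u \<in> space holding_law. R False u}"
    by (auto simp: space_pair_measure) (metis (full_types))+
  then have "measure edge_law {x \<in> space edge_law. R (fst x) (snd x)} =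
     measure edge_law ({True} \<times> {u \<in> space holding_law. R True u}) +
     measure edge_law ({False} \<times> {u \<in> space holding_law. R False u})"
    using S by (simp only:) (intro P.finite_measure_Union, auto)
  then show ?thesis using p by (simp add: part int)
qed

lemma edge_law_point:
  assumes "0 \<le> s"
  shows "measure edge_law {x \<in> space edge_law. open_at p (fst x) (snd x) s} = p"
proof -
  have "measure edge_law {x \<in> space edge_law. open_at p (fst x) (snd x) s} =
     p * H {(0, 0)} True s + (1 - p) * H {(0, 0)} False s"
    unfolding open_at_eq by (subst measure_edge_law) (auto simp: H_def ev_def)
  then show ?thesis using H_point(2)[OF assms] by simp
qed

lemma edge_law_pair:
  assumes "0 \<le> s" "0 \<le> t"
  shows "measure edge_law {x \<in> space edge_law. open_at p (fst x) (snd x) s \<and> open_at p (fst x) (snd x) t} =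
     p\<^sup>2 + p * (1 - p) * exp (- \<bar>s - t\<bar>)"
proof -
  have *: "measure edge_law {x \<in> space edge_law. open_at p (fst x) (snd x) s \<and> open_at p (fst x) (snd x) t} =
     p\<^sup>2 + p * (1 - p) * exp (- (t - s))" if "0 \<le> s" "s \<le> t" for s t
  proof -
    have "measure edge_law {x \<in> space edge_law. open_at p (fst x) (snd x) s \<and> open_at p (fst x) (snd x) t} =
       p * H {(0, 0), (t - s, t - s)} True s + (1 - p) * H {(0, 0), (t - s, t - s)} False s"
      unfolding open_at_eq by (subst measure_edge_law) (auto simp: H_def ev_def)
    also have "\<dots> = p\<^sup>2 + p * (1 - p) * exp (- (t - s))"
      by (rule H_pair) (use that in auto)
    finally show ?thesis .
  qed
  show ?thesis
  proof (cases "s \<le> t")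
    case True
    then show ?thesis using *[of s t] assms by simp
  next
    case False
    then show ?thesis using *[of t s] assms by (simp add: conj_commute)
  qed
qed

lemma edge_law_interval:
  assumes "0 \<le> s" "s \<le> t"
  shows "p * exp (- (t - s)) \<le> measure edge_law {x \<in> space edge_law. open_on p (fst x) (snd x) s t}"
proof -
  have "measure edge_law {x \<in> space edge_law. open_on p (fst x) (snd x) s t} =
     p * H {(0, t - s)} True s + (1 - p) * H {(0, t - s)} False s"
    by (subst measure_edge_law) (auto simp: H_def ev_def)
  then show ?thesis using H_interval[of s "t - s"] assms by simp
qed

end


section \<open>Dynamical percolation on the tree\<close>

abbreviation state_space :: "(bool \<times> (nat \<Rightarrow> real)) measure" where
  "state_space \<equiv> count_space UNIV \<Otimes>\<^sub>M (\<Pi>\<^sub>M k\<in>UNIV. borel)"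

lemma space_state_space [simp]: "space state_space = UNIV"
  by (auto simp: space_pair_measure space_PiM PiE_def)

lemma pred_on_states:
  assumes "\<And>b. Measurable.pred holding_law (R b)"
  shows "Measurable.pred state_space (\<lambda>x. R (fst x) (snd x))"
proof -
  have R: "Measurable.pred (\<Pi>\<^sub>M k\<in>UNIV. borel) (R b)" for b
    using assms by (simp cong: measurable_cong_sets add: sets_holding_law)
  have [measurable]: "Measurable.pred state_space (\<lambda>x. R b (snd x))" for b
    by (rule measurable_compose[OF measurable_snd R])
  have "(\<lambda>x. R (fst x) (snd x)) = (\<lambda>x. (fst x \<and> R True (snd x)) \<or> (\<not> fst x \<and> R False (snd x)))"
    by (auto simp: fun_eq_iff) (metis (full_types))+
  moreover have "Measurable.pred state_space (\<lambda>x. (fst x \<and> R True (snd x)) \<or> (\<not> fst x \<and> R False (snd x)))"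
    by measurable
  ultimately show ?thesis by simp
qed

lemma pred_open_on: "Measurable.pred state_space (\<lambda>x. open_on q (fst x) (snd x) s t)"
  by (rule pred_on_states) measurable

lemma pred_open_at: "Measurable.pred state_space (\<lambda>x. open_at q (fst x) (snd x) s)"
  unfolding open_at_eq by (rule pred_open_on)

text \<open>Only the random data, initial states and holding times, are kept; the given process
  comes back at the end through an almost sure identity.\<close>

locale dyn_perc = sph_tree V E \<rho> + prob_space M
  for V :: "'v set" and E and \<rho> and M :: "'w measure" +
  fixes p :: "nat \<Rightarrow> real" and B :: "'v set \<Rightarrow> 'w \<Rightarrow> bool" and U :: "'v set \<Rightarrow> 'w \<Rightarrow> nat \<Rightarrow> real"
  assumes p01: "0 < p k" "p k < 1"
    and dg_pos: "dg k \<ge> 1"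
    and indep: "indep_vars (\<lambda>_. state_space) (\<lambda>e \<omega>. (B e \<omega>, U e \<omega>)) E"
    and edge_distr: "e \<in> E \<Longrightarrow> distr M state_space (\<lambda>\<omega>. (B e \<omega>, U e \<omega>)) =
       measure_pmf (bernoulli_pmf (p (edge_level E \<rho> e))) \<Otimes>\<^sub>M holding_law"
begin

definition w where "w n = (\<Prod>i<n. real (dg i) * p (Suc i))"

sublocale weights dg p w
  by unfold_locales (use dg_pos p01 in \<open>auto simp: w_def less_imp_le\<close>)

definition edge_law where "edge_law k = measure_pmf (bernoulli_pmf (p k)) \<Otimes>\<^sub>M holding_law"

lemma chain: "chain (p k)"
  by unfold_locales (use p01 in auto)

lemma sets_edge_law: "sets (edge_law k) = sets state_space"
  unfolding edge_law_def by (intro sets_pair_measure_cong sets_holding_law) auto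

lemma space_edge_law [simp]: "space (edge_law k) = UNIV"
  using sets_eq_imp_space_eq[OF sets_edge_law] by simp

lemma prob_space_edge_law: "prob_space (edge_law k)"
  unfolding edge_law_def
  by (intro prob_space_pair prob_space_holding_law) (rule measure_pmf.prob_space_axioms)

definition st where "st v \<omega> = (B (uedge v) \<omega>, U (uedge v) \<omega>)"

lemma st_measurable: "v \<in> V - {\<rho>} \<Longrightarrow> st v \<in> measurable M state_space"
  using indep uedge_E[of v] by (auto simp: indep_vars_def st_def[abs_def])

lemma st_prob:
  assumes v: "v \<in> V - {\<rho>}" and R: "Measurable.pred state_space R"
  shows "{\<omega> \<in> space M. R (st v \<omega>)} \<in> events" "prob {\<omega> \<in> space M. R (st v \<omega>)} = measure (edge_law (lev v)) {x. R x}"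
proof -
  have R': "{x. R x} \<in> sets state_space"
    using R unfolding pred_def by simp
  have eq: "{\<omega> \<in> space M. R (st v \<omega>)} = st v -` {x. R x} \<inter> space M" by auto
  show "{\<omega> \<in> space M. R (st v \<omega>)} \<in> events"
    unfolding eq by (rule measurable_sets[OF st_measurable[OF v] R'])
  have "measure (distr M state_space (st v)) {x. R x} = prob {\<omega> \<in> space M. R (st v \<omega>)}"
    unfolding eq by (rule measure_distr[OF st_measurable[OF v] R'])
  moreover have "distr M state_space (st v) = edge_law (lev v)"
    using edge_distr[OF uedge_E, of v] v uedge_level[of v] by (simp add: st_def[abs_def] edge_law_def)
  ultimately show "prob {\<omega> \<in> space M. R (st v \<omega>)} = measure (edge_law (lev v)) {x. R x}" by simp
qed

text \<open>Observing finitely many features of an edge turns its law into a finite distribution.\<close>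

definition obs_law :: "(nat \<Rightarrow> bool \<times> (nat \<Rightarrow> real) \<Rightarrow> 'b) \<Rightarrow> nat \<Rightarrow> 'b pmf" where
  "obs_law F k = embed_pmf (\<lambda>s. measure (edge_law k) {x. F k x = s})"

context
  fixes F :: "nat \<Rightarrow> bool \<times> (nat \<Rightarrow> real) \<Rightarrow> 'b" and R :: "'b set" and dflt :: 'b
  assumes R: "finite R" "\<And>k x. F k x \<in> R"
    and F: "\<And>k s. Measurable.pred state_space (\<lambda>x. F k x = s)"
begin

lemma F_sets: "{x. F k x = s} \<in> sets (edge_law k)"
  using F unfolding pred_def sets_edge_law by simp

lemma measure_obs: "S \<subseteq> R \<Longrightarrow> (\<Sum>s\<in>S. measure (edge_law k) {x. F k x = s}) = measure (edge_law k) {x. F k x \<in> S}"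
proof -
  assume S: "S \<subseteq> R"
  interpret el: prob_space "edge_law k" by (rule prob_space_edge_law)
  have "{x. F k x \<in> S} = (\<Union>s\<in>S. {x. F k x = s})" by auto
  also have "measure (edge_law k) \<dots> = (\<Sum>s\<in>S. measure (edge_law k) {x. F k x = s})"
    by (rule el.finite_measure_finite_Union)
       (use S R F_sets in \<open>auto simp: disjoint_family_on_def intro: finite_subset\<close>)
  finally show ?thesis by simp
qed

lemma pmf_obs_law: "pmf (obs_law F k) s = measure (edge_law k) {x. F k x = s}"
  unfolding obs_law_def
proof (rule pmf_embed_pmf)
  interpret el: prob_space "edge_law k" by (rule prob_space_edge_law)
  have z: "measure (edge_law k) {x. F k x = s} = 0" if "s \<notin> R" for s
  proof -
    have "{x. F k x = s} = {}" using R that by blast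
    then show ?thesis by (simp only: measure_empty)
  qed
  have "(\<integral>\<^sup>+s. ennreal (measure (edge_law k) {x. F k x = s}) \<partial>count_space UNIV) =
      (\<Sum>s\<in>R. ennreal (measure (edge_law k) {x. F k x = s}))"
    by (intro nn_integral_count_space') (use R z in auto)
  also have "\<dots> = ennreal (\<Sum>s\<in>R. measure (edge_law k) {x. F k x = s})" by (simp add: sum_ennreal)
  also have "(\<Sum>s\<in>R. measure (edge_law k) {x. F k x = s}) = 1"
    using measure_obs[of R k] R(2) el.prob_space by simp
  finally show "(\<integral>\<^sup>+s. ennreal (measure (edge_law k) {x. F k x = s}) \<partial>count_space UNIV) = 1" by simp
qed simp

lemma set_obs_law: "set_pmf (obs_law F k) \<subseteq> R"
proof
  fix s assume "s \<in> set_pmf (obs_law F k)"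
  then have "measure (edge_law k) {x. F k x = s} \<noteq> 0" by (simp add: set_pmf_iff pmf_obs_law)
  then have "{x. F k x = s} \<noteq> {}" by (metis measure_empty)
  then show "s \<in> R" using R by blast
qed

lemma prob_obs_law: "measure_pmf.prob (obs_law F k) {s. Ob s} = measure (edge_law k) {x. Ob (F k x)}"
proof -
  have "measure_pmf.prob (obs_law F k) {s. Ob s} = measure_pmf.prob (obs_law F k) {s \<in> R. Ob s}"
    by (rule measure_prob_cong_0) (use set_obs_law in \<open>auto simp: set_pmf_eq\<close>)
  also have "\<dots> = (\<Sum>s\<in>{s \<in> R. Ob s}. measure (edge_law k) {x. F k x = s})"
    using R by (subst measure_measure_pmf_finite) (auto simp: pmf_obs_law)
  also have "\<dots> = measure (edge_law k) {x. F k x \<in> {s \<in> R. Ob s}}"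
    by (rule measure_obs) auto
  also have "{x. F k x \<in> {s \<in> R. Ob s}} = {x. Ob (F k x)}" using R by auto
  finally show ?thesis .
qed

lemma observe:
  assumes A: "finite A" "A \<subseteq> V - {\<rho>}"
  defines "\<Xi> \<equiv> \<lambda>\<omega> v. if v \<in> A then F (lev v) (st v \<omega>) else dflt"
  shows "{\<omega> \<in> space M. Qr (\<Xi> \<omega>)} \<in> events"
    and "prob {\<omega> \<in> space M. Qr (\<Xi> \<omega>)} = measure_pmf.prob (Pi_pmf A dflt (\<lambda>v. obs_law F (lev v))) {g. Qr g}"
proof -
  have rv: "(\<lambda>\<omega>. F (lev v) (st v \<omega>)) \<in> measurable M (count_space R)" if "v \<in> A" for v
    unfolding measurable_count_space_eq2[OF R(1)]
  proof (intro conjI ballI funcsetI)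
    fix s
    have "(\<lambda>\<omega>. F (lev v) (st v \<omega>)) -` {s} \<inter> space M = {\<omega> \<in> space M. F (lev v) (st v \<omega>) = s}" by auto
    then show "(\<lambda>\<omega>. F (lev v) (st v \<omega>)) -` {s} \<inter> space M \<in> events"
      using st_prob(1)[OF _ F, of v "lev v" s] A that by auto
  qed (use R in auto)
  have rv': "(\<lambda>\<omega>. F (lev v) (st v \<omega>)) \<in> measurable M (count_space UNIV)" if "v \<in> A" for v
    using measurable_compose[OF rv[OF that], of "\<lambda>s. s" "count_space UNIV"] by simp
  have inj: "inj_on uedge A" using A by (intro inj_on_subset[OF uedge_inj]) auto
  have ind: "prob {\<omega> \<in> space M. \<forall>v\<in>A. F (lev v) (st v \<omega>) = g v} = (\<Prod>v\<in>A. pmf (obs_law F (lev v)) (g v))" for g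
  proof (cases "A = {}")
    case True
    then show ?thesis by (simp add: prob_space)
  next
    case False
    define h where "h = (\<lambda>e. let v = the_inv_into A uedge e in {x. F (lev v) x = g v})"
    have h: "h (uedge v) = {x. F (lev v) x = g v}" if "v \<in> A" for v
      unfolding h_def using the_inv_into_f_f[OF inj that] by (simp only: Let_def)
    have "{\<omega> \<in> space M. \<forall>v\<in>A. F (lev v) (st v \<omega>) = g v} =
        (\<Inter>e\<in>uedge ` A. (\<lambda>\<omega>. (B e \<omega>, U e \<omega>)) -` h e \<inter> space M)"
      using False h by (auto simp: st_def)
    also have "prob \<dots> = (\<Prod>e\<in>uedge ` A. prob ((\<lambda>\<omega>. (B e \<omega>, U e \<omega>)) -` h e \<inter> space M))"
    proof (rule indep_varsD[OF indep])
      show "uedge ` A \<subseteq> E" using A uedge_E by auto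
      show "h e \<in> sets state_space" if "e \<in> uedge ` A" for e
        using that h F_sets by (auto simp: sets_edge_law)
    qed (use False A in auto)
    also have "\<dots> = (\<Prod>v\<in>A. prob ((\<lambda>\<omega>. (B (uedge v) \<omega>, U (uedge v) \<omega>)) -` h (uedge v) \<inter> space M))"
      by (simp add: prod.reindex[OF inj])
    also have "\<dots> = (\<Prod>v\<in>A. pmf (obs_law F (lev v)) (g v))"
    proof (rule prod.cong[OF refl])
      fix v assume v: "v \<in> A"
      have "(\<lambda>\<omega>. (B (uedge v) \<omega>, U (uedge v) \<omega>)) -` h (uedge v) \<inter> space M =
          {\<omega> \<in> space M. F (lev v) (st v \<omega>) = g v}"
        unfolding h[OF v] by (auto simp: st_def)
      then show "prob ((\<lambda>\<omega>. (B (uedge v) \<omega>, U (uedge v) \<omega>)) -` h (uedge v) \<inter> space M) =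
          pmf (obs_law F (lev v)) (g v)"
        using st_prob(2)[OF _ F, of v "lev v" "g v"] A v by (auto simp: pmf_obs_law)
    qed
    finally show ?thesis .
  qed
  show "{\<omega> \<in> space M. Qr (\<Xi> \<omega>)} \<in> events"
    unfolding \<Xi>_def
    by (rule transfer_finite_product(3)[OF A(1) R(1) R(2) rv' set_obs_law ind])
  show "prob {\<omega> \<in> space M. Qr (\<Xi> \<omega>)} = measure_pmf.prob (Pi_pmf A dflt (\<lambda>v. obs_law F (lev v))) {g. Qr g}"
    unfolding \<Xi>_def
    by (rule transfer_finite_product(4)[OF A(1) R(1) R(2) rv' set_obs_law ind])
qed

end

definition is_open :: "real \<Rightarrow> 'w \<Rightarrow> 'v \<Rightarrow> bool" where
  "is_open t \<omega> v \<longleftrightarrow> open_at (p (lev v)) (fst (st v \<omega>)) (snd (st v \<omega>)) t"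

lemma below_not_root: "x \<in> V \<Longrightarrow> below n x \<subseteq> V - {\<rho>}"
  using not_root_desc by blast

subsection \<open>Downward deviations over one scale\<close>

context
  fixes n0 :: nat and l u :: "nat \<Rightarrow> real"
  assumes lu: "\<And>k. 0 \<le> l k \<and> l k \<le> u k"
begin

text \<open>Counting all edges down to level \<open>n0\<close> as held makes the number of vertices
  there deterministic, hence at least \<open>w n0\<close>. The price is that the open path is found
  only below level \<open>n0\<close>.\<close>

definition held :: "'w \<Rightarrow> 'v \<Rightarrow> bool" where
  "held \<omega> v \<longleftrightarrow> lev v \<le> n0 \<or> open_on (p (lev v)) (fst (st v \<omega>)) (snd (st v \<omega>)) (l (lev v)) (u (lev v))"

text \<open>\<open>step_prob\<close> for the percolation of held edges. Below, \<open>w'\<close> is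
  its mean; the tilt \<open>h\<close> balances the deviation \<open>\<kappa>\<close> against the
  second order error, whose size is governed by \<open>\<sigma>\<close>.\<close>

lemma held_step:
  assumes n: "n0 \<le> n" "n \<le> N" and \<delta>: "0 \<le> \<delta>" "\<delta> * real N \<le> 1"
    and len: "\<And>k. n < k \<Longrightarrow> k \<le> N \<Longrightarrow> u k - l k \<le> \<delta>"
    and \<sigma>: "0 < \<sigma>" "(\<Sum>i=n..N. 1 / w i) \<le> \<sigma>"
    and \<kappa>: "0 < \<kappa>" "\<kappa> \<le> 1" and y: "y \<le> 1" "0 \<le> y'" "y' * exp (\<delta> * real N) \<le> y - \<kappa>"
  shows "{\<omega> \<in> space M. y * w n \<le> real (card (reach (held \<omega>) n \<rho>)) \<and>
           real (card (reach (held \<omega>) N \<rho>)) < y' * w N} \<in> events"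
    and "prob {\<omega> \<in> space M. y * w n \<le> real (card (reach (held \<omega>) n \<rho>)) \<and>
           real (card (reach (held \<omega>) N \<rho>)) < y' * w N} \<le> exp (- (\<kappa>\<^sup>2 / (6 * \<sigma>)))"
proof -
  define F where "F = (\<lambda>k x. k \<le> n0 \<or> open_on (p k) (fst x) (snd x) (l k) (u k))"
  have F: "Measurable.pred state_space (\<lambda>x. F k x = s)" for k s
  proof -
    note [measurable] = pred_open_on[of "p k" "l k" "u k"]
    show ?thesis unfolding F_def by measurable
  qed
  define A where "A = below N \<rho>"
  have A: "finite A" "A \<subseteq> V - {\<rho>}"
    unfolding A_def using below_fin[OF root_V] below_not_root[OF root_V] by auto
  define law where "law = obs_law F"
  interpret P: perc_tree V ch par lev dg A False law
    by unfold_locales (use A in \<open>auto intro: finite_subset[of _ UNIV]\<close>)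
  have UF: "finite (UNIV :: bool set)" "\<And>k x. F k x \<in> UNIV" by auto
  define q where "q = P.pr (\<lambda>s. s)"
  have q: "q k = measure (edge_law k) {x. F k x}" for k
    unfolding q_def P.pr_def unfolding law_def by (rule prob_obs_law[OF UF F])
  have q_ge: "p k * exp (- (u k - l k)) \<le> q k" for k
  proof -
    interpret el: prob_space "edge_law k" by (rule prob_space_edge_law)
    have "p k * exp (- (u k - l k)) \<le> measure (edge_law k) {x. open_on (p k) (fst x) (snd x) (l k) (u k)}"
      using chain.edge_law_interval[OF chain, of "l k" "u k" k] lu[of k]
      unfolding edge_law_def[symmetric] by simp
    also have "\<dots> \<le> measure (edge_law k) {x. F k x}"
    proof (rule el.finite_measure_mono)
      show "{x. F k x} \<in> sets (edge_law k)"
        using F[of k True] unfolding pred_def sets_edge_law by simp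
    qed (auto simp: F_def)
    finally show ?thesis by (simp add: q)
  qed
  have q_pos: "0 < q k" for k
    using q_ge[of k] p01[of k] by (smt (verit) exp_gt_zero mult_pos_pos)
  define w' where "w' = (\<lambda>n. \<Prod>i<n. real (dg i) * q (Suc i))"
  interpret W: weights dg q w'
    by unfold_locales (use dg_pos q_pos P.pr_bounds(2) in \<open>auto simp: w'_def q_def\<close>)
  have ratio: "exp (- (\<delta> * real j)) * (w (n + j) / w n) \<le> w' (n + j) / w' n" if "n + j \<le> N" for j
    using that
  proof (induction j)
    case (Suc j)
    have "exp (- (\<delta> * real (Suc j))) * (w (n + Suc j) / w n) =
       (exp (- (\<delta> * real j)) * (w (n + j) / w n)) * (real (dg (n + j)) * (p (Suc (n + j)) * exp (- \<delta>)))"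
      by (simp add: w_Suc algebra_simps exp_add[symmetric] exp_diff exp_minus divide_inverse)
    also have "\<dots> \<le> (w' (n + j) / w' n) * (real (dg (n + j)) * q (Suc (n + j)))"
    proof (rule mult_mono)
      have "p (Suc (n + j)) * exp (- \<delta>) \<le> p (Suc (n + j)) * exp (- (u (Suc (n + j)) - l (Suc (n + j))))"
        using len[of "Suc (n + j)"] Suc.prems p01[of "Suc (n + j)"] by (intro mult_left_mono) auto
      then have "p (Suc (n + j)) * exp (- \<delta>) \<le> q (Suc (n + j))" using q_ge[of "Suc (n + j)"] by linarith
      then show "real (dg (n + j)) * (p (Suc (n + j)) * exp (- \<delta>)) \<le> real (dg (n + j)) * q (Suc (n + j))"
        by (rule mult_left_mono) simp
      show "0 \<le> w' (n + j) / w' n" using W.w_pos[of n] W.w_pos[of "n + j"] by simp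
      show "exp (- (\<delta> * real j)) * (w (n + j) / w n) \<le> w' (n + j) / w' n" using Suc by simp
      show "0 \<le> real (dg (n + j)) * (p (Suc (n + j)) * exp (- \<delta>))" using p01(1)[of "Suc (n + j)"] by simp
    qed
    also have "\<dots> = w' (n + Suc j) / w' n" by (simp add: W.w_Suc)
    finally show ?case .
  qed (use w_pos[of n] W.w_pos[of n] in simp)
  \<comment> \<open>All windows together cost at most
    \<open>exp (\<delta> * N) \<le> exp 1 \<le> 3\<close>, so inverse weights of the held process
    are comparable to those of \<open>w\<close>.\<close>
  have ratio': "w' n / w' i \<le> 3 * (w n / w i)" if "n \<le> i" "i \<le> N" for i
  proof -
    have "\<delta> * real (i - n) \<le> \<delta> * real N" using that \<delta> by (intro mult_left_mono) auto
    then have "exp (\<delta> * real (i - n)) \<le> exp 1" using \<delta> by simp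
    also have "\<dots> \<le> 3" by (rule exp_le)
    finally have e3: "exp (\<delta> * real (i - n)) \<le> 3" .
    have "exp (- (\<delta> * real (i - n))) * (w i / w n) \<le> w' i / w' n"
      using ratio[of "i - n"] that by simp
    then have "w' n / w' i \<le> exp (\<delta> * real (i - n)) * (w n / w i)"
      using W.w_pos[of n] W.w_pos[of i] w_pos[of n] w_pos[of i]
      by (simp add: field_simps exp_minus)
    also have "\<dots> \<le> 3 * (w n / w i)"
      by (rule mult_right_mono[OF e3]) (use w_pos[of n] w_pos[of i] in simp)
    finally show ?thesis .
  qed
  define \<mu> where "\<mu> = w' N / w' n"
  have \<mu>: "0 < \<mu>" using W.w_pos by (simp add: \<mu>_def)
  \<comment> \<open>Chosen such that the second order error,
    \<open>3 / 2 * lam\<^sup>2 * w n * \<sigma>\<close>, equals \<open>lam * \<kappa> / 2\<close>,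
    half of what the deviation gains.\<close>
  define t where "t = \<kappa> / (3 * \<sigma>)"
  define lam where "lam = t / w n"
  define h where "h = lam / \<mu>"
  have t: "0 < t" using \<kappa> \<sigma> by (simp add: t_def)
  have lam: "0 < lam" using t w_pos by (simp add: lam_def)
  have h: "0 < h" using lam \<mu> by (simp add: h_def)
  have h\<mu>: "h * w' N / w' n = lam" using W.w_pos[of N] W.w_pos[of n] by (simp add: h_def \<mu>_def)
  define La where "La = lap dg q (exp (- h)) (N - n) n"
  have nN: "n + (N - n) = N" using n by simp
  have "lam - (1 - La) \<le> h\<^sup>2 * (w' N)\<^sup>2 / (2 * w' n) * (\<Sum>i=n..N. 1 / w' i)"
    using W.lap_exp_estimate[of h "N - n" n] h unfolding nN La_def h\<mu> by simp
  also have "\<dots> = lam\<^sup>2 / 2 * (\<Sum>i=n..N. w' n / w' i)"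
  proof -
    have "h\<^sup>2 * (w' N)\<^sup>2 / (2 * w' n) = (h * w' N / w' n)\<^sup>2 / 2 * w' n"
      using W.w_pos[of n] by (simp add: power2_eq_square field_simps)
    then have "h\<^sup>2 * (w' N)\<^sup>2 / (2 * w' n) * (\<Sum>i=n..N. 1 / w' i) = lam\<^sup>2 / 2 * (w' n * (\<Sum>i=n..N. 1 / w' i))"
      unfolding h\<mu> by (simp only: mult.assoc)
    also have "w' n * (\<Sum>i=n..N. 1 / w' i) = (\<Sum>i=n..N. w' n / w' i)"
      by (simp add: sum_distrib_left)
    finally show ?thesis .
  qed
  also have "\<dots> \<le> lam\<^sup>2 / 2 * (\<Sum>i=n..N. 3 * (w n / w i))"
    by (intro mult_left_mono sum_mono ratio') auto
  also have "(\<Sum>i=n..N. 3 * (w n / w i)) = 3 * w n * (\<Sum>i=n..N. 1 / w i)"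
    by (simp add: sum_distrib_left)
  also have "lam\<^sup>2 / 2 * (3 * w n * (\<Sum>i=n..N. 1 / w i)) \<le> lam\<^sup>2 / 2 * (3 * w n * \<sigma>)"
    by (intro mult_left_mono \<sigma>) (use w_pos[of n] in auto)
  also have "\<dots> = lam * (\<kappa> / 2)"
    using w_pos[of n] \<sigma> by (simp add: lam_def t_def power2_eq_square field_simps)
  finally have "La \<le> 1 + - (lam * (1 - \<kappa> / 2))" by (simp add: algebra_simps)
  also have "\<dots> \<le> exp (- (lam * (1 - \<kappa> / 2)))" by (rule exp_ge_add_one_self)
  finally have La: "La \<le> exp (- (lam * (1 - \<kappa> / 2)))" .
  have La0: "0 \<le> La" using W.lap_bounds[of "exp (- h)" "N - n" n] h by (simp add: La_def)
  define a where "a = nat \<lceil>y * w n\<rceil>"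
  have a: "y * w n \<le> real a" unfolding a_def by linarith
  have "La ^ a \<le> exp (- (lam * (1 - \<kappa> / 2))) ^ a" by (rule power_mono[OF La La0])
  also have "\<dots> = exp (- (lam * (1 - \<kappa> / 2) * real a))"
    by (simp add: exp_of_nat_mult[symmetric] mult_ac)
  also have "\<dots> \<le> exp (- (lam * (1 - \<kappa> / 2) * (y * w n)))"
    using mult_left_mono[OF a, of "lam * (1 - \<kappa> / 2)"] lam \<kappa> by simp
  finally have Laa: "La ^ a \<le> exp (- (lam * (1 - \<kappa> / 2) * (y * w n)))" .
  have ha: "h * (y' * w N) \<le> lam * w n * (y - \<kappa>)"
  proof -
    have "exp (- (\<delta> * real (N - n))) * (w N / w n) \<le> \<mu>"
      using ratio[of "N - n"] n by (simp add: \<mu>_def)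
    moreover have "exp (- (\<delta> * real N)) \<le> exp (- (\<delta> * real (N - n)))"
      using \<delta> by (simp add: mult_left_mono)
    ultimately have "exp (- (\<delta> * real N)) * (w N / w n) \<le> \<mu>"
      using w_pos[of N] w_pos[of n] by (smt (verit) divide_pos_pos mult_right_mono)
    then have "w N \<le> exp (\<delta> * real N) * (\<mu> * w n)"
      using w_pos[of n] by (simp add: exp_minus field_simps)
    then have "h * (y' * w N) \<le> h * (y' * (exp (\<delta> * real N) * (\<mu> * w n)))"
      using h y by (intro mult_left_mono) auto
    also have "\<dots> = (h * \<mu>) * w n * (y' * exp (\<delta> * real N))" by (simp add: mult_ac)
    also have "h * \<mu> = lam" using \<mu> by (simp add: h_def)
    also have "lam * w n * (y' * exp (\<delta> * real N)) \<le> lam * w n * (y - \<kappa>)"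
      by (intro mult_left_mono y) (use lam w_pos[of n] in auto)
    finally show ?thesis .
  qed
  let ?X = "\<lambda>\<omega> v. if v \<in> A then F (lev v) (st v \<omega>) else False"
  let ?R = "\<lambda>g. y * w n \<le> real (card (reach g n \<rho>)) \<and> real (card (reach g N \<rho>)) < y' * w N"
  have eq: "reach (held \<omega>) k \<rho> = reach (?X \<omega>) k \<rho>" if "k \<le> N" for k \<omega>
    by (rule reach_cong) (use below_mono[OF that, of \<rho>] in \<open>auto simp: A_def held_def F_def\<close>)
  have eqs: "{\<omega> \<in> space M. ?R (held \<omega>)} = {\<omega> \<in> space M. ?R (?X \<omega>)}"
    using eq n by simp
  show "{\<omega> \<in> space M. ?R (held \<omega>)} \<in> events"
    unfolding eqs by (rule observe(1)[OF UF F A])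
  have "prob {\<omega> \<in> space M. ?R (held \<omega>)} = measure_pmf.prob P.Q {g. ?R g}"
    unfolding eqs law_def by (rule observe(2)[OF UF F A])
  also have "\<dots> \<le> measure_pmf.prob P.Q {g. a \<le> card (reach g n \<rho>) \<and> real (card (reach g (n + (N - n)) \<rho>)) < y' * w N}"
    unfolding nN by (intro measure_pmf.finite_measure_mono) (auto simp: a_def)
  also have "\<dots> \<le> exp (h * (y' * w N)) * lap dg q (exp (- h)) (N - n) (lev \<rho> + n) ^ a"
    unfolding q_def by (rule P.step_prob[OF root_V]) (use h nN in \<open>auto simp: A_def\<close>)
  also have "\<dots> \<le> exp (lam * w n * (y - \<kappa>)) * exp (- (lam * (1 - \<kappa> / 2) * (y * w n)))"
    using ha Laa La0 by (intro mult_mono) (auto simp: La_def lev_root)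
  also have "\<dots> = exp (t * (- \<kappa> + \<kappa> * y / 2))"
  proof -
    have e: "lam * w n * (y - \<kappa>) + - (lam * (1 - \<kappa> / 2) * (y * w n)) = (lam * w n) * (- \<kappa> + \<kappa> * y / 2)"
      by (simp add: field_simps)
    have "lam * w n = t" using w_pos[of n] by (simp add: lam_def)
    with e show ?thesis by (metis mult_exp_exp)
  qed
  also have "\<dots> \<le> exp (t * (- \<kappa> + \<kappa> * 1 / 2))"
  proof -
    have "\<kappa> * y \<le> \<kappa> * 1" using \<kappa> y by (intro mult_left_mono) auto
    then have "t * (- \<kappa> + \<kappa> * y / 2) \<le> t * (- \<kappa> + \<kappa> * 1 / 2)"
      using t by (intro mult_left_mono) auto
    then show ?thesis by simp
  qed
  also have "t * (- \<kappa> + \<kappa> * 1 / 2) = - (\<kappa>\<^sup>2 / (6 * \<sigma>))"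
    using \<sigma> by (simp add: t_def power2_eq_square field_simps)
  finally show "prob {\<omega> \<in> space M. ?R (held \<omega>)} \<le> exp (- (\<kappa>\<^sup>2 / (6 * \<sigma>)))" .
qed

end

subsection \<open>A time at which a given vertex is not connected to infinity\<close>

text \<open>The parameters depend on each other in one direction: the depth \<open>m'\<close> on
  \<open>\<epsilon>\<close>, the scales on the number of vertices at that depth, the grid size on
  the scales.\<close>

lemma dead_time_prob:
  assumes \<alpha>: "\<alpha> > 1" and s: "\<And>k. k \<ge> 1 \<Longrightarrow> p k \<le> s" "0 < s" "s < 1"
    and C: "C > 0" "\<And>k. k \<ge> 3 \<Longrightarrow> w k \<le> C * real k * (ln (real k))\<^sup>2"
    and c: "c > 0" "\<And>k. k \<ge> 3 \<Longrightarrow> c * (real k * ln (real k) powr \<alpha>) \<le> w k"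
    and x: "x \<in> V" and a: "0 \<le> a" and len: "0 < len" and \<epsilon>: "0 < \<epsilon>"
  shows "\<exists>N T. finite T \<and> T \<subseteq> {a..a + len} \<and>
    {\<omega> \<in> space M. \<forall>t\<in>T. reach (is_open t \<omega>) N x \<noteq> {}} \<in> events \<and>
    prob {\<omega> \<in> space M. \<forall>t\<in>T. reach (is_open t \<omega>) N x \<noteq> {}} \<le> 3 * \<epsilon>"
proof -
  have c': "c * real k \<le> w k" if k: "k \<ge> 3" for k
  proof -
    have "ln (real k) \<ge> 1"
    proof -
      have "exp 1 \<le> real k" using exp_le k by (meson le_trans of_nat_mono order.trans of_nat_numeral numeral_le_real_of_nat_iff)
      then show ?thesis using k by (subst ln_ge_iff) auto
    qed
    then have "1 \<le> ln (real k) powr \<alpha>" using \<alpha> by (intro ge_one_powr_ge_zero) auto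
    then have "c * (real k * 1) \<le> c * (real k * ln (real k) powr \<alpha>)"
      using c by (intro mult_left_mono) auto
    then show ?thesis using c(2)[OF k] by simp
  qed
  define r where "r = (\<lambda>u k. (p k)\<^sup>2 + p k * (1 - p k) * exp (- u))"
  obtain \<eta> :: real and bb e uu :: "nat \<Rightarrow> real" where
    \<eta>: "\<eta> > 0" and bb: "\<And>n. bb n \<ge> 1" and e: "\<And>n. e n \<ge> 0" "e \<longlonglongrightarrow> 0"
    and bu: "(\<lambda>n. bb n * uu n) \<longlonglongrightarrow> 0" and uu: "\<And>n. uu n \<ge> 0"
    and ev: "eventually (\<lambda>n. lap dg p 0 (4 * n\<^sup>2 - n) n > 0 \<and>
       (\<forall>m u. real m \<le> \<eta> * w n \<longrightarrow> 0 \<le> u \<longrightarrow>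
          1 \<le> joint dg p (r u) (4 * n\<^sup>2 - n) n / (lap dg p 0 (4 * n\<^sup>2 - n) n)\<^sup>2 \<and>
          (joint dg p (r u) (4 * n\<^sup>2 - n) n / (lap dg p 0 (4 * n\<^sup>2 - n) n)\<^sup>2) ^ m \<le>
            (if u \<ge> uu n then 1 + e n else bb n))) sequentially"
    by (rule pair_ratio_at_scale[OF s C c(1) c', of r]) (auto simp: r_def)
  define D where "D = (\<lambda>m. ln (real (m - 1)) powr (1 - \<alpha>) / (\<alpha> - 1) / c)"
  \<comment> \<open>Bounds the probability of a configuration that is not \<open>good\<close>: mean
    number \<open>w m' / w (lev x)\<close> of reached vertices times the bound for one of them. The
    factor \<open>w m'\<close> cancels, and what remains is a tail of the convergent sum of
    \<open>1 / w\<close>.\<close>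
  define \<tau> where "\<tau> = (\<lambda>m. 3 / (2 * \<eta>\<^sup>2 * w (lev x)) * D m)"
  have "\<tau> \<longlonglongrightarrow> 0"
  proof -
    have "(\<lambda>m. ln (real m) powr (1 - \<alpha>)) \<longlonglongrightarrow> 0" using \<alpha> by real_asymp
    then have "(\<lambda>m. ln (real (Suc m - 1)) powr (1 - \<alpha>)) \<longlonglongrightarrow> 0" by simp
    then have "(\<lambda>m. ln (real (m - 1)) powr (1 - \<alpha>)) \<longlonglongrightarrow> 0"
      by (rule filterlim_sequentially_Suc[THEN iffD1])
    then have "(\<lambda>m. 3 / (2 * \<eta>\<^sup>2 * w (lev x)) * (ln (real (m - 1)) powr (1 - \<alpha>) / (\<alpha> - 1) / c)) \<longlonglongrightarrow>
      3 / (2 * \<eta>\<^sup>2 * w (lev x)) * (0 / (\<alpha> - 1) / c)"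
      using \<alpha> c by (intro tendsto_intros) auto
    then show ?thesis by (simp add: \<tau>_def[abs_def] D_def)
  qed
  then have "eventually (\<lambda>m. \<tau> m < \<epsilon> \<and> m \<ge> lev x + 3) sequentially"
    by (intro eventually_conj order_tendstoD(2) eventually_ge_at_top) (use \<epsilon> in auto)
  then obtain m' where m': "\<tau> m' < \<epsilon>" "m' \<ge> lev x + 3" by (auto simp: eventually_sequentially)
  define m where "m = m' - lev x"
  have lm: "lev x + m = m'" using m' by (simp add: m_def)
  have sum_D: "(\<Sum>i=m'..n. 1 / w i) \<le> D m'" for n
  proof -
    have "(\<Sum>i=m'..n. 1 / w i) \<le> (\<Sum>i=m'..n. (1 / (real i * ln (real i) powr \<alpha>)) / c)"
    proof (rule sum_mono)
      fix i assume "i \<in> {m'..n}"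
      then have i: "i \<ge> 3" using m' by auto
      have "0 < real i * ln (real i) powr \<alpha>" using i by simp
      then show "1 / w i \<le> (1 / (real i * ln (real i) powr \<alpha>)) / c"
        using c(2)[OF i] c(1) w_pos[of i] by (simp add: frac_le mult.commute)
    qed
    also have "\<dots> = (\<Sum>i=m'..n. 1 / (real i * ln (real i) powr \<alpha>)) / c" by (simp add: sum_divide_distrib)
    also have "\<dots> \<le> (ln (real (m' - 1)) powr (1 - \<alpha>) / (\<alpha> - 1)) / c"
      by (intro divide_right_mono sum_inverse_log_le) (use \<alpha> m' c in auto)
    finally show ?thesis by (simp add: D_def)
  qed
  have fin: "finite (desc m x)" by (rule desc_fin[OF x])
  define Mb where "Mb = card (desc m x)"
  obtain f where f: "bij_betw f {0..<Mb} (desc m x)"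
    unfolding Mb_def using ex_bij_betw_nat_finite[OF fin] by blast
  define idx where "idx = the_inv_into {0..<Mb} f"
  have idx: "idx b < Mb" if "b \<in> desc m x" for b
    using bij_betw_the_inv_into[OF f] that unfolding idx_def bij_betw_def by auto
  have idxf: "idx (f i) = i" if "i < Mb" for i
    unfolding idx_def using f that by (intro the_inv_into_f_f) (auto simp: bij_betw_def)
  obtain n1 where n1: "\<And>n. n \<ge> n1 \<Longrightarrow> lap dg p 0 (4 * n\<^sup>2 - n) n > 0 \<and>
       (\<forall>m u. real m \<le> \<eta> * w n \<longrightarrow> 0 \<le> u \<longrightarrow>
          1 \<le> joint dg p (r u) (4 * n\<^sup>2 - n) n / (lap dg p 0 (4 * n\<^sup>2 - n) n)\<^sup>2 \<and>
          (joint dg p (r u) (4 * n\<^sup>2 - n) n / (lap dg p 0 (4 * n\<^sup>2 - n) n)\<^sup>2) ^ m \<le>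
            (if u \<ge> uu n then 1 + e n else bb n))"
    using ev unfolding eventually_sequentially by blast
  obtain ns where ns: "\<And>i. i < Mb \<Longrightarrow> ns i \<ge> max m' n1"
    and evG: "eventually (\<lambda>G. (\<Sum>g<G. \<Sum>h<G. \<Prod>i<Mb.
     if \<bar>real g - real h\<bar> * len / real G \<ge> uu (ns i) then 1 + e (ns i) else bb (ns i)) \<le> (1 + \<epsilon>) * (real G)\<^sup>2)
     sequentially"
    using scales_exist[OF bb e uu bu len \<epsilon>, of Mb "max m' n1"] by blast
  obtain G where G: "G > 0" "(\<Sum>g<G. \<Sum>h<G. \<Prod>i<Mb.
     if \<bar>real g - real h\<bar> * len / real G \<ge> uu (ns i) then 1 + e (ns i) else bb (ns i)) \<le> (1 + \<epsilon>) * (real G)\<^sup>2"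
    using eventually_happens[OF eventually_conj[OF evG eventually_gt_at_top[of 0]]] by auto
  define cut where "cut = (\<lambda>b. ns (idx b) - m')"
  define dep where "dep = (\<lambda>b. 4 * (ns (idx b))\<^sup>2 - ns (idx b))"
  have cut: "lev x + m + cut b = ns (idx b)" if "b \<in> desc m x" for b
    using ns[OF idx[OF that]] by (simp add: cut_def lm)
  \<comment> \<open>Any depth beyond all \<open>m + cut b + dep b\<close> would do.\<close>
  define N where "N = m + (\<Sum>b\<in>desc m x. cut b + dep b)"
  define t where "t = (\<lambda>g. a + real g * len / real G)"
  have t: "0 \<le> t g" for g using a len by (simp add: t_def)
  have tdiff: "\<bar>t g - t h\<bar> = \<bar>real g - real h\<bar> * len / real G" for g h
  proof -
    have "t g - t h = (real g - real h) * (len / real G)" by (simp add: t_def algebra_simps diff_divide_distrib)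
    then show ?thesis using len by (simp add: abs_mult)
  qed
  define F where "F = (\<lambda>k y. map (\<lambda>g. open_at (p k) (fst y) (snd y) (t g)) [0..<G])"
  have F: "Measurable.pred state_space (\<lambda>y. F k y = ys)" for k ys
  proof -
    note [measurable] = pred_open_at[of "p k"]
    have "(\<lambda>y. F k y = ys) = (\<lambda>y. length ys = G \<and> (\<forall>g\<in>{..<G}. open_at (p k) (fst y) (snd y) (t g) \<longleftrightarrow> ys ! g))"
      by (auto simp: F_def fun_eq_iff list_eq_iff_nth_eq)
    then show ?thesis by simp
  qed
  define R :: "bool list set" where "R = {ys. length ys = G}"
  have R: "finite R" "\<And>k y. F k y \<in> R"
    using finite_lists_length_eq[of "UNIV :: bool set" G] by (auto simp: R_def F_def)
  define A where "A = below N x"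
  have A: "finite A" "A \<subseteq> V - {\<rho>}"
    unfolding A_def using below_fin[OF x] below_not_root[OF x] by auto
  define law where "law = obs_law F"
  define ob where "ob = (\<lambda>g (ys :: bool list). ys ! g)"
  have obF: "ob g (F k y) \<longleftrightarrow> open_at (p k) (fst y) (snd y) (t g)" if "g < G" for g k y
    using that by (simp add: ob_def F_def)
  have fl: "finite (set_pmf (law k))" for k
    unfolding law_def using set_obs_law[OF R F] R(1) by (rule finite_subset)
  interpret P: perc_tree V ch par lev dg A "[]" law
    by unfold_locales (use A fl in auto)
  have pr: "P.pr (ob g) k = p k" if "g < G" for g k
  proof -
    have "P.pr (ob g) k = measure (edge_law k) {y. open_at (p k) (fst y) (snd y) (t g)}"
      unfolding P.pr_def unfolding law_def using prob_obs_law[OF R F, where k = k and Ob = "ob g"] obF[OF that] by simp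
    then show ?thesis
      using chain.edge_law_point[OF chain[of k] t[of g]] unfolding edge_law_def[symmetric] by simp
  qed
  have prr: "P.pr (\<lambda>ys. ob g ys \<and> ob h ys) k = r \<bar>t g - t h\<bar> k" if "g < G" "h < G" for g h k
  proof -
    have "P.pr (\<lambda>ys. ob g ys \<and> ob h ys) k = measure (edge_law k)
        {y. open_at (p k) (fst y) (snd y) (t g) \<and> open_at (p k) (fst y) (snd y) (t h)}"
      unfolding P.pr_def unfolding law_def
      using prob_obs_law[OF R F, where k = k and Ob = "\<lambda>ys. ob g ys \<and> ob h ys"] obF[OF that(1)] obF[OF that(2)] by simp
    then show ?thesis
      using chain.edge_law_pair[OF chain[of k] t[of g] t[of h]] unfolding edge_law_def[symmetric] r_def by simp
  qed
  define \<theta> where "\<theta> = (\<lambda>b. nat \<lfloor>\<eta> * w (ns (idx b))\<rfloor>)"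
  have \<eta>w: "0 \<le> \<eta> * w k" for k using \<eta> w_pos[of k] by simp
  have \<theta>: "real (\<theta> b) \<le> \<eta> * w (ns (idx b))" for b
    using \<eta>w[of "ns (idx b)"] unfolding \<theta>_def by linarith
  have n1b: "ns (idx b) \<ge> n1" if "b \<in> desc m x" for b using ns[OF idx[OF that]] by simp
  interpret DT: dead_time V ch par lev dg A "[]" law x m cut dep N ob p "\<lambda>g h. r \<bar>t g - t h\<bar>" \<theta> G
  proof unfold_locales
    show "x \<in> V" by (rule x)
    show "below N x \<subseteq> A" by (simp add: A_def)
    show "m \<le> N" by (simp add: N_def)
    show "m + cut b + dep b \<le> N" if "b \<in> desc m x" for b
      using member_le_sum[OF that, of "\<lambda>b. cut b + dep b"] fin by (simp add: N_def)
    show "P.pr (ob g) k = p k" if "g < G" for g k by (rule pr[OF that])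
    show "P.pr (\<lambda>s. ob g s \<and> ob h s) k = r \<bar>t g - t h\<bar> k" if "g < G" "h < G" for g h k
      by (rule prr[OF that])
    show "0 < lap dg p 0 (dep b) (lev x + m + cut b)" if "b \<in> desc m x" for b
      unfolding cut[OF that] dep_def using n1[OF n1b[OF that]] by blast
    \<comment> \<open>The lower bound is part of a statement about exponents \<open>m\<close>;
      exponent 0 fulfils its condition trivially.\<close>
    show "1 \<le> joint dg p (r \<bar>t g - t h\<bar>) (dep b) (lev x + m + cut b) / (lap dg p 0 (dep b) (lev x + m + cut b))\<^sup>2"
      if "b \<in> desc m x" for b g h
      unfolding cut[OF that] dep_def using n1[OF n1b[OF that]] \<eta>w[of "ns (idx b)"]
      by (metis abs_ge_zero of_nat_0)
  qed
  have main: "measure_pmf.prob P.Q {\<omega>. \<forall>g<G. P.rch (ob g) \<omega> N x \<noteq> {}} \<le> 3 * \<epsilon>"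
  proof (rule DT.all_alive_prob[OF G(1)])
    fix g assume g: "g < G"
    define \<tau>1 where "\<tau>1 = 3 / (2 * \<eta>\<^sup>2 * w m') * D m'"
    have "measure_pmf.prob P.Q {\<omega>. \<not> DT.good (DT.S g \<omega>)} \<le>
        (\<Prod>i<m. real (dg (lev x + i)) * p (Suc (lev x + i))) * \<tau>1"
    proof (rule DT.not_good_prob[OF _ g])
      fix b assume b: "b \<in> desc m x"
      define n where "n = ns (idx b)"
      \<comment> \<open>Turns the threshold \<open>1 / h\<close> of \<open>large_reach_prob\<close>
        into \<open>\<eta> * w n\<close>.\<close>
      define h where "h = 1 / (\<eta> * w n)"
      have h: "0 < h" "1 / h = \<eta> * w n" using \<eta> w_pos[of n] by (simp_all add: h_def)
      note bp = DT.b_props[OF b]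
      have levb: "lev b = m'" using bp(2) lm by simp
      have nm: "m' + cut b = n" using cut[OF b] lm by (simp add: n_def)
      have subA: "below (cut b) b \<subseteq> A" using bp(3) below_mono[of "cut b" "cut b + dep b" b] by auto
      have prob_le: "measure_pmf.prob P.Q {\<omega>. \<theta> b < card (P.rch (ob g) \<omega> (cut b) b)} \<le>
          measure_pmf.prob P.Q {\<omega>. 1 / h \<le> real (card (P.rch (ob g) \<omega> (cut b) b))}"
      proof (rule measure_pmf.finite_measure_mono)
        show "{\<omega>. \<theta> b < card (P.rch (ob g) \<omega> (cut b) b)} \<subseteq> {\<omega>. 1 / h \<le> real (card (P.rch (ob g) \<omega> (cut b) b))}"
        proof safe
          fix \<omega> assume "\<theta> b < card (P.rch (ob g) \<omega> (cut b) b)"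
          then have "\<lfloor>\<eta> * w n\<rfloor> < int (card (P.rch (ob g) \<omega> (cut b) b))"
            unfolding \<theta>_def n_def by linarith
          then show "1 / h \<le> real (card (P.rch (ob g) \<omega> (cut b) b))"
            unfolding h(2) by linarith
        qed
      qed simp
      have prg: "P.pr (ob g) = p" using pr[OF g] by auto
      have "measure_pmf.prob P.Q {\<omega>. 1 / h \<le> real (card (P.rch (ob g) \<omega> (cut b) b))} \<le>
          3 * (lap dg p (exp (- h)) (cut b) m' - 1 + h * (\<Prod>i<cut b. real (dg (m' + i)) * p (Suc (m' + i))))"
        using P.large_reach_prob[OF bp(1) subA h(1), of "ob g"] unfolding prg levb .
      also have "(\<Prod>i<cut b. real (dg (m' + i)) * p (Suc (m' + i))) = w n / w m'"
        using w_add[of m' "cut b"] w_pos[of m'] by (simp add: nm)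
      also have "3 * (lap dg p (exp (- h)) (cut b) m' - 1 + h * (w n / w m')) \<le>
          3 * (h\<^sup>2 * (w n)\<^sup>2 / (2 * w m') * (\<Sum>i=m'..n. 1 / w i))"
        using lap_exp_estimate[of h "cut b" m'] h(1) unfolding nm by simp
      also have "\<dots> \<le> 3 * (h\<^sup>2 * (w n)\<^sup>2 / (2 * w m') * D m')"
        by (intro mult_left_mono sum_D) (use w_pos[of m'] in auto)
      also have "\<dots> = \<tau>1"
        using \<eta> w_pos[of n] w_pos[of m'] by (simp add: \<tau>1_def h_def field_simps power2_eq_square)
      finally show "measure_pmf.prob P.Q {\<omega>. \<theta> b < card (P.rch (ob g) \<omega> (cut b) b)} \<le> \<tau>1"
        using prob_le by linarith
    qed
    also have "(\<Prod>i<m. real (dg (lev x + i)) * p (Suc (lev x + i))) = w m' / w (lev x)"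
      using w_add[of "lev x" m] w_pos[of "lev x"] by (simp add: lm)
    also have "w m' / w (lev x) * \<tau>1 = \<tau> m'"
      using w_pos[of m'] w_pos[of "lev x"] \<eta> by (simp add: \<tau>1_def \<tau>_def field_simps)
    finally show "measure_pmf.prob P.Q {\<omega>. \<not> DT.good (DT.S g \<omega>)} \<le> \<epsilon>" using m' by simp
  next
    have "(\<Prod>b\<in>desc m x. (joint dg p (r \<bar>t g - t h\<bar>) (dep b) (lev x + m + cut b) /
          (lap dg p 0 (dep b) (lev x + m + cut b))\<^sup>2) ^ \<theta> b) \<le>
        (\<Prod>i<Mb. if \<bar>real g - real h\<bar> * len / real G \<ge> uu (ns i) then 1 + e (ns i) else bb (ns i))"
      if gh: "g < G" "h < G" for g h
    proof -
      let ?B = "\<lambda>i. if \<bar>real g - real h\<bar> * len / real G \<ge> uu (ns i) then 1 + e (ns i) else bb (ns i)"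
      have "(\<Prod>b\<in>desc m x. (joint dg p (r \<bar>t g - t h\<bar>) (dep b) (lev x + m + cut b) /
          (lap dg p 0 (dep b) (lev x + m + cut b))\<^sup>2) ^ \<theta> b) \<le> (\<Prod>b\<in>desc m x. ?B (idx b))"
      proof (rule prod_mono, intro conjI)
        fix b assume b: "b \<in> desc m x"
        have r1: "1 \<le> joint dg p (r \<bar>t g - t h\<bar>) (dep b) (lev x + m + cut b) / (lap dg p 0 (dep b) (lev x + m + cut b))\<^sup>2"
          by (rule DT.ratio_ge[OF b gh])
        then show "0 \<le> (joint dg p (r \<bar>t g - t h\<bar>) (dep b) (lev x + m + cut b) /
          (lap dg p 0 (dep b) (lev x + m + cut b))\<^sup>2) ^ \<theta> b" by (intro zero_le_power) linarith
        have "(joint dg p (r \<bar>t g - t h\<bar>) (dep b) (lev x + m + cut b) /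
          (lap dg p 0 (dep b) (lev x + m + cut b))\<^sup>2) ^ \<theta> b \<le>
          (if \<bar>t g - t h\<bar> \<ge> uu (ns (idx b)) then 1 + e (ns (idx b)) else bb (ns (idx b)))"
          unfolding cut[OF b] dep_def using n1[OF n1b[OF b]] \<theta>[of b] abs_ge_zero by blast
        then show "(joint dg p (r \<bar>t g - t h\<bar>) (dep b) (lev x + m + cut b) /
          (lap dg p 0 (dep b) (lev x + m + cut b))\<^sup>2) ^ \<theta> b \<le> ?B (idx b)" unfolding tdiff .
      qed
      also have "(\<Prod>b\<in>desc m x. ?B (idx b)) = (\<Prod>i\<in>{0..<Mb}. ?B (idx (f i)))"
        by (rule prod.reindex_bij_betw[OF f, symmetric])
      also have "\<dots> = (\<Prod>i\<in>{0..<Mb}. ?B i)"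
        by (rule prod.cong[OF refl]) (simp add: idxf)
      also have "\<dots> = (\<Prod>i<Mb. ?B i)" by (simp add: atLeast0LessThan)
      finally show ?thesis .
    qed
    then have "(\<Sum>g<G. \<Sum>h<G. \<Prod>b\<in>desc m x. (joint dg p (r \<bar>t g - t h\<bar>) (dep b) (lev x + m + cut b) /
          (lap dg p 0 (dep b) (lev x + m + cut b))\<^sup>2) ^ \<theta> b) \<le>
        (\<Sum>g<G. \<Sum>h<G. \<Prod>i<Mb. if \<bar>real g - real h\<bar> * len / real G \<ge> uu (ns i) then 1 + e (ns i) else bb (ns i))"
      by (intro sum_mono) auto
    then show "(\<Sum>g<G. \<Sum>h<G. \<Prod>b\<in>desc m x. (joint dg p (r \<bar>t g - t h\<bar>) (dep b) (lev x + m + cut b) /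
          (lap dg p 0 (dep b) (lev x + m + cut b))\<^sup>2) ^ \<theta> b) \<le> (1 + \<epsilon>) * (real G)\<^sup>2"
      using G(2) by linarith
  qed
  let ?X = "\<lambda>\<omega> v. if v \<in> A then F (lev v) (st v \<omega>) else []"
  let ?R = "\<lambda>gg. \<forall>g<G. P.rch (ob g) gg N x \<noteq> {}"
  have eq: "reach (is_open (t g) \<omega>) N x = P.rch (ob g) (?X \<omega>) N x" if "g < G" for g \<omega>
    by (rule reach_cong) (use obF[OF that] in \<open>auto simp: A_def is_open_def\<close>)
  have eqs: "{\<omega> \<in> space M. \<forall>t\<in>t ` {..<G}. reach (is_open t \<omega>) N x \<noteq> {}} = {\<omega> \<in> space M. ?R (?X \<omega>)}"
    using eq by auto
  have "{\<omega> \<in> space M. ?R (?X \<omega>)} \<in> events" by (rule observe(1)[OF R F A])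
  moreover have "prob {\<omega> \<in> space M. ?R (?X \<omega>)} \<le> 3 * \<epsilon>"
  proof -
    have "prob {\<omega> \<in> space M. ?R (?X \<omega>)} = measure_pmf.prob P.Q {g. ?R g}"
      unfolding law_def by (rule observe(2)[OF R F A])
    also have "\<dots> \<le> 3 * \<epsilon>" by (rule main)
    finally show ?thesis .
  qed
  moreover have "t ` {..<G} \<subseteq> {a..a + len}"
  proof safe
    fix g assume "g < G"
    then have "real g * len / real G \<le> real G * len / real G"
      using len by (intro divide_right_mono mult_right_mono) auto
    then show "t g \<in> {a..a + len}" using len G by (simp add: t_def)
  qed
  moreover have "finite (t ` {..<G})" by simp
  ultimately have "finite (t ` {..<G}) \<and> t ` {..<G} \<subseteq> {a..a + len} \<and>
    {\<omega> \<in> space M. \<forall>t\<in>t ` {..<G}. reach (is_open t \<omega>) N x \<noteq> {}} \<in> events \<and>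
    prob {\<omega> \<in> space M. \<forall>t\<in>t ` {..<G}. reach (is_open t \<omega>) N x \<noteq> {}} \<le> 3 * \<epsilon>"
    unfolding eqs by blast
  then show ?thesis by blast
qed

end


section \<open>Scales and losses for the absence of exceptional times\<close>

lemma one_le_ln:
  assumes "3 \<le> k"
  shows "1 \<le> ln (real k)"
proof -
  have "exp 1 \<le> real k" using exp_le assms by linarith
  then show ?thesis using assms by (subst ln_ge_iff) auto
qed

text \<open>Logarithms double from scale to scale, so with \<open>e = \<alpha> - 2\<close> the tails
  \<open>\<sigma> j\<close> decay like \<open>2 powr (- j * (1 + e))\<close>. The losses
  \<open>\<kappa> j\<close> are summable, yet \<open>\<kappa>\<^sup>2 / \<sigma>\<close> grows like
  \<open>2 powr (j * (1 + e / 2))\<close> and so outgrows the logarithm of the number of intervals,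
  which is of order \<open>2 ^ j\<close>. This is the use of \<alpha> > 2.\<close>

lemma scale_sequence:
  fixes w :: "nat \<Rightarrow> real" and L \<epsilon> \<alpha> :: real
  assumes \<alpha>: "2 < \<alpha>" "\<alpha> \<le> 3" and w: "\<And>k. k \<ge> k0 \<Longrightarrow> real k * ln (real k) powr \<alpha> \<le> w k"
    and L: "0 \<le> L" and \<epsilon>: "0 < \<epsilon>"
  obtains n0 :: nat and \<kappa> y \<sigma> :: "nat \<Rightarrow> real" where
    "n0 \<ge> 2" "\<And>j. 0 < \<kappa> j \<and> \<kappa> j \<le> 1" "\<And>j. 1 / 2 \<le> y j \<and> y j \<le> 1" "y 0 = 1" "\<And>j. 0 < \<sigma> j"
    "\<And>j. (\<Sum>i=n0 ^ (2 ^ j)..n0 ^ (2 ^ Suc j). 1 / w i) \<le> \<sigma> j"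
    "\<And>j. y (Suc j) * exp (1 / real (n0 ^ (2 ^ Suc j))) \<le> y j - \<kappa> j"
    "\<And>j. (L + 1) * (real (n0 ^ (2 ^ Suc j)))\<^sup>2 * exp (- ((\<kappa> j)\<^sup>2 / (6 * \<sigma> j))) \<le> \<epsilon> * (1 / 2) ^ Suc j"
proof -
  define e where "e = \<alpha> - 2"
  have e: "0 < e" "e \<le> 1" "\<alpha> = 2 + e" using \<alpha> by (auto simp: e_def)
  \<comment> \<open>Half of the surplus \<open>e\<close> is spent on making the losses summable:
    \<open>q\<^sup>2 = 2 powr (- e / 2)\<close>.\<close>
  define q where "q = 2 powr (- e / 4)"
  have q1: "q < 1" using e by (simp add: q_def powr_less_one)
  have q2: "1 / 2 \<le> q"
  proof -
    have "2 powr (- 1) \<le> 2 powr (- e / 4)" using e by (intro powr_mono) auto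
    then show ?thesis by (simp add: q_def powr_minus_divide)
  qed
  \<comment> \<open>The constants of \<open>\<kappa>\<^sup>2 / (6 * \<sigma>)\<close> collected: 96
    = 16 * 6, and the power of 1/2 comes from the halved logarithm in
    \<open>\<sigma>\<close>.\<close>
  define c2 where "c2 = (1 - q)\<^sup>2 / 96 * (1 / 2) powr (1 + e)"
  have c2: "c2 > 0" using q1 by (simp add: c2_def)
  define mm where "mm = min (\<epsilon> / (L + 1)) 1"
  have mm: "0 < mm" "mm \<le> 1" "mm \<le> \<epsilon> / (L + 1)" using \<epsilon> L by (auto simp: mm_def)
  have "filterlim (\<lambda>n. c2 * ln (real n) powr e) at_top sequentially"
    using c2 e(1) by real_asymp
  then have "eventually (\<lambda>n. c2 * ln (real n) powr e \<ge> 5) sequentially"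
    by (simp add: filterlim_at_top)
  moreover have lim: "(\<lambda>n. 1 / real n) \<longlonglongrightarrow> 0" by real_asymp
  have "eventually (\<lambda>n. 1 / real n < (1 - q) / 16) sequentially" "eventually (\<lambda>n. 1 / real n < mm / 2) sequentially"
    using order_tendstoD(2)[OF lim, of "(1 - q) / 16"] order_tendstoD(2)[OF lim, of "mm / 2"] q1 mm by auto
  ultimately have "eventually (\<lambda>n. c2 * ln (real n) powr e \<ge> 5 \<and> 1 / real n < (1 - q) / 16 \<and>
      1 / real n < mm / 2 \<and> n \<ge> max k0 4) sequentially"
    by (intro eventually_conj eventually_ge_at_top)
  \<comment> \<open>5 = 4 + 1: with \<open>X = 2 ^ j * lam\<close> the number of intervals is of
    order \<open>exp (4 * X)\<close>, and a further \<open>exp (- X)\<close> makes the sum over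
    \<open>j\<close> small.\<close>
  then obtain n0 where n0: "c2 * ln (real n0) powr e \<ge> 5" "1 / real n0 < (1 - q) / 16" "1 / real n0 < mm / 2"
      "n0 \<ge> k0" "n0 \<ge> 4"
    by (auto simp: eventually_sequentially)
  define lam where "lam = ln (real n0)"
  have lam: "0 < lam" using n0 by (simp add: lam_def)
  define n where "n = (\<lambda>j::nat. n0 ^ (2 ^ j))"
  have n_ge: "n j \<ge> n0" for j
    unfolding n_def using n0 by (intro self_le_power) auto
  have ln_n: "ln (real (n j)) = 2 ^ j * lam" for j
    using n0 by (simp add: n_def lam_def ln_realpow)
  define \<kappa> where "\<kappa> = (\<lambda>j::nat. (1 - q) / 4 * q ^ j)"
  \<comment> \<open>\<open>y j - y (Suc j) = 2 * \<kappa> j\<close>: one half is the allowed loss,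
    the other absorbs the factor \<open>exp (1 / n (Suc j))\<close> for edges that do not stay
    open.\<close>
  define y where "y = (\<lambda>j::nat. (1 + q ^ j) / 2)"
  define \<sigma> where "\<sigma> = (\<lambda>j::nat. (2 ^ j * lam / 2) powr (- (1 + e)))"
  have qj: "0 < q ^ j" "q ^ j \<le> 1" "(1 / 2) ^ j \<le> q ^ j" for j
    using q1 q2 by (auto intro: power_le_one power_mono)
  have pw: "Suc j \<le> 2 ^ j" for j :: nat by (induction j) auto
  show ?thesis
  proof (rule that[of n0 \<kappa> y \<sigma>])
    show "n0 \<ge> 2" using n0 by simp
    show "0 < \<kappa> j \<and> \<kappa> j \<le> 1" for j
    proof
      show "0 < \<kappa> j" using q1 qj[of j] by (simp add: \<kappa>_def)
      have "(1 - q) / 4 * q ^ j \<le> 1 * 1" using q1 q2 qj[of j] by (intro mult_mono) auto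
      then show "\<kappa> j \<le> 1" by (simp add: \<kappa>_def)
    qed
    show "1 / 2 \<le> y j \<and> y j \<le> 1" for j using qj[of j] by (simp add: y_def)
    show "y 0 = 1" by (simp add: y_def)
    show "0 < \<sigma> j" for j using lam by (simp add: \<sigma>_def)
    show "(\<Sum>i=n0 ^ (2 ^ j)..n0 ^ (2 ^ Suc j). 1 / w i) \<le> \<sigma> j" for j
    proof -
      have nj: "n j \<ge> 4" "n j \<ge> k0" using n_ge[of j] n0 by auto
      have "(\<Sum>i=n j..n (Suc j). 1 / w i) \<le> (\<Sum>i=n j..n (Suc j). 1 / (real i * ln (real i) powr \<alpha>))"
      proof (rule sum_mono)
        fix i assume "i \<in> {n j..n (Suc j)}"
        then have i: "i \<ge> 4" "i \<ge> k0" using nj by auto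
        have "0 < real i * ln (real i) powr \<alpha>" using i by simp
        then show "1 / w i \<le> 1 / (real i * ln (real i) powr \<alpha>)"
          using w[OF i(2)] by (intro divide_left_mono) auto
      qed
      also have "\<dots> \<le> ln (real (n j - 1)) powr (1 - \<alpha>) / (\<alpha> - 1)"
        by (rule sum_inverse_log_le) (use \<alpha> nj in auto)
      also have "\<dots> \<le> ln (real (n j - 1)) powr (1 - \<alpha>) / 1"
        by (intro divide_left_mono) (use \<alpha> in auto)
      \<comment> \<open>From \<open>n j \<le> (n j - 1)\<^sup>2\<close> the logarithm of
        \<open>n j - 1\<close> is at least half of that of \<open>n j\<close>.\<close>
      also have "\<dots> \<le> (2 ^ j * lam / 2) powr (1 - \<alpha>)"
      proof -
        define z where "z = real (n j)"
        have z: "z \<ge> 4" using nj by (simp add: z_def)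
        have "z \<le> (z - 1)\<^sup>2" 
        proof -
          have "0 \<le> (z - 4) * z + (z + 1)" using z by (intro add_nonneg_nonneg mult_nonneg_nonneg) auto
          then show ?thesis by (simp add: power2_eq_square algebra_simps)
        qed
        then have "ln z \<le> ln ((z - 1)\<^sup>2)" using z by (subst ln_le_cancel_iff) auto
        also have "\<dots> = 2 * ln (z - 1)" using z by (subst ln_realpow) auto
        finally have "2 ^ j * lam / 2 \<le> ln (z - 1)" using ln_n[of j] by (simp add: z_def)
        moreover have "z - 1 = real (n j - 1)" using nj by (simp add: z_def of_nat_diff)
        ultimately show ?thesis
          using \<alpha> lam by (simp only: div_by_1) (intro powr_mono2', auto)
      qed
      also have "1 - \<alpha> = - (1 + e)" using e by simp
      finally show ?thesis by (simp add: n_def \<sigma>_def)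
    qed
    show "y (Suc j) * exp (1 / real (n0 ^ (2 ^ Suc j))) \<le> y j - \<kappa> j" for j
    proof -
      define x where "x = 1 / real (n (Suc j))"
      have "n0 * 2 ^ j \<le> n (Suc j)"
      proof -
        have "n0 * 2 ^ j \<le> n0 * n0 ^ j" using n0 by (intro mult_left_mono power_mono) auto
        also have "\<dots> = n0 ^ Suc j" by simp
        also have "\<dots> \<le> n0 ^ (2 ^ Suc j)"
        proof (rule power_increasing)
          show "Suc j \<le> 2 ^ Suc j" using pw[of "Suc j"] by linarith
        qed (use n0 in auto)
        finally show ?thesis by (simp add: n_def)
      qed
      then have "real n0 * 2 ^ j \<le> real (n (Suc j))" by (metis of_nat_le_iff of_nat_mult of_nat_numeral of_nat_power)
      then have "x \<le> 1 / (real n0 * 2 ^ j)"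
        unfolding x_def using n0 n_ge[of "Suc j"] by (intro divide_left_mono mult_pos_pos) auto
      also have "\<dots> = 1 / real n0 * (1 / 2) ^ j" by (simp add: power_divide)
      also have "\<dots> \<le> (1 - q) / 16 * q ^ j"
        using n0 qj[of j] q1 by (intro mult_mono) auto
      finally have x\<kappa>: "x \<le> (1 - q) / 16 * q ^ j" .
      have x0: "0 \<le> x" by (simp add: x_def)
      have "(1 - q) / 16 * q ^ j \<le> 1 * 1" using q1 q2 qj[of j] by (intro mult_mono) auto
      then have x1: "x \<le> 1" using x\<kappa> by simp
      have "exp x \<le> 1 + x + x\<^sup>2" by (rule exp_bound[OF x0 x1])
      also have "x\<^sup>2 \<le> x" using x0 x1 by (simp add: power2_eq_square mult_left_le)
      finally have ex: "exp x \<le> 1 + 2 * x" by simp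
      have ys: "0 \<le> y (Suc j)" "y (Suc j) \<le> 1" using qj[of "Suc j"] by (auto simp: y_def)
      have "y (Suc j) * exp x \<le> y (Suc j) * (1 + 2 * x)" by (rule mult_left_mono[OF ex ys(1)])
      also have "\<dots> \<le> y (Suc j) + 2 * x"
        using mult_right_mono[OF ys(2), of "2 * x"] x0 by (simp add: algebra_simps)
      also have "\<dots> \<le> y (Suc j) + \<kappa> j"
      proof -
        have "2 * ((1 - q) / 16 * q ^ j) \<le> \<kappa> j" using q1 qj[of j] by (simp add: \<kappa>_def)
        then show ?thesis using x\<kappa> by linarith
      qed
      also have "\<dots> = y j - \<kappa> j" by (simp add: y_def \<kappa>_def field_simps)
      finally show ?thesis by (simp add: x_def n_def)
    qed
    show "(L + 1) * (real (n0 ^ (2 ^ Suc j)))\<^sup>2 * exp (- ((\<kappa> j)\<^sup>2 / (6 * \<sigma> j))) \<le> \<epsilon> * (1 / 2) ^ Suc j" for j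
    proof -
      define X where "X = 2 ^ j * lam"
      have X: "0 < X" using lam by (simp add: X_def)
      have "(real (n (Suc j)))\<^sup>2 = exp (2 * ln (real (n (Suc j))))"
      proof -
        have "0 < real (n (Suc j))" using n_ge[of "Suc j"] n0 by simp
        then show ?thesis by (simp add: exp_double)
      qed
      also have "2 * ln (real (n (Suc j))) = 4 * X" by (simp add: ln_n X_def)
      finally have N2: "(real (n (Suc j)))\<^sup>2 = exp (4 * X)" .
      have "5 * X \<le> (\<kappa> j)\<^sup>2 / (6 * \<sigma> j)"
      proof -
        have s: "1 / \<sigma> j = (X / 2) powr (1 + e)"
          unfolding \<sigma>_def X_def by (simp only: powr_minus divide_inverse inverse_inverse_eq mult_1)
        have X2: "X / 2 = 2 ^ j * (lam * (1 / 2))" by (simp add: X_def)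
        have s2: "(X / 2) powr (1 + e) = (2 ^ j) powr (1 + e) * (lam powr (1 + e) * (1 / 2) powr (1 + e))"
        proof -
          have "(lam * (1 / 2)) powr (1 + e) = lam powr (1 + e) * (1 / 2) powr (1 + e)"
            by (rule powr_mult)
          moreover have "(2 ^ j * (lam * (1 / 2))) powr (1 + e) = (2 ^ j) powr (1 + e) * (lam * (1 / 2)) powr (1 + e)"
            by (rule powr_mult)
          ultimately show ?thesis unfolding X2 by (simp only:)
        qed
        have q2j: "(q ^ j)\<^sup>2 = 2 powr (- (e / 2) * real j)"
        proof -
          have "(q ^ j)\<^sup>2 = q ^ (j * 2)" by (simp add: power_mult)
          also have "\<dots> = (2 powr (- e / 4)) powr real (j * 2)"
            unfolding q_def by (rule powr_realpow[symmetric]) simp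
          also have "\<dots> = 2 powr (- (e / 2) * real j)" by (simp add: powr_powr)
          finally show ?thesis .
        qed
        have two: "(2 ^ j) powr (1 + e) = 2 powr (real j * (1 + e))"
          by (simp add: powr_realpow[symmetric] powr_powr)
        have "2 ^ j \<le> (q ^ j)\<^sup>2 * (2 ^ j) powr (1 + e)"
        proof -
          have "2 ^ j = 2 powr real j" by (simp add: powr_realpow)
          also have "\<dots> \<le> 2 powr (- (e / 2) * real j + real j * (1 + e))"
            using e by (intro powr_mono) (auto simp: algebra_simps)
          also have "\<dots> = (q ^ j)\<^sup>2 * (2 ^ j) powr (1 + e)" unfolding q2j two by (rule powr_add)
          finally show ?thesis .
        qed
        then have "c2 * lam powr (1 + e) * 2 ^ j \<le> c2 * lam powr (1 + e) * ((q ^ j)\<^sup>2 * (2 ^ j) powr (1 + e))"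
          using c2 by (intro mult_left_mono) auto
        also have "\<dots> = (\<kappa> j)\<^sup>2 / 6 * (1 / \<sigma> j)"
          unfolding s s2 by (simp add: c2_def \<kappa>_def power_mult_distrib power_divide)
        finally have 1: "c2 * lam powr (1 + e) * 2 ^ j \<le> (\<kappa> j)\<^sup>2 / (6 * \<sigma> j)" by simp
        have "5 * X \<le> (c2 * lam powr e) * X"
          using n0 X by (intro mult_right_mono) (auto simp: lam_def)
        also have "\<dots> = c2 * lam powr (1 + e) * 2 ^ j"
          using lam by (simp add: X_def powr_add)
        finally show ?thesis using 1 by linarith
      qed
      then have "exp (- ((\<kappa> j)\<^sup>2 / (6 * \<sigma> j))) \<le> exp (- (5 * X))" by simp
      then have C1: "(L + 1) * (real (n (Suc j)))\<^sup>2 * exp (- ((\<kappa> j)\<^sup>2 / (6 * \<sigma> j))) \<le> (L + 1) * exp (4 * X) * exp (- (5 * X))"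
        unfolding N2 using L by (intro mult_left_mono) auto
      have "exp (- X) \<le> exp (- (real (Suc j) * lam))"
      proof -
        have "real (Suc j) \<le> real (2 ^ j)" using pw[of j] by (simp only: of_nat_le_iff)
        then have "real (Suc j) * lam \<le> 2 ^ j * lam" using lam by (intro mult_right_mono) auto
        then show ?thesis unfolding X_def by (simp only: exp_le_cancel_iff neg_le_iff_le)
      qed
      also have "exp (- (real (Suc j) * lam)) = (1 / real n0) ^ Suc j"
      proof -
        have "0 < real n0" using n0(5) by simp
        then have "exp lam = real n0" unfolding lam_def by (rule exp_ln)
        then have *: "1 / real n0 = exp (- lam)" by (simp only: exp_minus inverse_eq_divide)
        have "exp (real (Suc j) * - lam) = exp (- lam) ^ Suc j" by (rule exp_of_nat_mult)
        then show ?thesis unfolding * by (simp only: mult_minus_right)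
      qed
      also have "(1 / real n0) ^ Suc j \<le> (mm * (1 / 2)) ^ Suc j"
        using n0 by (intro power_mono) auto
      also have "\<dots> = mm ^ Suc j * (1 / 2) ^ Suc j" by (rule power_mult_distrib)
      also have "\<dots> \<le> mm * (1 / 2) ^ Suc j"
      proof (rule mult_right_mono)
        show "mm ^ Suc j \<le> mm" using power_le_one[of mm j] mm by (simp add: mult_left_le)
      qed simp
      also have "mm * (1 / 2) ^ Suc j \<le> \<epsilon> / (L + 1) * (1 / 2) ^ Suc j"
        using mm by (intro mult_right_mono) auto
      finally have E: "exp (- X) \<le> \<epsilon> / (L + 1) * (1 / 2) ^ Suc j" .
      note C1
      also have "(L + 1) * exp (4 * X) * exp (- (5 * X)) = (L + 1) * exp (- X)" by (simp add: mult.assoc mult_exp_exp)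
      also have "\<dots> \<le> (L + 1) * (\<epsilon> / (L + 1) * (1 / 2) ^ Suc j)"
        by (rule mult_left_mono[OF E]) (use L in simp)
      also have "\<dots> = \<epsilon> * (1 / 2) ^ Suc j"
      proof -
        have "(L + 1) * (\<epsilon> / (L + 1) * z) = \<epsilon> * z" for z using L by (simp add: field_simps)
        from this[of "(1 / 2) ^ Suc j"] show ?thesis .
      qed
      finally show ?thesis unfolding n_def .
    qed
  qed
qed

lemma (in prob_space) AE_if_small:
  assumes "\<And>\<epsilon>. 0 < \<epsilon> \<Longrightarrow> \<exists>N\<in>events. prob N \<le> \<epsilon> \<and> (\<forall>\<omega>\<in>space M - N. R \<omega>)"
  shows "AE \<omega> in M. R \<omega>"
proof -
  have "\<exists>N\<in>events. prob N \<le> 1 / real (Suc i) \<and> (\<forall>\<omega>\<in>space M - N. R \<omega>)" for i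
    by (rule assms) simp
  then have "\<forall>i. \<exists>N. N \<in> events \<and> prob N \<le> 1 / real (Suc i) \<and> (\<forall>\<omega>\<in>space M - N. R \<omega>)"
    by blast
  from choice[OF this] obtain N where
    "\<forall>i. N i \<in> events \<and> prob (N i) \<le> 1 / real (Suc i) \<and> (\<forall>\<omega>\<in>space M - N i. R \<omega>)" ..
  then have N: "\<And>i. N i \<in> events" "\<And>i. prob (N i) \<le> 1 / real (Suc i)" "\<And>i \<omega>. \<omega> \<in> space M - N i \<Longrightarrow> R \<omega>"
    by auto
  have ev: "(\<Inter>i. N i) \<in> events" using N(1) by auto
  have "prob (\<Inter>i. N i) \<le> 1 / real (Suc i)" for i
  proof -
    have "prob (\<Inter>i. N i) \<le> prob (N i)" by (rule finite_measure_mono[OF _ N(1)]) auto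
    then show ?thesis using N(2)[of i] by linarith
  qed
  moreover have "(\<lambda>i. 1 / real (Suc i)) \<longlonglongrightarrow> 0" by real_asymp
  ultimately have "prob (\<Inter>i. N i) \<le> 0" by (intro LIMSEQ_le_const) auto
  then have "prob (\<Inter>i. N i) = 0" using measure_nonneg[of M "\<Inter>i. N i"] by linarith
  then have "(\<Inter>i. N i) \<in> null_sets M" using ev by (simp add: null_sets_def emeasure_eq_measure)
  then show ?thesis
    by (rule AE_I') (use N(3) in auto)
qed

context sph_tree
begin

text \<open>A level of degree 0 would leave all later levels empty, and finitely many finite levels
  cannot make up the infinite vertex set.\<close>

lemma dg_ge_1: "dg k \<ge> 1"
proof (rule ccontr)
  assume "\<not> dg k \<ge> 1"
  then have dk: "dg k = 0" by simp
  have "card (desc (Suc k) \<rho>) = 0"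
    unfolding card_desc[OF root_V] using dk by (simp add: lev_root)
  then have 0: "desc (Suc k) \<rho> = {}" using desc_fin[OF root_V, of "Suc k"] by (simp only: card_0_eq)
  have e: "lev x \<le> k" if "x \<in> V" for x
  proof (rule ccontr)
    assume "\<not> lev x \<le> k"
    then have l: "lev x = Suc k + (lev x - Suc k)" by simp
    have "desc (Suc k + (lev x - Suc k)) \<rho> = {}" unfolding desc_add 0 by (rule UN_empty)
    then have "desc (lev x) \<rho> = {}" unfolding l[symmetric] .
    then show False using that by (auto simp add: desc_root level_set_def)
  qed
  have "V \<subseteq> (\<Union>n\<in>{..k}. desc n \<rho>)"
  proof
    fix x assume "x \<in> V"
    then have "x \<in> desc (lev x) \<rho>" "lev x \<le> k" by (simp_all add: desc_root level_set_def e)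
    then show "x \<in> (\<Union>n\<in>{..k}. desc n \<rho>)" by blast
  qed
  moreover have "finite (\<Union>n\<in>{..k}. desc n \<rho>)" using desc_fin[OF root_V] by simp
  ultimately have "finite V" by (rule finite_subset)
  then show False using sph by (simp add: spherically_symmetric_tree_def)
qed

lemma edge_uedge:
  assumes "e \<in> E"
  obtains v where "v \<in> V" "v \<noteq> \<rho>" "e = uedge v"
proof -
  obtain x y where xy: "x \<in> V" "y \<in> V" "e = {x, y}"
  proof -
    have "simple_graph V E" using sph by (simp add: spherically_symmetric_tree_def tree_def)
    then show thesis using assms that unfolding simple_graph_def by blast
  qed
  note pick = that
  have *: thesis if ab: "b \<in> ch a" "a \<in> V" "e = {a, b}" for a b
  proof (rule pick[of b])
    show "b \<in> V" using ch_V[OF ab(2)] ab(1) by blast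
    show "b \<noteq> \<rho>" using ch_lev[OF ab(2,1)] lev_root by auto
    show "e = uedge b" using ab par_ch by simp
  qed
  have "e = {y, x}" using xy(3) by (simp add: insert_commute)
  moreover have "y \<in> ch x \<or> x \<in> ch y" using assms unfolding xy(3) by (rule edge_ch)
  ultimately show ?thesis using *[of y x] *[of x y] xy by (elim disjE) simp_all
qed

lemma reach_True: "reach (\<lambda>_. True) n x = desc n x"
  by (induction n arbitrary: x) auto

end


text \<open>Rounding down to a finer grid does not change the cell of the coarse grid. Hence one
  representative time per fine interval has the same windows at all coarser scales.\<close>

lemma floor_of_floor_mult_divide:
  fixes x :: real
  assumes "0 < d"
  shows "\<lfloor>real_of_int \<lfloor>x * real d\<rfloor> / real d\<rfloor> = \<lfloor>x\<rfloor>"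
proof (rule floor_unique)
  have d: "0 < real d" using assms by simp
  have "real_of_int (\<lfloor>x\<rfloor> * int d) \<le> x * real d" using d by (simp add: mult_right_mono)
  then have "\<lfloor>x\<rfloor> * int d \<le> \<lfloor>x * real d\<rfloor>" by (simp only: le_floor_iff)
  then have "real_of_int (\<lfloor>x\<rfloor> * int d) \<le> real_of_int \<lfloor>x * real d\<rfloor>" by (simp only: of_int_le_iff)
  then show "real_of_int \<lfloor>x\<rfloor> \<le> real_of_int \<lfloor>x * real d\<rfloor> / real d"
    using d by (simp add: pos_le_divide_eq)
  have "real_of_int \<lfloor>x * real d\<rfloor> / real d \<le> x"
    using d by (simp add: pos_divide_le_eq)
  also have "x < real_of_int \<lfloor>x\<rfloor> + 1" by linarith
  finally show "real_of_int \<lfloor>x * real d\<rfloor> / real d < real_of_int \<lfloor>x\<rfloor> + 1" .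
qed

section \<open>Absence of exceptional times\<close>

context dyn_perc
begin

lemma w_le_card_desc: "w n \<le> real (card (desc n \<rho>))"
proof -
  have "w n \<le> (\<Prod>i<n. real (dg i))"
    unfolding w_def
  proof (rule prod_mono, intro conjI)
    fix i
    show "0 \<le> real (dg i) * p (Suc i)" using p01[of "Suc i"] by simp
    show "real (dg i) * p (Suc i) \<le> real (dg i)" using p01[of "Suc i"] by (simp add: mult_left_le)
  qed
  then show ?thesis unfolding card_desc[OF root_V] by (simp add: lev_root)
qed

text \<open>A fine interval of scale \<open>j\<close> fixes all windows down to level
  \<open>n (Suc j)\<close>, so uncountably many times lead to finitely many bad events per scale.
  Off these, the number of held vertices at level \<open>n j\<close> is at least
  \<open>y j * w (n j)\<close>, hence never 0. The path is located below a vertex of level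
  \<open>n0\<close> because the edges above are held only by definition.\<close>

lemma no_exceptional_times:
  fixes L :: nat
  assumes \<alpha>: "2 < \<alpha>" "\<alpha> \<le> 3" and wl: "\<And>k. k \<ge> k0 \<Longrightarrow> real k * ln (real k) powr \<alpha> \<le> w k"
  shows "AE \<omega> in M. \<forall>t\<in>{0..real L}. \<exists>n0. \<forall>N. \<exists>M'\<ge>N. \<exists>b\<in>desc n0 \<rho>. reach (is_open t \<omega>) M' b \<noteq> {}"
proof (rule AE_if_small)
  fix \<epsilon> :: real assume \<epsilon>: "0 < \<epsilon>"
  obtain n0 :: nat and \<kappa> y \<sigma> :: "nat \<Rightarrow> real" where n0: "n0 \<ge> 2"
    and \<kappa>: "\<And>j. 0 < \<kappa> j \<and> \<kappa> j \<le> 1" and y: "\<And>j. 1 / 2 \<le> y j \<and> y j \<le> 1" and y0: "y 0 = 1"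
    and \<sigma>: "\<And>j. 0 < \<sigma> j"
    and sum_w: "\<And>j. (\<Sum>i=n0 ^ (2 ^ j)..n0 ^ (2 ^ Suc j). 1 / w i) \<le> \<sigma> j"
    and yy: "\<And>j. y (Suc j) * exp (1 / real (n0 ^ (2 ^ Suc j))) \<le> y j - \<kappa> j"
    and small: "\<And>j. (real L + 1) * (real (n0 ^ (2 ^ Suc j)))\<^sup>2 * exp (- ((\<kappa> j)\<^sup>2 / (6 * \<sigma> j))) \<le> \<epsilon> * (1 / 2) ^ Suc j"
    by (rule scale_sequence[where L = "real L" and ?k0.0 = k0, OF \<alpha> wl _ \<epsilon>])
       (assumption | rule of_nat_0_le_iff | (rule that; assumption))+
  define n where "n = (\<lambda>j::nat. n0 ^ (2 ^ j))"
  have n_eq: "n0 ^ (2 ^ j) = n j" for j by (simp only: n_def)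
  note sum_w = sum_w[unfolded n_eq] and yy = yy[unfolded n_eq] and small = small[unfolded n_eq]
  have n_0: "n 0 = n0" by (simp add: n_def)
  have n_pos: "0 < n j" for j using n0 by (simp add: n_def)
  have n_Suc: "n j < n (Suc j)" for j
    unfolding n_def using n0 by (intro power_strict_increasing) auto
  have n_mono: "i \<le> j \<Longrightarrow> n i \<le> n j" for i j
    by (rule lift_Suc_mono_le[of n]) (rule less_imp_le[OF n_Suc])
  have n_add: "n0 + j \<le> n j" for j
  proof (induction j)
    case (Suc j)
    then show ?case using n_Suc[of j] by linarith
  qed (simp add: n_0)
  \<comment> \<open>Windows of length \<open>1 / n\<^sup>2\<close> cost only a factor
    \<open>exp (- 1 / n)\<close> over \<open>n\<close> levels. As all \<open>n j\<close> are powers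
    of \<open>n0\<close>, the grids are nested.\<close>
  define m where "m = (\<lambda>j. (n j)\<^sup>2)"
  have m_pos: "0 < m j" for j using n_pos[of j] by (simp add: m_def)
  have m_dvd: "m i dvd m j" if "i \<le> j" for i j
  proof -
    have "2 ^ i * 2 \<le> 2 ^ j * (2 :: nat)" using that by (intro mult_right_mono power_increasing) auto
    then show ?thesis unfolding m_def n_def power_mult[symmetric] by (rule le_imp_power_dvd)
  qed
  \<comment> \<open>The scale to which a level belongs; scale 0 collects the levels up to
    \<open>n0\<close>.\<close>
  define blk where "blk = (\<lambda>k. LEAST r. k \<le> n r)"
  have blk_le: "blk k \<le> j" if "k \<le> n j" for k j
    unfolding blk_def using that by (rule Least_le)
  have blk_n: "k \<le> n (blk k)" for k
    unfolding blk_def by (rule LeastI[of _ k]) (use n_add[of k] in linarith)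
  have blk_eq: "blk k = Suc j" if "n j < k" "k \<le> n (Suc j)" for k j
  proof -
    have "\<not> blk k \<le> j" using blk_n[of k] n_mono[of "blk k" j] that by linarith
    then show ?thesis using blk_le[OF that(2)] by linarith
  qed
  define l where "l = (\<lambda>t k. real_of_int \<lfloor>t * real (m (blk k))\<rfloor> / real (m (blk k)))"
  define u where "u = (\<lambda>t k. l t k + 1 / real (m (blk k)))"
  have lu: "0 \<le> l t k \<and> l t k \<le> u t k" if "0 \<le> t" for t k
    using that by (simp add: l_def u_def)
  have lt: "l t k \<le> t" "t \<le> u t k" for t k
  proof -
    have mr: "0 < real (m (blk k))" using m_pos by simp
    show "l t k \<le> t" unfolding l_def using mr by (simp add: pos_divide_le_eq)
    have "t * real (m (blk k)) \<le> real_of_int \<lfloor>t * real (m (blk k))\<rfloor> + 1" by linarith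
    then show "t \<le> u t k"
      unfolding u_def l_def add_divide_distrib[symmetric] using mr by (simp add: pos_le_divide_eq)
  qed
  define H where "H = (\<lambda>t. held n0 (l t) (u t))"
  define \<tau> where "\<tau> = (\<lambda>j i. real i / real (m (Suc j)))"
  have \<tau>0: "0 \<le> \<tau> j i" for j i by (simp add: \<tau>_def)
  define Bad where "Bad = (\<lambda>j i. {\<omega> \<in> space M. y j * w (n j) \<le> real (card (reach (H (\<tau> j i) \<omega>) (n j) \<rho>)) \<and>
      real (card (reach (H (\<tau> j i) \<omega>) (n (Suc j)) \<rho>)) < y (Suc j) * w (n (Suc j))})"
  have Bad: "Bad j i \<in> events" "prob (Bad j i) \<le> exp (- ((\<kappa> j)\<^sup>2 / (6 * \<sigma> j)))" for j i
  proof -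
    let ?\<delta> = "1 / real (m (Suc j))"
    have \<delta>n: "?\<delta> * real (n (Suc j)) = 1 / real (n (Suc j))"
      using n_pos[of "Suc j"] by (simp add: m_def power2_eq_square)
    have 1: "n0 \<le> n j" using n_add[of j] by linarith
    have 2: "n j \<le> n (Suc j)" using n_Suc[of j] by linarith
    have 3: "0 \<le> ?\<delta>" by simp
    have 4: "?\<delta> * real (n (Suc j)) \<le> 1" unfolding \<delta>n using n_pos[of "Suc j"] by simp
    have 5: "u (\<tau> j i) k - l (\<tau> j i) k \<le> ?\<delta>" if "n j < k" "k \<le> n (Suc j)" for k
      unfolding u_def blk_eq[OF that] by simp
    have 6: "0 < \<kappa> j" "\<kappa> j \<le> 1" "y j \<le> 1" "0 \<le> y (Suc j)" using \<kappa>[of j] y[of j] y[of "Suc j"] by auto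
    have 7: "y (Suc j) * exp (?\<delta> * real (n (Suc j))) \<le> y j - \<kappa> j" unfolding \<delta>n by (rule yy)
    show "Bad j i \<in> events"
      unfolding Bad_def H_def
      by (rule held_step(1)[OF lu[OF \<tau>0] 1 2 3 4 5 \<sigma> sum_w 6(1,2,3,4) 7])
    show "prob (Bad j i) \<le> exp (- ((\<kappa> j)\<^sup>2 / (6 * \<sigma> j)))"
      unfolding Bad_def H_def
      by (rule held_step(2)[OF lu[OF \<tau>0] 1 2 3 4 5 \<sigma> sum_w 6(1,2,3,4) 7])
  qed
  \<comment> \<open>The index \<open>L * m (Suc j)\<close> itself is included for the time
    \<open>t = L\<close>.\<close>
  define BL where "BL = (\<lambda>j. \<Union>i\<in>{..L * m (Suc j)}. Bad j i)"
  have BL_ev: "BL j \<in> events" for j unfolding BL_def using Bad(1) by blast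
  have BL_prob: "prob (BL j) \<le> \<epsilon> * (1 / 2) ^ Suc j" for j
  proof -
    let ?e = "exp (- ((\<kappa> j)\<^sup>2 / (6 * \<sigma> j)))"
    have "prob (BL j) \<le> (\<Sum>i\<in>{..L * m (Suc j)}. prob (Bad j i))"
      unfolding BL_def using Bad(1) by (intro finite_measure_subadditive_finite) auto
    also have "\<dots> \<le> (\<Sum>i\<in>{..L * m (Suc j)}. ?e)" by (rule sum_mono) (rule Bad(2))
    also have "\<dots> = (real L * real (m (Suc j)) + 1) * ?e" by simp
    also have "\<dots> \<le> ((real L + 1) * (real (n (Suc j)))\<^sup>2) * ?e"
    proof (rule mult_right_mono)
      have "1 \<le> real (m (Suc j))" using m_pos[of "Suc j"] by simp
      then show "real L * real (m (Suc j)) + 1 \<le> (real L + 1) * (real (n (Suc j)))\<^sup>2"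
        by (simp add: m_def algebra_simps)
    qed simp
    also have "\<dots> \<le> \<epsilon> * (1 / 2) ^ Suc j" by (rule small)
    finally show ?thesis .
  qed
  have geo: "(\<lambda>j. \<epsilon> * (1 / 2) ^ Suc j) sums (\<epsilon> * 1)" by (rule sums_mult) (rule power_half_series)
  have summ: "summable (\<lambda>j. prob (BL j))"
    by (rule summable_comparison_test'[OF sums_summable[OF geo], of 0]) (use BL_prob in auto)
  have "prob (\<Union>j. BL j) \<le> (\<Sum>j. prob (BL j))"
    by (rule finite_measure_subadditive_countably) (use BL_ev summ in auto)
  also have "\<dots> \<le> (\<Sum>j. \<epsilon> * (1 / 2) ^ Suc j)"
    by (rule suminf_le[OF BL_prob summ sums_summable[OF geo]])
  also have "\<dots> = \<epsilon>" using sums_unique[OF geo] by simp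
  finally have prob_bad: "prob (\<Union>j. BL j) \<le> \<epsilon>" .
  have "\<forall>t\<in>{0..real L}. \<exists>n0. \<forall>N. \<exists>M'\<ge>N. \<exists>b\<in>desc n0 \<rho>. reach (is_open t \<omega>) M' b \<noteq> {}"
    if \<omega>: "\<omega> \<in> space M - (\<Union>j. BL j)" for \<omega>
  proof
    fix t assume t: "t \<in> {0..real L}"
    have card: "y j * w (n j) \<le> real (card (reach (H t \<omega>) (n j) \<rho>))" for j
    proof (induction j)
      case 0
      have "reach (H t \<omega>) n0 \<rho> = reach (\<lambda>_. True) n0 \<rho>"
      proof (rule reach_cong)
        fix v assume "v \<in> below n0 \<rho>"
        then have "lev v \<le> n0" using below_lev[OF root_V] by (simp add: lev_root)
        then show "H t \<omega> v = True" using lu[of t] t by (simp add: H_def held_def)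
      qed
      then show ?case using w_le_card_desc[of n0] by (simp add: y0 n_0 reach_True)
    next
      case (Suc j)
      \<comment> \<open>The representative of the fine interval that contains
        \<open>t\<close>.\<close>
      define i where "i = nat \<lfloor>t * real (m (Suc j))\<rfloor>"
      have i: "real i = real_of_int \<lfloor>t * real (m (Suc j))\<rfloor>" using t by (simp add: i_def)
      have "i \<le> L * m (Suc j)"
      proof -
        have "t * real (m (Suc j)) \<le> real L * real (m (Suc j))" using t by (intro mult_right_mono) auto
        moreover have "real i \<le> t * real (m (Suc j))" unfolding i by linarith
        ultimately have "real i \<le> real (L * m (Suc j))" by simp
        then show ?thesis by (simp only: of_nat_le_iff)
      qed
      then have nb: "\<omega> \<notin> Bad j i" using \<omega> by (auto simp: BL_def)
      have l_eq: "l (\<tau> j i) k = l t k" if k: "k \<le> n (Suc j)" for k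
      proof -
        obtain d where d: "m (Suc j) = m (blk k) * d" using m_dvd[OF blk_le[OF k]] by (elim dvdE)
        have d0: "0 < d" using d m_pos[of "Suc j"] by (simp add: gr0I)
        have "\<tau> j i * real (m (blk k)) = real_of_int \<lfloor>t * real (m (blk k)) * real d\<rfloor> / real d"
          unfolding \<tau>_def i d using m_pos[of "blk k"] by (simp add: mult.assoc)
        then have "\<lfloor>\<tau> j i * real (m (blk k))\<rfloor> = \<lfloor>t * real (m (blk k))\<rfloor>"
          by (simp only: floor_of_floor_mult_divide[OF d0])
        then show ?thesis by (simp only: l_def)
      qed
      have R: "reach (H (\<tau> j i) \<omega>) N \<rho> = reach (H t \<omega>) N \<rho>" if "N \<le> n (Suc j)" for N
      proof (rule reach_cong)
        fix v assume "v \<in> below N \<rho>"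
        then have "lev v \<le> n (Suc j)" using below_lev[OF root_V, of v N] that by (simp add: lev_root)
        then show "H (\<tau> j i) \<omega> v = H t \<omega> v"
          using lu[of t] lu[OF \<tau>0[of j i]] t l_eq[of "lev v"] by (simp add: H_def held_def u_def)
      qed
      have "y j * w (n j) \<le> real (card (reach (H (\<tau> j i) \<omega>) (n j) \<rho>))"
        using Suc R[of "n j"] n_Suc[of j] by simp
      then have "\<not> real (card (reach (H (\<tau> j i) \<omega>) (n (Suc j)) \<rho>)) < y (Suc j) * w (n (Suc j))"
        using nb \<omega> by (simp add: Bad_def)
      then show ?case using R[of "n (Suc j)"] by simp
    qed
    have "\<exists>M'\<ge>N. \<exists>b\<in>desc n0 \<rho>. reach (is_open t \<omega>) M' b \<noteq> {}" for N
    proof -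
      define M' where "M' = n N - n0"
      have M': "N \<le> M'" "n N = n0 + M'" using n_add[of N] by (auto simp: M'_def)
      have "0 < y N * w (n N)" using y[of N] w_pos[of "n N"] by (intro mult_pos_pos) auto
      then have "reach (H t \<omega>) (n N) \<rho> \<noteq> {}" using card[of N] by auto
      then obtain b where b: "b \<in> reach (H t \<omega>) n0 \<rho>" "reach (H t \<omega>) M' b \<noteq> {}"
        unfolding M' reach_add by auto
      have bd: "b \<in> desc n0 \<rho>" using b(1) reach_subset_desc[of "H t \<omega>" n0 \<rho>] by (rule set_mp[rotated])
      have bV: "b \<in> V" "lev b = n0" using desc_V[OF root_V bd] desc_lev[OF root_V bd] by (auto simp: lev_root)
      have "reach (H t \<omega>) M' b \<subseteq> reach (is_open t \<omega>) M' b"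
      proof (rule reach_mono)
        fix v assume v: "v \<in> below M' b" "H t \<omega> v"
        have "n0 < lev v" using below_lev[OF bV(1) v(1)] bV(2) by simp
        then have "open_on (p (lev v)) (fst (st v \<omega>)) (snd (st v \<omega>)) (l t (lev v)) (u t (lev v))"
          using v(2) lu[of t] t by (simp add: H_def held_def)
        then show "is_open t \<omega> v"
          unfolding is_open_def by (rule open_on_imp_open_at) (use lt in auto)
      qed
      then show ?thesis using b(2) M'(1) bd by blast
    qed
    then show "\<exists>n0. \<forall>N. \<exists>M'\<ge>N. \<exists>b\<in>desc n0 \<rho>. reach (is_open t \<omega>) M' b \<noteq> {}" by blast
  qed
  moreover have "(\<Union>j. BL j) \<in> events" using BL_ev by blast
  ultimately show "\<exists>N\<in>events. prob N \<le> \<epsilon> \<and> (\<forall>\<omega>\<in>space M - N. \<forall>t\<in>{0..real L}.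
      \<exists>n0. \<forall>N. \<exists>M'\<ge>N. \<exists>b\<in>desc n0 \<rho>. reach (is_open t \<omega>) M' b \<noteq> {})"
    using prob_bad by (intro bexI[of _ "\<Union>j. BL j"] conjI) auto
qed

end


section \<open>Exceptional times by Baire category\<close>

context dyn_perc
begin

lemma AE_good_holding_times:
  "AE \<omega> in M. \<forall>v\<in>V - {\<rho>}. (\<forall>i. 0 < snd (st v \<omega>) i) \<and> (\<forall>n. \<exists>i\<ge>n. 1 < snd (st v \<omega>) i)"
proof -
  let ?g = "\<lambda>u :: nat \<Rightarrow> real. (\<forall>i. 0 < u i) \<and> (\<forall>n. \<exists>i\<ge>n. 1 < u i)"
  have g: "Measurable.pred holding_law ?g" by measurable
  have g': "Measurable.pred state_space (\<lambda>x. ?g (snd x))" by (rule pred_on_states) (rule g)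
  have "AE \<omega> in M. ?g (snd (st v \<omega>))" if v: "v \<in> V - {\<rho>}" for v
  proof -
    have "(\<integral>u. of_bool (?g u) \<partial>holding_law) = (\<integral>u. (1 :: real) \<partial>holding_law)"
      by (rule integral_cong_AE) (use g AE_holding_law in \<open>auto elim: AE_mp\<close>)
    then have 1: "(\<integral>u. of_bool (?g u) \<partial>holding_law) = (1 :: real)" by (simp add: prob_space.prob_space[OF prob_space_holding_law])
    have "measure (edge_law (lev v)) {x. ?g (snd x)} = 1"
      using chain.measure_edge_law[OF chain, of "\<lambda>_. ?g" "lev v"] g
      unfolding edge_law_def[symmetric] 1 by simp
    then have "prob {\<omega> \<in> space M. ?g (snd (st v \<omega>))} = 1"
      using st_prob(2)[OF v g'] by simp
    moreover have "{\<omega> \<in> space M. ?g (snd (st v \<omega>))} \<in> events" by (rule st_prob(1)[OF v g'])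
    ultimately have "AE \<omega> in M. \<omega> \<in> {\<omega> \<in> space M. ?g (snd (st v \<omega>))}"
      using prob_eq_1 by blast
    then show ?thesis by (rule AE_mp) simp
  qed
  moreover have "countable (V - {\<rho>})" using countable_V by simp
  ultimately show ?thesis by (subst AE_ball_countable) auto
qed

lemma AE_exists_dead_time:
  assumes \<alpha>: "\<alpha> > 1" and s: "\<And>k. k \<ge> 1 \<Longrightarrow> p k \<le> s" "0 < s" "s < 1"
    and C: "C > 0" "\<And>k. k \<ge> 3 \<Longrightarrow> w k \<le> C * real k * (ln (real k))\<^sup>2"
    and c: "c > 0" "\<And>k. k \<ge> 3 \<Longrightarrow> c * (real k * ln (real k) powr \<alpha>) \<le> w k"
    and x: "x \<in> V" and ab: "0 \<le> a" "a < b"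
  shows "AE \<omega> in M. \<exists>t\<in>{a..b}. \<exists>N. reach (is_open t \<omega>) N x = {}"
proof (rule AE_if_small)
  fix \<epsilon> :: real assume "0 < \<epsilon>"
  then have \<epsilon>: "0 < \<epsilon> / 3" by simp
  have len: "0 < b - a" using ab by simp
  have "\<exists>N T. finite T \<and> T \<subseteq> {a..a + (b - a)} \<and>
    {\<omega> \<in> space M. \<forall>t\<in>T. reach (is_open t \<omega>) N x \<noteq> {}} \<in> events \<and>
    prob {\<omega> \<in> space M. \<forall>t\<in>T. reach (is_open t \<omega>) N x \<noteq> {}} \<le> 3 * (\<epsilon> / 3)"
    by (rule dead_time_prob[OF \<alpha> s C c x ab(1) len \<epsilon>])
  then obtain N T where T: "finite T" "T \<subseteq> {a..a + (b - a)}"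
    "{\<omega> \<in> space M. \<forall>t\<in>T. reach (is_open t \<omega>) N x \<noteq> {}} \<in> events"
    "prob {\<omega> \<in> space M. \<forall>t\<in>T. reach (is_open t \<omega>) N x \<noteq> {}} \<le> 3 * (\<epsilon> / 3)"
    by (elim exE conjE)
  show "\<exists>N\<in>events. prob N \<le> \<epsilon> \<and> (\<forall>\<omega>\<in>space M - N. \<exists>t\<in>{a..b}. \<exists>N. reach (is_open t \<omega>) N x = {})"
  proof (rule bexI[OF _ T(3)], intro conjI ballI)
    show "prob {\<omega> \<in> space M. \<forall>t\<in>T. reach (is_open t \<omega>) N x \<noteq> {}} \<le> \<epsilon>" using T(4) by simp
    fix \<omega> assume "\<omega> \<in> space M - {\<omega> \<in> space M. \<forall>t\<in>T. reach (is_open t \<omega>) N x \<noteq> {}}"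
    then obtain t where "t \<in> T" "reach (is_open t \<omega>) N x = {}" by auto
    moreover have "t \<in> {a..b}" using T(2) \<open>t \<in> T\<close> by auto
    ultimately show "\<exists>t\<in>{a..b}. \<exists>N. reach (is_open t \<omega>) N x = {}" by (intro bexI exI)
  qed
qed

text \<open>Being cut off at depth \<open>N\<close> is witnessed by finitely many closed edges, and
  these stay closed in a common neighbourhood of the time. Openness is relative to the half-line
  because time 0 may be such a time.\<close>

lemma dead_times_open:
  assumes x: "x \<in> V"
    and good: "\<And>v. v \<in> V - {\<rho>} \<Longrightarrow> (\<forall>i. 0 < snd (st v \<omega>) i) \<and> (\<forall>n. \<exists>i\<ge>n. 1 < snd (st v \<omega>) i)"
  shows "openin (top_of_set {0..}) {t. 0 \<le> t \<and> (\<exists>N. reach (is_open t \<omega>) N x = {})}"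
  unfolding openin_euclidean_subtopology_iff
proof (intro conjI ballI)
  fix t assume "t \<in> {t. 0 \<le> t \<and> (\<exists>N. reach (is_open t \<omega>) N x = {})}"
  then obtain N where t: "0 \<le> t" and N: "reach (is_open t \<omega>) N x = {}" by auto
  define S where "S = {v \<in> below N x. \<not> is_open t \<omega> v}"
  have S: "finite S" unfolding S_def using below_fin[OF x, of N] by simp
  have "\<exists>\<epsilon>>0. \<forall>t'\<ge>0. \<bar>t' - t\<bar> < \<epsilon> \<longrightarrow> \<not> is_open t' \<omega> v" if v: "v \<in> S" for v
  proof -
    have 1: "v \<in> V - {\<rho>}" "\<not> is_open t \<omega> v" using v below_not_root[OF x, of N] by (auto simp: S_def)
    show ?thesis
      using chain.closed_times_open[OF chain, of "snd (st v \<omega>)" t "lev v" "fst (st v \<omega>)"] good[OF 1(1)] t 1(2)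
      unfolding is_open_def by simp
  qed
  then have "\<forall>v\<in>S. \<exists>\<epsilon>. 0 < \<epsilon> \<and> (\<forall>t'\<ge>0. \<bar>t' - t\<bar> < \<epsilon> \<longrightarrow> \<not> is_open t' \<omega> v)" by simp
  from bchoice[OF this] obtain \<epsilon> where
    "\<forall>v\<in>S. 0 < \<epsilon> v \<and> (\<forall>t'\<ge>0. \<bar>t' - t\<bar> < \<epsilon> v \<longrightarrow> \<not> is_open t' \<omega> v)" ..
  then have \<epsilon>: "\<And>v. v \<in> S \<Longrightarrow> 0 < \<epsilon> v" "\<And>v t'. v \<in> S \<Longrightarrow> 0 \<le> t' \<Longrightarrow> \<bar>t' - t\<bar> < \<epsilon> v \<Longrightarrow> \<not> is_open t' \<omega> v"
    by auto
  define e where "e = Min (insert 1 (\<epsilon> ` S))"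
  have e0: "0 < e" unfolding e_def using S \<epsilon>(1) by auto
  have eS: "e \<le> \<epsilon> v" if "v \<in> S" for v unfolding e_def using S that by auto
  have dead: "reach (is_open t' \<omega>) N x = {}" if t': "0 \<le> t'" "\<bar>t' - t\<bar> < e" for t'
  proof -
    have "reach (is_open t' \<omega>) N x \<subseteq> reach (is_open t \<omega>) N x"
    proof (rule reach_mono, rule ccontr)
      fix v assume v: "v \<in> below N x" "is_open t' \<omega> v" "\<not> is_open t \<omega> v"
      then have vS: "v \<in> S" by (simp add: S_def)
      have "\<bar>t' - t\<bar> < \<epsilon> v" using eS[OF vS] t'(2) by linarith
      then show False using \<epsilon>(2)[OF vS t'(1)] v(2) by simp
    qed
    then show ?thesis using N by simp
  qed
  show "\<exists>e>0. \<forall>t'\<in>{0..}. dist t' t < e \<longrightarrow> t' \<in> {t. 0 \<le> t \<and> (\<exists>N. reach (is_open t \<omega>) N x = {})}"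
  proof (intro exI[of _ e] conjI ballI impI e0)
    fix t' :: real assume "t' \<in> {0..}" "dist t' t < e"
    then have "0 \<le> t'" "reach (is_open t' \<omega>) N x = {}" using dead[of t'] by (auto simp: dist_real_def)
    then show "t' \<in> {t. 0 \<le> t \<and> (\<exists>N. reach (is_open t \<omega>) N x = {})}" by auto
  qed
qed auto

lemma exceptional_time:
  assumes \<alpha>: "\<alpha> > 1" and s: "\<And>k. k \<ge> 1 \<Longrightarrow> p k \<le> s" "0 < s" "s < 1"
    and C: "C > 0" "\<And>k. k \<ge> 3 \<Longrightarrow> w k \<le> C * real k * (ln (real k))\<^sup>2"
    and c: "c > 0" "\<And>k. k \<ge> 3 \<Longrightarrow> c * (real k * ln (real k) powr \<alpha>) \<le> w k"
  shows "AE \<omega> in M. \<exists>t\<ge>0. \<forall>x\<in>V. \<exists>N. reach (is_open t \<omega>) N x = {}"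
proof -
  \<comment> \<open>Rational end points leave countably many almost sure events, enough for
    density.\<close>
  define I where "I = {(a, b) \<in> \<rat> \<times> \<rat>. 0 \<le> a \<and> a < (b :: real)}"
  have I: "countable I" unfolding I_def by (rule countable_subset[of _ "\<rat> \<times> \<rat>"]) (auto simp: countable_rat)
  have "AE \<omega> in M. \<forall>z\<in>V \<times> I. \<exists>t\<in>{fst (snd z)..snd (snd z)}. \<exists>N. reach (is_open t \<omega>) N (fst z) = {}"
  proof (subst AE_ball_countable)
    show "countable (V \<times> I)" using countable_V I by simp
    show "\<forall>z\<in>V \<times> I. AE \<omega> in M. \<exists>t\<in>{fst (snd z)..snd (snd z)}. \<exists>N. reach (is_open t \<omega>) N (fst z) = {}"
    proof
      fix z assume "z \<in> V \<times> I"
      then have z: "fst z \<in> V" "0 \<le> fst (snd z)" "fst (snd z) < snd (snd z)" by (auto simp: I_def)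
      show "AE \<omega> in M. \<exists>t\<in>{fst (snd z)..snd (snd z)}. \<exists>N. reach (is_open t \<omega>) N (fst z) = {}"
        by (rule AE_exists_dead_time[OF \<alpha> s C c z])
    qed
  qed
  then show ?thesis
    using AE_good_holding_times
  proof eventually_elim
    case (elim \<omega>)
    define D where "D = (\<lambda>x. {t. 0 \<le> t \<and> (\<exists>N. reach (is_open t \<omega>) N x = {})})"
    have D_open: "openin (top_of_set {0..}) (D x)" if "x \<in> V" for x
      unfolding D_def using that elim(2) by (intro dead_times_open) auto
    have D_hit: "\<exists>t\<in>D x. a \<le> t \<and> t \<le> b" if x: "x \<in> V" and ab: "0 \<le> a" "a < b" for x a b
    proof -
      obtain a' where a': "a' \<in> \<rat>" "a < a'" "a' < b" using Rats_dense_in_real[OF ab(2)] by auto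
      obtain b' where b': "b' \<in> \<rat>" "a' < b'" "b' < b" using Rats_dense_in_real[OF a'(3)] by auto
      have "(x, a', b') \<in> V \<times> I" using x a' b' ab by (simp add: I_def)
      from bspec[OF elim(1) this] obtain t N where t: "t \<in> {a'..b'}" "reach (is_open t \<omega>) N x = {}" by auto
      have "t \<in> D x" using t a' ab unfolding D_def by auto
      then show ?thesis using t a' b' by (intro bexI[of _ t]) auto
    qed
    have D_dense: "top_of_set {0..} closure_of D x = topspace (top_of_set {0..})" if x: "x \<in> V" for x
    proof
      show "topspace (top_of_set {0..}) \<subseteq> top_of_set {0..} closure_of D x"
      proof
        fix t :: real assume "t \<in> topspace (top_of_set {0..})"
        then have t: "0 \<le> t" by simp
        have "t \<in> closure (D x)"
          unfolding closure_approachable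
        proof (intro allI impI)
          fix e :: real assume e: "0 < e"
          obtain r where r: "r \<in> D x" "t \<le> r" "r \<le> t + e / 2" using D_hit[OF x t, of "t + e / 2"] e by auto
          then show "\<exists>y\<in>D x. dist y t < e" using e by (intro bexI[of _ r]) (auto simp: dist_real_def)
        qed
        moreover have "D x \<subseteq> {0..}" by (auto simp: D_def)
        ultimately show "t \<in> top_of_set {0..} closure_of D x"
          using t by (simp add: closure_of_subtopology Int_absorb1)
      qed
    qed (rule closure_of_subset_topspace)
    have cm: "completely_metrizable_space (top_of_set {0 :: real ..})"
      by (intro completely_metrizable_space_closedin completely_metrizable_space_euclidean) simp
    have "top_of_set {0..} closure_of \<Inter>(D ` V) = topspace (top_of_set {0..})"
    proof (rule Baire_category)
      show "completely_metrizable_space (top_of_set {0 :: real ..}) \<or>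
          locally_compact_space (top_of_set {0 :: real ..}) \<and> regular_space (top_of_set {0 :: real ..})"
        using cm by simp
      show "countable (D ` V)" using countable_V by simp
      show "openin (top_of_set {0..}) T \<and> top_of_set {0..} closure_of T = topspace (top_of_set {0..})"
        if "T \<in> D ` V" for T
        using that D_open D_dense by auto
    qed
    then have "\<Inter>(D ` V) \<noteq> {}" by (auto simp: closure_of_empty)
    then obtain t where "t \<in> \<Inter>(D ` V)" by auto
    then have t: "t \<in> D x" if "x \<in> V" for x using that by auto
    show ?case
    proof (intro exI[of _ t] conjI ballI)
      show "0 \<le> t" using t[OF root_V] by (simp add: D_def)
      show "\<exists>N. reach (is_open t \<omega>) N x = {}" if "x \<in> V" for x using t[OF that] by (simp add: D_def)
    qed
  qed
qed

end


theorem theorem1p2: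
  fixes V :: "'v set" and E :: "'v set set" and \<rho> :: 'v and p :: "nat \<Rightarrow> real"
    and M :: "'w measure" and X :: "'v set \<Rightarrow> real \<Rightarrow> 'w \<Rightarrow> bool"
  assumes tree: "spherically_symmetric_tree V E \<rho>"
    and prob: "\<And>n. n \<ge> 1 \<Longrightarrow> 0 \<le> p n \<and> p n \<le> 1"
    and inf_pos: "0 < (INF n\<in>{1..}. p n)"
    and sup_less: "(SUP n\<in>{1..}. p n) < 1"
    and dyn: "dynamical_percolation E \<rho> p M X"
  shows "((\<exists>\<alpha>>2. filterlim (\<lambda>n. w_perc V E \<rho> p n / (real n * ln (real n) powr \<alpha>)) at_top sequentially)
            \<longrightarrow> (AE \<omega> in M. \<forall>t\<ge>0. percolates V (open_edges E X t \<omega>)))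
       \<and> ((\<exists>\<alpha>. 1 < \<alpha> \<and> \<alpha> \<le> 2 \<and>
             (\<exists>c C. 0 < c \<and> 0 < C \<and>
                (\<forall>n\<ge>2. c \<le> w_perc V E \<rho> p n / (real n * ln (real n) powr \<alpha>) \<and>
                        w_perc V E \<rho> p n / (real n * ln (real n) powr \<alpha>) \<le> C)))
            \<longrightarrow> (AE \<omega> in M. \<exists>t\<ge>0. \<not> percolates V (open_edges E X t \<omega>)))"
proof -
  interpret sph_tree V E \<rho> by unfold_locales (rule tree)
  define s where "s = max (1 / 2) (SUP n\<in>{1..}. p n)"
  have s: "0 < s" "s < 1" using sup_less by (auto simp: s_def)
  have bdd: "bdd_below (p ` {1..})" "bdd_above (p ` {1..})"
    using prob by (auto intro!: bdd_belowI[of _ 0] bdd_aboveI[of _ 1])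
  have p_pos: "0 < p k" if "k \<ge> 1" for k
    using cINF_lower[OF bdd(1), of k] inf_pos that by simp
  have p_le: "p k \<le> s" if "k \<ge> 1" for k
    using cSUP_upper[OF _ bdd(2), of k] that by (simp add: s_def)
  \<comment> \<open>The unused value \<open>p 0\<close> is arbitrary; replace it by an admissible one.\<close>
  define q where "q = (\<lambda>k. if k = 0 then 1 / 2 else p k)"
  have q01: "0 < q k" "q k < 1" for k
    using p_pos[of k] p_le[of k] s by (auto simp: q_def)
  have q_level: "q (edge_level E \<rho> e) = p (edge_level E \<rho> e)" if "e \<in> E" for e
  proof -
    obtain v where v: "v \<in> V" "v \<noteq> \<rho>" "e = uedge v" by (rule edge_uedge[OF \<open>e \<in> E\<close>])
    have "lev v \<noteq> 0" using lev_0[OF v(1)] v(2) by auto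
    then show ?thesis using uedge_level[OF v(1,2)] v(3) by (simp add: q_def)
  qed
  have "prob_space M" using dyn by (simp add: dynamical_percolation_def)
  then interpret prob_space M .
  have "\<exists>(B :: 'v set \<Rightarrow> 'w \<Rightarrow> bool) (U :: 'v set \<Rightarrow> 'w \<Rightarrow> nat \<Rightarrow> real).
        indep_vars (\<lambda>_. state_space) (\<lambda>e \<omega>. (B e \<omega>, U e \<omega>)) E \<and>
        (\<forall>e\<in>E. distr M state_space (\<lambda>\<omega>. (B e \<omega>, U e \<omega>)) =
           measure_pmf (bernoulli_pmf (p (edge_level E \<rho> e))) \<Otimes>\<^sub>M holding_law) \<and>
        (AE \<omega> in M. \<forall>e\<in>E. \<forall>t\<ge>0. X e t \<omega> \<longleftrightarrow> open_at (p (edge_level E \<rho> e)) (B e \<omega>) (U e \<omega>) t)"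
    using dyn unfolding dynamical_percolation_def by (elim conjE)
  then obtain B :: "'v set \<Rightarrow> 'w \<Rightarrow> bool" and U :: "'v set \<Rightarrow> 'w \<Rightarrow> nat \<Rightarrow> real" where
    ind: "indep_vars (\<lambda>_. state_space) (\<lambda>e \<omega>. (B e \<omega>, U e \<omega>)) E"
    and law: "\<forall>e\<in>E. distr M state_space (\<lambda>\<omega>. (B e \<omega>, U e \<omega>)) =
           measure_pmf (bernoulli_pmf (p (edge_level E \<rho> e))) \<Otimes>\<^sub>M holding_law"
    and X: "AE \<omega> in M. \<forall>e\<in>E. \<forall>t\<ge>0. X e t \<omega> \<longleftrightarrow> open_at (p (edge_level E \<rho> e)) (B e \<omega>) (U e \<omega>) t"
    by (elim exE conjE)
  interpret dyn_perc V E \<rho> M q B U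
  proof unfold_locales
    show "distr M state_space (\<lambda>\<omega>. (B e \<omega>, U e \<omega>)) =
       measure_pmf (bernoulli_pmf (q (edge_level E \<rho> e))) \<Otimes>\<^sub>M holding_law" if "e \<in> E" for e
      using bspec[OF law that] q_level[OF that] by simp
  qed (use q01 dg_ge_1 ind in auto)
  have w_eq: "w_perc V E \<rho> p n = w n" for n
  proof -
    have "w_perc V E \<rho> p n = (\<Prod>i<n. real (dg i) * p (Suc i))"
      by (rule w_perc_eq) (use prob in auto)
    then show ?thesis unfolding w_def by (simp add: q_def)
  qed
  \<comment> \<open>The given process agrees with the one built from \<open>B\<close> and
    \<open>U\<close> at all times simultaneously, outside one null set.\<close>
  have X': "AE \<omega> in M. \<forall>t\<ge>0. \<forall>v\<in>V - {\<rho>}. uedge v \<in> open_edges E X t \<omega> \<longleftrightarrow> is_open t \<omega> v"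
    using X
  proof eventually_elim
    case (elim \<omega>)
    show ?case
    proof (intro allI impI ballI)
      fix t :: real and v assume t: "0 \<le> t" and v: "v \<in> V - {\<rho>}"
      have e: "uedge v \<in> E" using uedge_E v by simp
      have "X (uedge v) t \<omega> \<longleftrightarrow> open_at (q (lev v)) (B (uedge v) \<omega>) (U (uedge v) \<omega>) t"
        using elim e t q_level[OF e] uedge_level[of v] v by simp
      then show "uedge v \<in> open_edges E X t \<omega> \<longleftrightarrow> is_open t \<omega> v"
        using e by (simp add: open_edges_def is_open_def st_def)
    qed
  qed
  have reach_eq: "reach (\<lambda>v. uedge v \<in> open_edges E X t \<omega>) N x = reach (is_open t \<omega>) N x"
    if "\<forall>t\<ge>0. \<forall>v\<in>V - {\<rho>}. uedge v \<in> open_edges E X t \<omega> \<longleftrightarrow> is_open t \<omega> v" "0 \<le> t" "x \<in> V" for t \<omega> N x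
  proof (rule reach_cong)
    fix v assume "v \<in> below N x"
    then have "v \<in> V - {\<rho>}" using below_not_root[OF \<open>x \<in> V\<close>, of N] by (rule set_mp[rotated])
    then show "(uedge v \<in> open_edges E X t \<omega>) = is_open t \<omega> v"
      using that(1,2) by simp
  qed
  have open_E: "open_edges E X t \<omega> \<subseteq> E" for t \<omega> by (auto simp: open_edges_def)
  show ?thesis
  proof (intro conjI impI)
    assume "\<exists>\<alpha>>2. filterlim (\<lambda>n. w_perc V E \<rho> p n / (real n * ln (real n) powr \<alpha>)) at_top sequentially"
    then obtain \<alpha> where \<alpha>: "2 < \<alpha>"
      and lim: "filterlim (\<lambda>n. w n / (real n * ln (real n) powr \<alpha>)) at_top sequentially"
      unfolding w_eq by blast
    \<comment> \<open>\<open>scale_sequence\<close> takes exponents up to 3; lowering the exponent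
      only weakens the lower bound on \<open>w\<close>.\<close>
    define \<beta> where "\<beta> = min \<alpha> 3"
    have \<beta>: "2 < \<beta>" "\<beta> \<le> 3" "\<beta> \<le> \<alpha>" using \<alpha> by (auto simp: \<beta>_def)
    have "eventually (\<lambda>n. 1 \<le> w n / (real n * ln (real n) powr \<alpha>)) sequentially"
      using lim by (simp add: filterlim_at_top)
    then obtain k1 where k1: "\<And>k. k \<ge> k1 \<Longrightarrow> 1 \<le> w k / (real k * ln (real k) powr \<alpha>)"
      by (auto simp: eventually_sequentially)
    have wl: "real k * ln (real k) powr \<beta> \<le> w k" if "k \<ge> max k1 3" for k
    proof -
      have k: "k \<ge> k1" "k \<ge> 3" using that by auto
      have ln1: "1 \<le> ln (real k)" by (rule one_le_ln[OF k(2)])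
      have "0 < real k * ln (real k) powr \<alpha>" using k ln1 by simp
      then have "real k * ln (real k) powr \<alpha> \<le> w k" using k1[OF k(1)] by (simp add: pos_le_divide_eq)
      moreover have "real k * ln (real k) powr \<beta> \<le> real k * ln (real k) powr \<alpha>"
        using ln1 \<beta>(3) by (intro mult_left_mono powr_mono) auto
      ultimately show ?thesis by linarith
    qed
    have "AE \<omega> in M. \<forall>L :: nat. \<forall>t\<in>{0..real L}. \<exists>n0. \<forall>N. \<exists>M'\<ge>N. \<exists>b\<in>desc n0 \<rho>. reach (is_open t \<omega>) M' b \<noteq> {}"
      unfolding AE_all_countable
      by (rule allI) (rule no_exceptional_times[OF \<beta>(1,2) wl])
    then show "AE \<omega> in M. \<forall>t\<ge>0. percolates V (open_edges E X t \<omega>)"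
      using X'
    proof eventually_elim
      case (elim \<omega>)
      show ?case
      proof (intro allI impI)
        fix t :: real assume t: "0 \<le> t"
        obtain L :: nat where "t \<le> real L" using real_arch_simple by blast
        then have "t \<in> {0..real L}" using t by simp
        from bspec[OF spec[OF elim(1)] this] obtain n0 where
          n0: "\<forall>N. \<exists>M'\<ge>N. \<exists>b\<in>desc n0 \<rho>. reach (is_open t \<omega>) M' b \<noteq> {}" ..
        show "percolates V (open_edges E X t \<omega>)"
        proof (rule reach_imp_percolates)
          show "finite (desc n0 \<rho>)" by (rule desc_fin[OF root_V])
          show "desc n0 \<rho> \<subseteq> V" using desc_V[OF root_V] by (rule subsetI)
          show "\<exists>M'\<ge>N. \<exists>z\<in>desc n0 \<rho>. reach (\<lambda>v. uedge v \<in> open_edges E X t \<omega>) M' z \<noteq> {}" for N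
          proof -
            obtain M' b where b: "N \<le> M'" "b \<in> desc n0 \<rho>" "reach (is_open t \<omega>) M' b \<noteq> {}"
              using spec[OF n0, of N] by (elim exE conjE bexE)
            have "reach (\<lambda>v. uedge v \<in> open_edges E X t \<omega>) M' b \<noteq> {}"
              using b(3) reach_eq[OF elim(2) t desc_V[OF root_V b(2)], of M'] by simp
            then show ?thesis using b(1,2) by (intro exI[of _ M'] conjI bexI[of _ b])
          qed
        qed
      qed
    qed
  next
    assume "\<exists>\<alpha>. 1 < \<alpha> \<and> \<alpha> \<le> 2 \<and>
             (\<exists>c C. 0 < c \<and> 0 < C \<and>
                (\<forall>n\<ge>2. c \<le> w_perc V E \<rho> p n / (real n * ln (real n) powr \<alpha>) \<and>
                        w_perc V E \<rho> p n / (real n * ln (real n) powr \<alpha>) \<le> C))"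
    then obtain \<alpha> c C where \<alpha>: "1 < \<alpha>" "\<alpha> \<le> 2" and c: "0 < c" and C: "0 < C"
      and b: "\<forall>n\<ge>2. c \<le> w n / (real n * ln (real n) powr \<alpha>) \<and> w n / (real n * ln (real n) powr \<alpha>) \<le> C"
      unfolding w_eq by (elim exE conjE)
    \<comment> \<open>\<alpha> \<le> 2 enters only through the upper bound with the squared
      logarithm; the lower bound keeps \<alpha>, whose excess over 1 makes the sum of
      \<open>1 / w\<close> converge.\<close>
    have bounds: "c * (real k * ln (real k) powr \<alpha>) \<le> w k" "w k \<le> C * real k * (ln (real k))\<^sup>2" if "k \<ge> 3" for k
    proof -
      have ln1: "1 \<le> ln (real k)" by (rule one_le_ln[OF that])
      have pos: "0 < real k * ln (real k) powr \<alpha>" using that ln1 by simp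
      have b': "c \<le> w k / (real k * ln (real k) powr \<alpha>)" "w k / (real k * ln (real k) powr \<alpha>) \<le> C"
        using b that by auto
      show "c * (real k * ln (real k) powr \<alpha>) \<le> w k" using b'(1) pos by (simp add: pos_le_divide_eq)
      have "w k \<le> C * (real k * ln (real k) powr \<alpha>)" using b'(2) pos by (simp add: pos_divide_le_eq)
      also have "\<dots> \<le> C * (real k * ln (real k) powr 2)"
        using ln1 \<alpha> C by (intro mult_left_mono powr_mono) auto
      also have "ln (real k) powr 2 = (ln (real k))\<^sup>2" using ln1 by simp
      finally show "w k \<le> C * real k * (ln (real k))\<^sup>2" by (simp add: mult.assoc)
    qed
    have qs: "q k \<le> s" if "k \<ge> 1" for k using p_le[OF that] that by (simp add: q_def)
    have "AE \<omega> in M. \<exists>t\<ge>0. \<forall>x\<in>V. \<exists>N. reach (is_open t \<omega>) N x = {}"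
      by (rule exceptional_time[OF \<alpha>(1) qs s C bounds(2) c bounds(1)])
    then show "AE \<omega> in M. \<exists>t\<ge>0. \<not> percolates V (open_edges E X t \<omega>)"
      using X'
    proof eventually_elim
      case (elim \<omega>)
      from elim(1) obtain t where t: "0 \<le> t" and dead: "\<forall>x\<in>V. \<exists>N. reach (is_open t \<omega>) N x = {}"
        by (elim exE conjE)
      have "\<not> percolates V (open_edges E X t \<omega>)"
      proof
        assume "percolates V (open_edges E X t \<omega>)"
        then have "\<exists>z\<in>V. \<forall>N. reach (\<lambda>v. uedge v \<in> open_edges E X t \<omega>) N z \<noteq> {}"
          by (rule percolates_imp_reach[OF open_E])
        then obtain z where z: "z \<in> V" "\<forall>N. reach (\<lambda>v. uedge v \<in> open_edges E X t \<omega>) N z \<noteq> {}" ..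
        obtain N where "reach (is_open t \<omega>) N z = {}" using bspec[OF dead z(1)] ..
        then show False using spec[OF z(2), of N] reach_eq[OF elim(2) t z(1), of N] by simp
      qed
      then show ?case using t by (intro exI[of _ t] conjI)
    qed
  qed
qed

end
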